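(* Let $X$ be a separable infinite-dimensional Banach space such that $SP_w(X)$ is countable and such that $SP_w(Y^* )$ is countable for every infinite-dimensional closed subspace $Y$ of $X$. Then every spreading model $(\tilde e_i)$ of $X$ generated by a normalized weakly null sequence is equivalent to the unit vector basis of $c_0$ or of $\ell_p$ for some $1\le p<\infty$.
   Context: A normalized basic sequence $(x_i)$ in a Banach space $X$ generates a spreading model $(\tilde x_i)$ if there exist $\varepsilon_n\downarrow 0$ such that for all $n$, all $(a_i)_{i=1}^n\subseteq[-1,1]$ and all $n\le k_1<\cdots<k_n$, $(1+\varepsilon_n)^{-1}\|\sum_{i=1}^n a_i\tilde x_i\|\le\|\sum_{i=1}^n a_ix_{k_i}\|\le(1+\varepsilon_n)\|\sum_{i=1}^n a_i\tilde x_i\|$. Two sequences $(u_i),(v_i)$ are equivalent if there is $C<\infty$ with $C^{-1}\|\sum a_iv_i\|\le\|\sum a_iu_i\|\le C\|\sum a_iv_i\|$ for all finitely supported scalars $(a_i)$. $SP_w(Z)$ denotes the set of equivalence classes of spreading models generated by normalized weakly null sequences in the Banach space $Z$. *)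

theory Defs
  imports "HOL-Analysis.Analysis" "HOL-Library.Function_Algebras"
begin

text \<open>Used to represent the dual space Y* of a closed subspace Y of X as a set of
  real-valued functions on X (linear and bounded on Y, zero off Y).\<close>

instantiation "fun" :: (type, real_vector) real_vector
begin
definition scaleR_fun :: "real \<Rightarrow> ('a \<Rightarrow> 'b) \<Rightarrow> 'a \<Rightarrow> 'b" where
  "scaleR_fun c f = (\<lambda>x. c *\<^sub>R f x)"
instance by standard (auto simp: scaleR_fun_def fun_eq_iff scaleR_add_right scaleR_add_left)
end

section \<open>Abstract normed spaces: a carrier V (a linear subspace) with a norm N\<close>

definition bdd_lin_functional :: "'v::real_vector set \<Rightarrow> ('v \<Rightarrow> real) \<Rightarrow> ('v \<Rightarrow> real) \<Rightarrow> bool" where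
  "bdd_lin_functional V N \<Phi> \<longleftrightarrow>
     (\<forall>x\<in>V. \<forall>y\<in>V. \<Phi> (x + y) = \<Phi> x + \<Phi> y) \<and>
     (\<forall>x\<in>V. \<forall>c. \<Phi> (c *\<^sub>R x) = c * \<Phi> x) \<and>
     (\<exists>K. \<forall>x\<in>V. \<bar>\<Phi> x\<bar> \<le> K * N x)"

definition weakly_null :: "'v::real_vector set \<Rightarrow> ('v \<Rightarrow> real) \<Rightarrow> (nat \<Rightarrow> 'v) \<Rightarrow> bool" where
  "weakly_null V N x \<longleftrightarrow> (\<forall>i. x i \<in> V) \<and>
     (\<forall>\<Phi>. bdd_lin_functional V N \<Phi> \<longrightarrow> (\<lambda>n. \<Phi> (x n)) \<longlonglongrightarrow> 0)"

definition closed_span_seq :: "'v::real_vector set \<Rightarrow> ('v \<Rightarrow> real) \<Rightarrow> (nat \<Rightarrow> 'v) \<Rightarrow> 'v set" where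
  "closed_span_seq V N x = {y \<in> V. \<forall>\<epsilon>>0. \<exists>n c. N (y - (\<Sum>i<n. c i *\<^sub>R x i)) < \<epsilon>}"

definition basic_seq :: "'v::real_vector set \<Rightarrow> ('v \<Rightarrow> real) \<Rightarrow> (nat \<Rightarrow> 'v) \<Rightarrow> bool" where
  "basic_seq V N x \<longleftrightarrow> (\<forall>i. x i \<in> V) \<and>
     (\<forall>y\<in>closed_span_seq V N x. \<exists>!c. (\<lambda>n. N (y - (\<Sum>i<n. c i *\<^sub>R x i))) \<longlonglongrightarrow> 0)"

definition normalized_basic :: "'v::real_vector set \<Rightarrow> ('v \<Rightarrow> real) \<Rightarrow> (nat \<Rightarrow> 'v) \<Rightarrow> bool" where
  "normalized_basic V N x \<longleftrightarrow> basic_seq V N x \<and> (\<forall>i. N (x i) = 1)"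

text \<open>A sequence (u_i) in a normed space is recorded through its norm function on finitely
  supported scalar sequences: a \<mapsto> norm (sum a_i u_i).  Sequences are indexed from 0.\<close>
definition seq_norm :: "(nat \<Rightarrow> 'e::real_normed_vector) \<Rightarrow> (nat \<Rightarrow> real) \<Rightarrow> real" where
  "seq_norm u = (\<lambda>a. norm (\<Sum>i\<in>{i. a i \<noteq> 0}. a i *\<^sub>R u i))"

text \<open>S is a seminorm on finitely supported sequences (i.e. S = seq_norm u for some sequence u
  in some normed space).\<close>
definition c00_seminorm :: "((nat \<Rightarrow> real) \<Rightarrow> real) \<Rightarrow> bool" where
  "c00_seminorm S \<longleftrightarrow>
     (\<forall>a b. finite {i. a i \<noteq> 0} \<longrightarrow> finite {i. b i \<noteq> 0} \<longrightarrow>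
        S (\<lambda>i. a i + b i) \<le> S a + S b) \<and>
     (\<forall>a c. finite {i. a i \<noteq> 0} \<longrightarrow> S (\<lambda>i. c * a i) = \<bar>c\<bar> * S a)"

text \<open>The normalized basic sequence x in (V, N) generates the spreading model whose norm
  function is S (the paper's definition, with indices shifted to start at 0).\<close>
definition generates_sm :: "'v::real_vector set \<Rightarrow> ('v \<Rightarrow> real) \<Rightarrow> (nat \<Rightarrow> 'v)
    \<Rightarrow> ((nat \<Rightarrow> real) \<Rightarrow> real) \<Rightarrow> bool" where
  "generates_sm V N x S \<longleftrightarrow> normalized_basic V N x \<and>
     (\<exists>\<epsilon>::nat \<Rightarrow> real. decseq \<epsilon> \<and> \<epsilon> \<longlonglongrightarrow> 0 \<and> (\<forall>n. \<epsilon> n > 0) \<and>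
       (\<forall>n (a::nat \<Rightarrow> real) (k::nat \<Rightarrow> nat).
          (\<forall>i<n. \<bar>a i\<bar> \<le> 1) \<and> strict_mono_on {..<n} k \<and> (0 < n \<longrightarrow> n \<le> k 0) \<longrightarrow>
          (let s = S (\<lambda>i. if i < n then a i else 0);
               t = N (\<Sum>i<n. a i *\<^sub>R x (k i))
           in inverse (1 + \<epsilon> n) * s \<le> t \<and> t \<le> (1 + \<epsilon> n) * s)))"

definition sm_equiv :: "((nat \<Rightarrow> real) \<Rightarrow> real) \<Rightarrow> ((nat \<Rightarrow> real) \<Rightarrow> real) \<Rightarrow> bool" where
  "sm_equiv S T \<longleftrightarrow> (\<exists>C. 0 < C \<and> (\<forall>a. finite {i. a i \<noteq> 0} \<longrightarrow>
       inverse C * T a \<le> S a \<and> S a \<le> C * T a))"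

definition SPw :: "'v::real_vector set \<Rightarrow> ('v \<Rightarrow> real) \<Rightarrow> ((nat \<Rightarrow> real) \<Rightarrow> real) set set" where
  "SPw V N = {{T. c00_seminorm T \<and> sm_equiv S T} | S. c00_seminorm S \<and>
       (\<exists>x. weakly_null V N x \<and> generates_sm V N x S)}"

definition c0_norm :: "(nat \<Rightarrow> real) \<Rightarrow> real" where
  "c0_norm a = Sup ((\<lambda>i. \<bar>a i\<bar>) ` UNIV)"

definition lp_norm :: "real \<Rightarrow> (nat \<Rightarrow> real) \<Rightarrow> real" where
  "lp_norm p a = (\<Sum>i\<in>{i. a i \<noteq> 0}. \<bar>a i\<bar> powr p) powr (1 / p)"

definition separable_space :: "'a::metric_space set \<Rightarrow> bool" where
  "separable_space S \<longleftrightarrow> (\<exists>D. countable D \<and> D \<subseteq> S \<and> S \<subseteq> closure D)"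

definition infinite_dim :: "'a::real_vector set \<Rightarrow> bool" where
  "infinite_dim Y \<longleftrightarrow> \<not> (\<exists>B. finite B \<and> span B = Y)"

text \<open>The dual Y* of a linear subspace Y of X: bounded linear functionals on Y, each
  represented by the unique extension that vanishes off Y; with the dual norm.\<close>
definition dual_space :: "'a::real_normed_vector set \<Rightarrow> ('a \<Rightarrow> real) set" where
  "dual_space Y = {f. bdd_lin_functional Y norm f \<and> (\<forall>x. x \<notin> Y \<longrightarrow> f x = 0)}"

definition dual_norm :: "'a::real_normed_vector set \<Rightarrow> ('a \<Rightarrow> real) \<Rightarrow> real" where
  "dual_norm Y f = Sup ({\<bar>f y\<bar> | y. y \<in> Y \<and> norm y \<le> 1})"

end

theory Submission
  imports Defs
begin

text \<open>Let \<open>S\<close> be the norm of the spreading model. Passing to a subsequence, the generating sequence has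
  uniformly bounded coordinate projections onto Schreier sets, so that its biorthogonal functionals
  in the dual of its closed span generate a spreading model equivalent to the dual norm of \<open>S\<close>.
  Countability of the set of spreading models forces \<open>S (a \<otimes> b) \<le> E * S a * S b\<close>: otherwise blocks
  with suitable infinite coefficient vectors, indexed by an almost disjoint family of sets of integers,
  give uncountably many inequivalent spreading models. The same argument in the dual gives the reverse
  inequality, unless the biorthogonal functionals are not weakly null, in which case \<open>S\<close> is
  equivalent to the norm of \<open>c\<^sub>0\<close>. Finally \<open>S (a \<otimes> b) \<approx> S a * S b\<close> makes \<open>S (1, \<dots>, 1)\<close> grow like a power
  of the length, and comparing \<open>S\<close> with the norm of \<open>\<ell>\<^sub>p\<close> on the tensor powers of \<open>a\<close>, which take only
  polynomially many values, gives the equivalence.\<close>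

text \<open>A spreading model, however, only sees index sets with at most as many elements as their
  least element, and projections onto those can be controlled. The same control bounds the
  restriction of an arbitrary vector to such a set, and that is what estimates the biorthogonal
  functionals from above. Everything is proved up to constants, because only equivalence classes are
  counted; this lets one argument serve the space and its dual. In the blocks that code a set of
  integers, a later level carries so small a weight that it does not disturb the tests of earlier
  levels, while its tensor norm is so large that in its own test it still beats all earlier levels.
  Both demands are met by choosing the data recursively. Unboundedness of
  \<open>S (1, ..., 1)\<close> is used twice: it makes the biorthogonal functionals weakly null,
  since otherwise the dual norm would grow like that of l1 on (1, ..., 1), and it makes the growth
  exponent positive, so that p is finite.\<close>

text \<open>Dependent choice with access to the whole list of earlier choices. The sparse
  subsequences and the tensor data below are all built in this way.\<close>

lemma history_choice:
  assumes "\<And>h. \<exists>x. P h x"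
  shows "\<exists>f::nat \<Rightarrow> 'a. \<forall>s. P (map f [0..<s]) (f s)"
proof -
  obtain g where g: "\<And>h. P h (g h)" using assms by metis
  define H where "H = rec_nat [] (\<lambda>_ h. h @ [g h])"
  have H0: "H 0 = []" and HS: "\<And>n. H (Suc n) = H n @ [g (H n)]" by (simp_all add: H_def)
  define f where "f = (\<lambda>n. g (H n))"
  have "map f [0..<s] = H s" for s by (induction s) (auto simp: H0 HS f_def)
  then show ?thesis using g by (intro exI[of _ f]) (simp add: f_def)
qed

section \<open>Limits along a nonprincipal ultrafilter\<close>

text \<open>Finer filters are smaller in the filter order, so Zorn's lemma is used downwards. A
  minimal proper filter below \<open>sequentially\<close> decides every predicate, since adding a
  predicate to it gives either the same filter or \<open>bot\<close>.\<close>

lemma nonprincipal_ultrafilter_exists: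
  "\<exists>U :: nat filter. U \<noteq> bot \<and> U \<le> sequentially \<and>
     (\<forall>P. eventually P U \<or> eventually (\<lambda>x. \<not> P x) U)"
proof -
  define A where "A = {F :: nat filter. F \<noteq> bot \<and> F \<le> sequentially}"
  have "\<exists>U\<in>A. \<forall>F\<in>A. F \<le> U \<longrightarrow> F = U"
  proof (rule predicate_Zorn)
    show "partial_order_on A (relation_of (\<lambda>x y. y \<le> x) A)"
      by (rule partial_order_on_relation_ofI) auto
    show "\<exists>U\<in>A. \<forall>F\<in>C. U \<le> F" if C: "C \<in> Chains (relation_of (\<lambda>x y. y \<le> x) A)" for C
    proof (cases "C = {}")
      case True
      have "sequentially \<in> A" by (auto simp: A_def)
      then show ?thesis using True by auto
    next
      case False
      have CA: "C \<subseteq> A" using C by (auto simp: Chains_def relation_of_def)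
      have lin: "F \<le> G \<or> G \<le> F" if "F \<in> C" "G \<in> C" for F G
        using C that by (auto simp: Chains_def relation_of_def)
      \<comment> \<open>Because \<open>C\<close> is linearly ordered, its infimum has the members of
        \<open>C\<close> as a base; this keeps \<open>Inf C\<close> proper.\<close>
      have ev: "eventually P (Inf C) \<longleftrightarrow> (\<exists>F\<in>C. eventually P F)" for P
        by (rule eventually_Inf_base[OF False]) (metis inf.absorb_iff2 inf.orderE lin order_refl inf_commute)
      have "Inf C \<noteq> bot"
        using CA by (auto simp: trivial_limit_def ev A_def)
      moreover have "Inf C \<le> sequentially" using False CA by (auto simp: A_def intro: Inf_lower2)
      ultimately show ?thesis by (auto simp: A_def intro!: bexI[of _ "Inf C"] Inf_lower)
    qed
  qed
  then obtain U where U: "U \<in> A" "\<And>F. F \<in> A \<Longrightarrow> F \<le> U \<Longrightarrow> F = U" by blast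
  have "eventually P U \<or> eventually (\<lambda>x. \<not> P x) U" for P
  proof (cases "inf U (principal {x. P x}) = bot")
    case True
    then show ?thesis by (simp add: trivial_limit_def eventually_inf_principal)
  next
    case False
    have "inf U (principal {x. P x}) \<le> sequentially"
      using U(1) by (auto simp: A_def intro: le_infI1)
    then have "inf U (principal {x. P x}) = U" using False by (intro U(2)) (auto simp: A_def)
    moreover have "eventually P (inf U (principal {x. P x}))" by (simp add: eventually_inf_principal)
    ultimately show ?thesis by simp
  qed
  then show ?thesis using U(1) by (auto simp: A_def)
qed

locale free_ultrafilter =
  fixes U :: "nat filter"
  assumes not_bot: "U \<noteq> bot"
    and le_sequentially: "U \<le> sequentially"
    and ultra: "eventually P U \<or> eventually (\<lambda>x. \<not> P x) U"
begin

text \<open>Compactness of \<open>{-B..B}\<close> gives a cluster point of \<open>f\<close> along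
  \<open>U\<close>, and the dichotomy \<open>ultra\<close> turns a cluster point into a
  limit.\<close>

lemma bounded_tendsto_Lim:
  fixes f :: "nat \<Rightarrow> real"
  assumes "\<And>k. \<bar>f k\<bar> \<le> B"
  shows "(f \<longlongrightarrow> Lim U f) U"
proof -
  have "compact {-B..B}" by simp
  moreover have "filtermap f U \<noteq> bot" using not_bot by (simp add: filtermap_bot_iff)
  moreover have "eventually (\<lambda>x. x \<in> {-B..B}) (filtermap f U)"
    using assms by (auto simp: eventually_filtermap abs_le_iff minus_le_iff)
  ultimately obtain l where l: "inf (nhds l) (filtermap f U) \<noteq> bot"
    unfolding compact_filter by blast
  have "(f \<longlongrightarrow> l) U"
  proof (rule topological_tendstoI)
    fix S assume S: "open S" "l \<in> S"
    have "\<not> eventually (\<lambda>x. f x \<notin> S) U"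
    proof
      assume *: "eventually (\<lambda>x. f x \<notin> S) U"
      have "eventually (\<lambda>x. x \<in> S) (nhds l)" using S eventually_nhds by blast
      moreover have "eventually (\<lambda>x. x \<notin> S) (filtermap f U)" using * by (simp add: eventually_filtermap)
      ultimately have "eventually (\<lambda>x. False) (inf (nhds l) (filtermap f U))"
        unfolding eventually_inf by (metis (mono_tags, lifting))
      then show False using l by (simp add: trivial_limit_def)
    qed
    then show "eventually (\<lambda>x. f x \<in> S) U" using ultra by blast
  qed
  then show ?thesis using tendsto_Lim[OF not_bot] by metis
qed

text \<open>The \<open>r\<close> indices after \<open>ks\<close> are sent to infinity, the last one
  innermost. The list holds the indices already fixed, so that partially limited expressions can be
  compared with each other.\<close>

fun iter_lim :: "nat \<Rightarrow> (nat list \<Rightarrow> real) \<Rightarrow> nat list \<Rightarrow> real" where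
  "iter_lim 0 \<phi> ks = \<phi> ks"
| "iter_lim (Suc r) \<phi> ks = Lim U (\<lambda>k. iter_lim r \<phi> (ks @ [k]))"

lemma abs_iter_lim_le:
  assumes "\<And>ks. \<bar>\<phi> ks\<bar> \<le> B"
  shows "\<bar>iter_lim r \<phi> ks\<bar> \<le> B"
proof (induction r arbitrary: ks)
  case (Suc r)
  have t: "((\<lambda>k. iter_lim r \<phi> (ks @ [k])) \<longlongrightarrow> iter_lim (Suc r) \<phi> ks) U"
    using bounded_tendsto_Lim[of "\<lambda>k. iter_lim r \<phi> (ks @ [k])" B] Suc by simp
  show ?case
    by (rule tendsto_upperbound[OF tendsto_rabs[OF t]]) (use Suc not_bot in auto)
qed (use assms in simp)

lemma iter_lim_tendsto:
  assumes "\<And>ks. \<bar>\<phi> ks\<bar> \<le> B"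
  shows "((\<lambda>k. iter_lim r \<phi> (ks @ [k])) \<longlongrightarrow> iter_lim (Suc r) \<phi> ks) U"
  using bounded_tendsto_Lim[of "\<lambda>k. iter_lim r \<phi> (ks @ [k])" B] abs_iter_lim_le[of \<phi> B] assms by simp

lemma iter_lim_add:
  assumes "\<And>ks. \<bar>\<phi> ks\<bar> \<le> B" "\<And>ks. \<bar>\<psi> ks\<bar> \<le> B'"
  shows "iter_lim r (\<lambda>ks. \<phi> ks + \<psi> ks) ks = iter_lim r \<phi> ks + iter_lim r \<psi> ks"
proof (induction r arbitrary: ks)
  case (Suc r)
  show ?case
    using tendsto_Lim[OF not_bot tendsto_add[OF iter_lim_tendsto[of \<phi> B, OF assms(1)]
      iter_lim_tendsto[of \<psi> B', OF assms(2)]], of r ks r ks]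
    by (subst iter_lim.simps(2)) (simp only: Suc)
qed simp

lemma iter_lim_mult:
  assumes "\<And>ks. \<bar>\<phi> ks\<bar> \<le> B"
  shows "iter_lim r (\<lambda>ks. c * \<phi> ks) ks = c * iter_lim r \<phi> ks"
proof (induction r arbitrary: ks)
  case (Suc r)
  show ?case
    using tendsto_Lim[OF not_bot tendsto_mult_left[OF iter_lim_tendsto[of \<phi> B, OF assms]], of c r ks]
    by (subst iter_lim.simps(2)) (simp only: Suc)
qed simp

text \<open>Plays the role usually given to Ramsey's theorem. At each stage only the finitely many
  tests active for the current history matter, and each requirement holds along \<open>U\<close>, so
  a common index exists. \<open>Act\<close> holds pairs of arity and test function; \<open>R\<close>
  carries further requirements of the application.\<close>

lemma sparse_subsequence:
  fixes Act :: "nat list \<Rightarrow> (nat \<times> (nat list \<Rightarrow> real)) set"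
  assumes fin: "\<And>h. finite (Act h)"
    and bdd: "\<And>h n \<phi>. (n, \<phi>) \<in> Act h \<Longrightarrow> \<exists>B. \<forall>ks. \<bar>\<phi> ks\<bar> \<le> B"
    and R: "\<And>h. eventually (R h) sequentially"
    and \<delta>: "\<And>s. 0 < \<delta> s"
  obtains m :: "nat \<Rightarrow> nat" where "strict_mono m" "\<And>s. R (map m [0..<s]) (m s)"
    "\<And>s n \<phi> ks. (n, \<phi>) \<in> Act (map m [0..<s]) \<Longrightarrow> set ks \<subseteq> m ` {..<s} \<Longrightarrow> length ks < n \<Longrightarrow>
       \<bar>iter_lim (n - Suc (length ks)) \<phi> (ks @ [m s]) - iter_lim (n - length ks) \<phi> ks\<bar> < \<delta> s"
proof -
  define Q where "Q = (\<lambda>h k. R h k \<and> (\<forall>j\<in>set h. j < k) \<and>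
    (\<forall>p\<in>Act h. \<forall>ks\<in>{ks. set ks \<subseteq> set h \<and> length ks \<le> fst p}. length ks < fst p \<longrightarrow>
       \<bar>iter_lim (fst p - Suc (length ks)) (snd p) (ks @ [k]) - iter_lim (fst p - length ks) (snd p) ks\<bar>
         < \<delta> (length h)))"
  have ev: "eventually (Q h) U" for h
    unfolding Q_def
  proof (intro eventually_conj eventually_ball_finite ballI)
    show "eventually (R h) U" using R le_sequentially filter_leD by blast
    show "eventually (\<lambda>k. j < k) U" for j
      using eventually_gt_at_top le_sequentially filter_leD by blast
    fix p ks assume p: "p \<in> Act h" and ks: "ks \<in> {ks. set ks \<subseteq> set h \<and> length ks \<le> fst p}"
    show "\<forall>\<^sub>F k in U. length ks < fst p \<longrightarrow>
       \<bar>iter_lim (fst p - Suc (length ks)) (snd p) (ks @ [k]) - iter_lim (fst p - length ks) (snd p) ks\<bar>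
         < \<delta> (length h)"
    proof (cases "length ks < fst p")
      case True
      obtain B where B: "\<And>ks. \<bar>snd p ks\<bar> \<le> B" using bdd[of "fst p" "snd p" h] p by auto
      have e: "Suc (fst p - Suc (length ks)) = fst p - length ks" using True by simp
      have "((\<lambda>k. iter_lim (fst p - Suc (length ks)) (snd p) (ks @ [k]))
           \<longlongrightarrow> iter_lim (fst p - length ks) (snd p) ks) U"
        using iter_lim_tendsto[of "snd p" B "fst p - Suc (length ks)" ks] B unfolding e by blast
      from tendstoD[OF this \<delta>[of "length h"]] show ?thesis by (simp add: dist_real_def)
    qed simp
  qed (use fin finite_lists_length_le in auto)
  have "\<exists>k. Q h k" for h using eventually_happens'[OF not_bot ev] .
  then obtain m where m: "\<And>s. Q (map m [0..<s]) (m s)" using history_choice[of Q] by blast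
  have "strict_mono m"
    by (rule strict_mono_Suc_iff[THEN iffD2]) (use m in \<open>auto simp: Q_def\<close>)
  moreover have "\<And>s. R (map m [0..<s]) (m s)" using m by (auto simp: Q_def)
  moreover have "\<bar>iter_lim (n - Suc (length ks)) \<phi> (ks @ [m s]) - iter_lim (n - length ks) \<phi> ks\<bar> < \<delta> s"
    if "(n, \<phi>) \<in> Act (map m [0..<s])" "set ks \<subseteq> m ` {..<s}" "length ks < n" for s n \<phi> ks
    using m[of s] that by (fastforce simp: Q_def atLeast0LessThan)
  ultimately show ?thesis using that by blast
qed

text \<open>The pending limits are replaced by actual indices one at a time, from the first pending
  position on; \<open>step\<close> bounds each replacement and the errors add up.\<close>

lemma iter_lim_telescope:
  fixes m :: "nat \<Rightarrow> nat"
  assumes step: "\<And>s ks. s \<in> set qs \<Longrightarrow> set ks \<subseteq> m ` {..<s} \<Longrightarrow> length ks < n \<Longrightarrow>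
       \<bar>iter_lim (n - Suc (length ks)) \<phi> (ks @ [m s]) - iter_lim (n - length ks) \<phi> ks\<bar> < \<delta> s"
    and "sorted_wrt (<) (ps @ qs)" "length (ps @ qs) = n"
  shows "\<bar>\<phi> (map m (ps @ qs)) - iter_lim (length qs) \<phi> (map m ps)\<bar> \<le> (\<Sum>s\<in>set qs. \<delta> s)"
  using assms
proof (induction qs arbitrary: ps)
  case (Cons q qs)
  have "\<bar>\<phi> (map m ((ps @ [q]) @ qs)) - iter_lim (length qs) \<phi> (map m (ps @ [q]))\<bar> \<le> (\<Sum>s\<in>set qs. \<delta> s)"
    by (rule Cons.IH) (use Cons.prems in auto)
  moreover have "\<bar>iter_lim (n - Suc (length (map m ps))) \<phi> (map m ps @ [m q])
      - iter_lim (n - length (map m ps)) \<phi> (map m ps)\<bar> < \<delta> q"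
    by (rule Cons.prems(1)) (use Cons.prems(2,3) in \<open>auto simp: sorted_wrt_append\<close>)
  moreover have "n - Suc (length (map m ps)) = length qs" "n - length (map m ps) = length (q # qs)"
    using Cons.prems(3) by auto
  moreover have "(\<Sum>s\<in>set (q # qs). \<delta> s) = \<delta> q + (\<Sum>s\<in>set qs. \<delta> s)"
  proof -
    have "\<forall>x\<in>set qs. q < x" using Cons.prems(2) by (simp add: sorted_wrt_append)
    then have "q \<notin> set qs" by (metis less_irrefl)
    then show ?thesis by simp
  qed
  ultimately show ?case by (simp del: iter_lim.simps)
qed simp

end

section \<open>Hahn--Banach\<close>

text \<open>Functionals are kept as linear subspaces of the product with the reals, so that
  extension is inclusion and Zorn's lemma applies directly. The bound at \<open>v = 0\<close> forces
  \<open>t = 0\<close>, which makes every admissible subspace single-valued.\<close>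

lemma hahn_banach_graph:
  fixes G :: "('a::real_normed_vector \<times> real) set"
  assumes G: "subspace G" and bd: "\<And>v t. (v, t) \<in> G \<Longrightarrow> t \<le> C * norm v" and C: "0 \<le> C"
  obtains f where "linear f" "\<And>v. \<bar>f v\<bar> \<le> C * norm v" "\<And>v t. (v, t) \<in> G \<Longrightarrow> f v = t"
proof -
  define A where "A = {H. subspace H \<and> G \<subseteq> H \<and> (\<forall>v t. (v, t) \<in> H \<longrightarrow> t \<le> C * norm v)}"
  have "\<exists>M\<in>A. \<forall>X\<in>A. M \<subseteq> X \<longrightarrow> X = M"
  proof (rule subset_Zorn_nonempty)
    show "A \<noteq> {}" using G bd by (auto simp: A_def)
    fix \<C> assume ne: "\<C> \<noteq> {}" and ch: "subset.chain A \<C>"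
    have sub: "\<C> \<subseteq> A" and lin: "\<And>X Y. X \<in> \<C> \<Longrightarrow> Y \<in> \<C> \<Longrightarrow> X \<subseteq> Y \<or> Y \<subseteq> X"
      using ch by (auto simp: subset.chain_def)
    have "subspace (\<Union>\<C>)"
    proof (rule subspaceI)
      show "0 \<in> \<Union>\<C>" using ne sub subspace_0 unfolding A_def by blast
      show "p + q \<in> \<Union>\<C>" if pq: "p \<in> \<Union>\<C>" "q \<in> \<Union>\<C>" for p q
      proof -
        obtain X where "X \<in> \<C>" "p \<in> X" "q \<in> X" using pq lin by blast
        then show ?thesis using sub by (auto simp: A_def intro!: bexI[of _ X] subspace_add)
      qed
      show "c *\<^sub>R p \<in> \<Union>\<C>" if p: "p \<in> \<Union>\<C>" for c p
      proof -
        obtain X where "X \<in> \<C>" "p \<in> X" using p by blast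
        then show ?thesis using sub by (auto simp: A_def intro!: bexI[of _ X] subspace_scale)
      qed
    qed
    moreover have "G \<subseteq> \<Union>\<C>" using ne sub unfolding A_def by blast
    moreover have "t \<le> C * norm v" if vt: "(v, t) \<in> \<Union>\<C>" for v t
    proof -
      obtain X where "X \<in> \<C>" "(v, t) \<in> X" using vt by blast
      then show ?thesis using sub unfolding A_def by blast
    qed
    ultimately show "\<Union>\<C> \<in> A" unfolding A_def by blast
  qed
  then obtain M where M: "subspace M" "G \<subseteq> M" "\<And>v t. (v, t) \<in> M \<Longrightarrow> t \<le> C * norm v"
    and max: "\<And>X. X \<in> A \<Longrightarrow> M \<subseteq> X \<Longrightarrow> X = M" by (auto simp: A_def)
  have uniq: "t = t'" if "(v, t) \<in> M" "(v, t') \<in> M" for v t t'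
    using M(3)[of 0 "t - t'"] M(3)[of 0 "t' - t"] subspace_diff[OF M(1) that] subspace_diff[OF M(1) that(2,1)]
    by simp
  have dom: "\<exists>t. (v, t) \<in> M" for v
  proof -
    \<comment> \<open>The value given to the new vector \<open>v\<close>: the least number
      respecting all lower bounds, while \<open>key\<close> says that every lower bound lies below
      every upper bound.\<close>
    define c where "c = (SUP p\<in>M. - snd p - C * norm (fst p + v))"
    have key: "- s - C * norm (w + v) \<le> C * norm (w' + v) - s'" if "(w, s) \<in> M" "(w', s') \<in> M" for w s w' s'
    proof -
      have "s' - s \<le> C * norm (w' - w)" using M(3) subspace_diff[OF M(1) that(2,1)] by simp
      also have "\<dots> \<le> C * (norm (w + v) + norm (w' + v))"
        using norm_triangle_ineq4[of "w' + v" "w + v"] C by (intro mult_left_mono) auto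
      finally show ?thesis by (simp add: algebra_simps)
    qed
    have z: "(0, 0) \<in> M" using subspace_0[OF M(1)] by (simp add: zero_prod_def)
    have bdd: "bdd_above ((\<lambda>p. - snd p - C * norm (fst p + v)) ` M)"
    proof (rule bdd_aboveI2)
      show "- snd p - C * norm (fst p + v) \<le> C * norm (0 + v) - 0" if "p \<in> M" for p
        using key[of "fst p" "snd p" 0 0] z that by (simp del: add_0)
    qed
    have lo: "- s - C * norm (w + v) \<le> c" if "(w, s) \<in> M" for w s
      unfolding c_def using cSUP_upper[OF that bdd] by simp
    have hi: "c \<le> C * norm (w + v) - s" if "(w, s) \<in> M" for w s
      unfolding c_def using z key[OF _ that] by (intro cSUP_least) auto
    define X where "X = {p + r *\<^sub>R (v, c) | p r. p \<in> M}"
    have X1: "s + r * c \<le> C * norm (w + r *\<^sub>R v)" if ws: "(w, s) \<in> M" for w s r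
    proof -
      \<comment> \<open>After division by \<open>r\<close>, the upper bound \<open>hi\<close> serves
        for positive \<open>r\<close> and the lower bound \<open>lo\<close> for negative
        \<open>r\<close>.\<close>
      consider "r = 0" | "r > 0" | "r < 0" by linarith
      then show ?thesis
      proof cases
        case 1 then show ?thesis using M(3)[OF ws] by simp
      next
        case 2
        have "((1/r) *\<^sub>R w, s / r) \<in> M" using subspace_scale[OF M(1) ws, of "1/r"] by simp
        from hi[OF this] have "r * c \<le> r * (C * norm ((1/r) *\<^sub>R w + v) - s / r)" using 2 by (intro mult_left_mono) auto
        also have "\<dots> = C * norm (r *\<^sub>R ((1/r) *\<^sub>R w + v)) - s" using 2 by (simp add: algebra_simps del: scaleR_scaleR scaleR_add_right)
        also have "r *\<^sub>R ((1/r) *\<^sub>R w + v) = w + r *\<^sub>R v" using 2 by (simp add: scaleR_add_right)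
        finally show ?thesis by simp
      next
        case 3
        have "((1/r) *\<^sub>R w, s / r) \<in> M" using subspace_scale[OF M(1) ws, of "1/r"] by simp
        from lo[OF this] have "(-r) * (- (s / r) - C * norm ((1/r) *\<^sub>R w + v)) \<le> (-r) * c" using 3 by (intro mult_left_mono) auto
        moreover have "(-r) * (- (s / r) - C * norm ((1/r) *\<^sub>R w + v)) = s - C * norm (r *\<^sub>R ((1/r) *\<^sub>R w + v))"
          using 3 by (simp add: algebra_simps del: scaleR_scaleR scaleR_add_right)
        moreover have "r *\<^sub>R ((1/r) *\<^sub>R w + v) = w + r *\<^sub>R v" using 3 by (simp add: scaleR_add_right)
        ultimately show ?thesis by simp
      qed
    qed
    have "X = {x + y |x y. x \<in> M \<and> y \<in> span {(v, c)}}" (is "X = ?S")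
    proof
      show "X \<subseteq> ?S" unfolding X_def by (blast intro: span_scale span_base)
      show "?S \<subseteq> X"
      proof
        fix q assume "q \<in> ?S"
        then obtain p r where "p \<in> M" "q = p + r *\<^sub>R (v, c)" unfolding span_singleton by blast
        then show "q \<in> X" unfolding X_def by blast
      qed
    qed
    then have "subspace X" using subspace_sums[OF M(1) subspace_span, of "{(v, c)}"] by simp
    moreover have MX: "M \<subseteq> X"
    proof
      fix p assume "p \<in> M"
      then show "p \<in> X" unfolding X_def by (intro CollectI exI[of _ p] exI[of _ 0]) (simp add: zero_prod_def)
    qed
    moreover have "t \<le> C * norm w" if "(w, t) \<in> X" for w t
      using that X1 by (auto simp: X_def)
    ultimately have "X \<in> A" using M(2) by (auto simp: A_def)
    then have "X = M" using max MX by blast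
    moreover have "(v, c) \<in> X" using z unfolding X_def by (intro CollectI exI[of _ "(0,0)"] exI[of _ 1]) simp
    ultimately show ?thesis by auto
  qed
  define f where "f v = (THE t. (v, t) \<in> M)" for v
  have f: "(v, f v) \<in> M" for v
    unfolding f_def using dom[of v] uniq by (metis theI)
  have feq: "f v = t" if "(v, t) \<in> M" for v t using uniq f that by blast
  have lin: "linear f"
  proof (rule linearI)
    show "f (a + b) = f a + f b" for a b using feq subspace_add[OF M(1) f f] by simp
    show "f (c *\<^sub>R a) = c *\<^sub>R f a" for a c using feq subspace_scale[OF M(1) f] by simp
  qed
  show ?thesis
  proof (rule that[OF lin])
    show "\<bar>f v\<bar> \<le> C * norm v" for v
      using M(3)[OF f, of v] M(3)[OF f, of "-v"] linear_neg[OF lin, of v] by (simp add: abs_le_iff)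
    show "f v = t" if "(v, t) \<in> G" for v t using feq that M(2) by blast
  qed
qed

lemma norming_functional:
  fixes v :: "'a::real_normed_vector"
  obtains f where "linear f" "\<And>w. \<bar>f w\<bar> \<le> norm w" "f v = norm v"
proof (rule hahn_banach_graph[of "span {(v, norm v)}" 1])
  show "t \<le> 1 * norm w" if "(w, t) \<in> span {(v, norm v)}" for w t
    using that by (auto simp: span_singleton mult_right_mono)
  fix f assume f: "linear f" "\<And>w. \<bar>f w\<bar> \<le> 1 * norm w"
    "\<And>w t. (w, t) \<in> span {(v, norm v)} \<Longrightarrow> f w = t"
  show thesis using that[OF f(1)] f(2) f(3)[of v "norm v"] by (simp add: span_base)
qed auto

lemma linear_bdd_lin_functional:
  assumes "linear f" "\<And>w. \<bar>f w\<bar> \<le> C * norm w"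
  shows "bdd_lin_functional UNIV norm f"
  using assms by (auto simp: bdd_lin_functional_def linear_add linear_scale)

section \<open>Basic and Schreier unconditional subsequences\<close>

text \<open>A finite net in the unit ball of the sup norm on vectors of length \<open>n\<close>.
  Entries beyond \<open>n\<close> are fixed to 0 so that the set of functions is finite; conditions
  on all coefficient vectors thereby become finitely many.\<close>

definition grid :: "nat \<Rightarrow> nat \<Rightarrow> (nat \<Rightarrow> real) set" where
  "grid n q = {a. \<forall>i. (i \<in> {..<n} \<longrightarrow> a i \<in> (\<lambda>z. real_of_int z / real q) ` {- int q..int q}) \<and>
      (i \<notin> {..<n} \<longrightarrow> a i = 0)}"

lemma finite_grid: "finite (grid n q)"
  unfolding grid_def by (rule finite_set_of_finite_funs) auto

lemma grid_approx:
  fixes a :: "nat \<Rightarrow> real"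
  assumes "0 < q" "\<And>i. i < n \<Longrightarrow> \<bar>a i\<bar> \<le> M"
  obtains b where "b \<in> grid n q" "\<And>i. i < n \<Longrightarrow> \<bar>a i - M * b i\<bar> \<le> M / q"
proof (cases "M \<le> 0")
  case True
  have "a i = 0" if "i < n" for i using assms(2)[OF that] True by simp
  moreover have "M = 0" if "0 < n" using assms(2)[OF that] True by simp
  ultimately show ?thesis
    by (intro that[of "\<lambda>_. 0"]) (auto simp: grid_def intro!: image_eqI[of _ _ 0])
next
  case False
  define b where "b = (\<lambda>i. if i < n then real_of_int \<lfloor>a i * q / M\<rfloor> / q else 0)"
  have "\<lfloor>a i * q / M\<rfloor> \<in> {- int q..int q}" if "i < n" for i
  proof -
    have "\<bar>a i * q / M\<bar> \<le> q"
      using mult_right_mono[OF assms(2)[OF that], of "real q"] False by (simp add: abs_mult field_simps)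
    then have "- real q \<le> a i * q / M" "a i * q / M \<le> real q" by linarith+
    then show ?thesis by (simp add: le_floor_iff floor_le_iff)
  qed
  then have "b \<in> grid n q" by (auto simp: grid_def b_def)
  moreover have "\<bar>a i - M * b i\<bar> \<le> M / q" if "i < n" for i
  proof -
    have "\<bar>a i * q / M - real_of_int \<lfloor>a i * q / M\<rfloor>\<bar> \<le> 1" by linarith
    then have "(M / q) * \<bar>a i * q / M - real_of_int \<lfloor>a i * q / M\<rfloor>\<bar> \<le> (M / q) * 1"
      using False by (intro mult_left_mono) auto
    moreover have "(M / q) * \<bar>a i * q / M - real_of_int \<lfloor>a i * q / M\<rfloor>\<bar> = \<bar>(M / q) * (a i * q / M - real_of_int \<lfloor>a i * q / M\<rfloor>)\<bar>"
      using False by (simp add: abs_mult)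
    moreover have "(M / q) * (a i * q / M - real_of_int \<lfloor>a i * q / M\<rfloor>) = a i - M * b i"
      using False assms(1) that by (simp add: b_def field_simps)
    ultimately show ?thesis by (metis mult.right_neutral)
  qed
  ultimately show ?thesis by (rule that)
qed

lemma sum_half_powers_le:
  assumes "finite Q" "\<And>s. s \<in> Q \<Longrightarrow> i \<le> s"
  shows "(\<Sum>s\<in>Q. (1/2::real) ^ s) \<le> 2 * (1/2) ^ i"
proof -
  define N where "N = Suc (Max (insert i Q))"
  have Q: "Q \<subseteq> {i..<N}" using assms by (auto simp: N_def less_Suc_eq_le)
  have g: "(\<Sum>s\<in>{i..<i + d}. (1/2::real) ^ s) = 2 * (1/2) ^ i - 2 * (1/2) ^ (i + d)" for d
  proof (induction d)
    case (Suc d)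
    have "(1/2::real) ^ (i + Suc d) = (1/2) ^ (i + d) / 2" by simp
    moreover have "(\<Sum>s\<in>{i..<i + Suc d}. (1/2::real) ^ s) = (\<Sum>s\<in>{i..<i + d}. (1/2) ^ s) + (1/2) ^ (i + d)" by simp
    ultimately show ?case using Suc.IH by linarith
  qed simp
  have "(\<Sum>s\<in>Q. (1/2::real) ^ s) \<le> (\<Sum>s\<in>{i..<N}. (1/2) ^ s)"
    by (rule sum_mono2) (use Q in auto)
  also have "\<dots> \<le> 2 * (1/2) ^ i"
  proof -
    have "i \<le> Max (insert i Q)" using assms(1) by (intro Max_ge) auto
    then have "i + (N - i) = N" by (simp add: N_def)
    then show ?thesis using g[of "N - i"] by simp
  qed
  finally show ?thesis .
qed

lemma norm_sum_scaleR_diff_le: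
  fixes y :: "nat \<Rightarrow> 'a::real_normed_vector"
  assumes "\<And>i. i < n \<Longrightarrow> \<bar>a i - b i\<bar> \<le> r" "\<And>i. i < n \<Longrightarrow> norm (y i) = 1"
  shows "norm ((\<Sum>i<n. a i *\<^sub>R y i) - (\<Sum>i<n. b i *\<^sub>R y i)) \<le> n * r"
proof -
  have "norm ((\<Sum>i<n. a i *\<^sub>R y i) - (\<Sum>i<n. b i *\<^sub>R y i)) = norm (\<Sum>i<n. (a i - b i) *\<^sub>R y i)"
    by (simp add: sum_subtractf scaleR_diff_left)
  also have "\<dots> \<le> (\<Sum>i<n. r)" by (rule sum_norm_le) (use assms in auto)
  finally show ?thesis by simp
qed

lemma norming_functionals:
  obtains G :: "'a::real_normed_vector \<Rightarrow> 'a \<Rightarrow> real"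
  where "\<And>v. linear (G v)" "\<And>v w. \<bar>G v w\<bar> \<le> norm w" "\<And>v. G v v = norm v"
proof -
  have "\<exists>f. linear f \<and> (\<forall>w. \<bar>f w\<bar> \<le> norm w) \<and> f v = norm v" for v :: 'a
    using norming_functional[of v] by metis
  then obtain G where "\<And>v::'a. linear (G v) \<and> (\<forall>w. \<bar>G v w\<bar> \<le> norm w) \<and> G v v = norm v" by metis
  then show ?thesis using that by blast
qed

lemma weakly_nullD_linear:
  assumes "weakly_null UNIV norm x" "linear f" "\<And>w. \<bar>f w\<bar> \<le> norm w" "0 < \<delta>"
  shows "eventually (\<lambda>k. \<bar>f (x k)\<bar> < \<delta>) sequentially"
proof -
  have "(\<lambda>k. f (x k)) \<longlonglongrightarrow> 0"
    using assms(1) linear_bdd_lin_functional[OF assms(2), of 1] assms(3) by (auto simp: weakly_null_def)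
  from tendstoD[OF this assms(4)] show ?thesis by (simp add: dist_real_def)
qed

text \<open>Mazur's construction. Let \<open>B\<close> be the largest norm of a partial sum,
  attained at \<open>r\<close>. A functional norming a grid approximation of that sum is at least
  \<open>B / 2\<close> on it and, since the later vectors are almost annihilated, at most
  \<open>B / 4\<close> in absolute value on the rest up to \<open>n\<close>. So the full sum has
  norm at least \<open>B / 4\<close>.\<close>

lemma basic_subsequence:
  fixes x :: "nat \<Rightarrow> 'a::real_normed_vector"
  assumes wn: "weakly_null UNIV norm x" and n1: "\<And>i. norm (x i) = 1"
  obtains m :: "nat \<Rightarrow> nat" where "strict_mono m"
    "\<And>a t n. t \<le> n \<Longrightarrow> norm (\<Sum>i<t. a i *\<^sub>R x (m i)) \<le> 4 * norm (\<Sum>i<n. a i *\<^sub>R x (m i))"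
proof -
  obtain G :: "'a \<Rightarrow> 'a \<Rightarrow> real"
    where G: "\<And>v. linear (G v)" "\<And>v w. \<bar>G v w\<bar> \<le> norm w" "\<And>v. G v v = norm v"
    using norming_functionals by blast
  define V where "V = (\<lambda>a ks. \<Sum>i<length ks. a i *\<^sub>R x (ks ! i))"
  \<comment> \<open>The mesh \<open>1 / (8 * t + 1)\<close>, on \<open>t\<close> coefficients of
    size at most \<open>2 * B\<close>, costs \<open>B / 4\<close>. The factor \<open>1/16\<close>
    makes the tail, whose coefficients are also at most \<open>2 * B\<close>, cost another
    \<open>B / 4\<close>.\<close>
  define Q where "Q = (\<lambda>h k. (\<forall>j\<in>set h. j < k) \<and>
     (\<forall>t\<in>{..length h}. \<forall>a\<in>grid t (8 * t + 1). \<bar>G (V a (take t h)) (x k)\<bar> < (1/16) * (1/2) ^ length h))"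
  have "eventually (Q h) sequentially" for h
    unfolding Q_def
    by (intro eventually_conj eventually_ball_finite ballI weakly_nullD_linear[OF wn G(1,2)] finite_grid
        eventually_gt_at_top) auto
  then have "\<exists>k. Q h k" for h using eventually_happens'[of sequentially] by auto
  then obtain m where m: "\<And>s. Q (map m [0..<s]) (m s)" using history_choice[of Q] by blast
  have sm: "strict_mono m"
    by (rule strict_mono_Suc_iff[THEN iffD2]) (use m in \<open>auto simp: Q_def\<close>)
  have small: "\<bar>G (\<Sum>i<t. a i *\<^sub>R x (m i)) (x (m s))\<bar> < (1/16) * (1/2) ^ s"
    if "t \<le> s" "a \<in> grid t (8 * t + 1)" for t s a
  proof -
    have "V a (take t (map m [0..<s])) = (\<Sum>i<t. a i *\<^sub>R x (m i))"
      using that(1) by (auto simp: V_def take_map intro!: sum.cong)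
    moreover have "\<bar>G (V a (take t (map m [0..<s]))) (x (m s))\<bar> < (1/16) * (1/2) ^ length (map m [0..<s])"
      using m[of s] that unfolding Q_def by (metis atMost_iff diff_zero length_map length_upt)
    ultimately show ?thesis by simp
  qed
  have "norm (\<Sum>i<t. a i *\<^sub>R x (m i)) \<le> 4 * norm (\<Sum>i<n. a i *\<^sub>R x (m i))" if tn: "t \<le> n" for a t n
  proof -
    define P where "P = (\<lambda>t. \<Sum>i<t. a i *\<^sub>R x (m i))"
    define B where "B = Max ((\<lambda>r. norm (P r)) ` {..n})"
    have B: "norm (P r) \<le> B" if "r \<le> n" for r unfolding B_def using that by (intro Max_ge) auto
    obtain r where r: "r \<le> n" "norm (P r) = B"
    proof -
      have "B \<in> (\<lambda>r. norm (P r)) ` {..n}" unfolding B_def by (rule Max_in) auto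
      then show ?thesis using that by auto
    qed
    have B0: "0 \<le> B" using r(2) by (metis norm_ge_zero)
    have a: "\<bar>a i\<bar> \<le> 2 * B" if "i < n" for i
    proof -
      have "\<bar>a i\<bar> = norm (P (Suc i) - P i)" by (simp add: P_def n1)
      also have "\<dots> \<le> B + B" using B[of "Suc i"] B[of i] that norm_triangle_ineq4[of "P (Suc i)" "P i"] by simp
      finally show ?thesis by simp
    qed
    obtain b where b: "b \<in> grid r (8 * r + 1)" "\<And>i. i < r \<Longrightarrow> \<bar>a i - 2 * B * b i\<bar> \<le> 2 * B / real (8 * r + 1)"
      using grid_approx[of "8 * r + 1" r a "2 * B"] a r(1) by auto
    define w where "w = (\<Sum>i<r. b i *\<^sub>R x (m i))"
    define g where "g = G w"
    have "norm (P r - (\<Sum>i<r. (2 * B * b i) *\<^sub>R x (m i))) \<le> r * (2 * B / real (8 * r + 1))"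
      unfolding P_def by (rule norm_sum_scaleR_diff_le) (use b n1 in auto)
    also have "\<dots> \<le> B / 4" using B0 by (simp add: field_simps mult_nonneg_nonneg)
    finally have d: "norm (P r - (2 * B) *\<^sub>R w) \<le> B / 4" by (simp add: w_def scaleR_sum_right)
    have lin: "linear g" by (simp add: g_def G)
    have "g (P r) = g (P r - (2 * B) *\<^sub>R w) + 2 * B * norm w"
      using linear_diff[OF lin] linear_scale[OF lin] G(3)[of w] by (simp add: g_def)
    moreover have "\<bar>g (P r - (2 * B) *\<^sub>R w)\<bar> \<le> B / 4" 
      unfolding g_def by (rule order_trans[OF G(2) d])
    moreover have "B \<le> norm (P r - (2 * B) *\<^sub>R w) + 2 * B * norm w"
      using norm_triangle_ineq[of "P r - (2 * B) *\<^sub>R w" "(2 * B) *\<^sub>R w"] B0 r(2) by simp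
    ultimately have g1: "B / 2 \<le> g (P r)" using d by linarith
    have "P n - P r = (\<Sum>i\<in>{r..<n}. a i *\<^sub>R x (m i))"
      unfolding P_def using sum_diff_nat_ivl[of 0 r n "\<lambda>i. a i *\<^sub>R x (m i)"] r(1)
      by (simp add: atLeast0LessThan)
    then have "\<bar>g (P n - P r)\<bar> = \<bar>\<Sum>i\<in>{r..<n}. a i * g (x (m i))\<bar>"
      by (simp add: linear_sum[OF lin] linear_scale[OF lin])
    also have "\<dots> \<le> (\<Sum>i\<in>{r..<n}. \<bar>a i * g (x (m i))\<bar>)" by (rule sum_abs)
    also have "\<dots> \<le> (\<Sum>i\<in>{r..<n}. (2 * B) * ((1/16) * (1/2) ^ i))"
      unfolding abs_mult
    proof (intro sum_mono mult_mono)
      fix i assume i: "i \<in> {r..<n}"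
      show "\<bar>a i\<bar> \<le> 2 * B" using a i by simp
      show "\<bar>g (x (m i))\<bar> \<le> (1/16) * (1/2) ^ i"
        unfolding g_def w_def using small[of r i b] b(1) i by simp
    qed (use B0 in auto)
    also have "\<dots> = (B / 8) * (\<Sum>i\<in>{r..<n}. (1/2) ^ i)"
      by (simp add: sum_distrib_left mult.assoc)
    also have "\<dots> \<le> (B / 8) * (2 * (1/2) ^ r)" using B0 sum_half_powers_le[of "{r..<n}" r] by (intro mult_left_mono) auto
    also have "\<dots> \<le> B / 4" using B0 power_le_one[of "1/2::real" r] mult_left_mono[of "(1/2)^r" 1 B] by simp
    finally have g2: "\<bar>g (P n - P r)\<bar> \<le> B / 4" .
    have "g (P n) = g (P r) + g (P n - P r)" using linear_diff[OF lin, of "P n" "P r"] by simp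
    then have "B / 4 \<le> norm (P n)" using g1 g2 G(2)[of w "P n"] by (simp add: g_def)
    then show ?thesis using B[OF tn] by (simp add: P_def)
  qed
  then show ?thesis using that sm by blast
qed

lemma sorted_filter_split:
  fixes js :: "nat list"
  assumes "sorted_wrt (<) js" "i \<notin> set js"
  shows "js = filter (\<lambda>j. j < i) js @ filter (\<lambda>j. i < j) js"
  using assms
proof (induction js)
  case (Cons j js)
  consider "j < i" | "i < j" using Cons.prems(2) by fastforce
  then show ?case
  proof cases
    case 1 then show ?thesis using Cons by simp
  next
    case 2
    then have "filter (\<lambda>j. j < i) js = []" using Cons.prems by (auto simp: filter_empty_conv)
    then show ?thesis using 2 Cons by simp
  qed
qed simp

text \<open>For a norming functional \<open>g\<close> of a vector supported on \<open>F = {k\<^sub>1 < \<dots> < k\<^sub>p}\<close>, the functional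
  \<open>g - g\<^sub>0\<close>, where \<open>g\<^sub>0\<close> is the iterated limit of \<open>g\<close> as \<open>k\<^sub>p \<rightarrow> \<infinity>, \<dots>, k\<^sub>1 \<rightarrow> \<infinity>\<close>, is still almost
  norming on \<open>F\<close>, and is tiny off \<open>F\<close> provided the sequence is sparse enough.\<close>

lemma schreier_unconditional_subsequence:
  fixes x :: "nat \<Rightarrow> 'a::real_normed_vector"
  assumes wn: "weakly_null UNIV norm x" and n1: "\<And>i. norm (x i) = 1"
    and basic: "\<And>a t n. t \<le> n \<Longrightarrow> norm (\<Sum>i<t. a i *\<^sub>R x i) \<le> K * norm (\<Sum>i<n. a i *\<^sub>R x i)"
  obtains m :: "nat \<Rightarrow> nat" where "strict_mono m"
    "\<And>a F n. F \<subseteq> {..<n} \<Longrightarrow> (\<And>i. i \<in> F \<Longrightarrow> card F \<le> i) \<Longrightarrow>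
       norm (\<Sum>i\<in>F. a i *\<^sub>R x (m i)) \<le> (2 + 24 * K) * norm (\<Sum>i<n. a i *\<^sub>R x (m i))"
proof -
  obtain U where "free_ultrafilter U"
    using nonprincipal_ultrafilter_exists unfolding free_ultrafilter_def by blast
  then interpret free_ultrafilter U .
  obtain G0 :: "'a \<Rightarrow> 'a \<Rightarrow> real"
    where G0: "\<And>v. linear (G0 v)" "\<And>v w. \<bar>G0 v w\<bar> \<le> norm w" "\<And>v. G0 v v = norm v"
    using norming_functionals by blast
  define V where "V = (\<lambda>a ks. \<Sum>i<length ks. a i *\<^sub>R x (ks ! i))"
  define G where "G = (\<lambda>a z ks. G0 (V a ks) z)"
  have Gb: "\<bar>G a z ks\<bar> \<le> norm z" for a z ks by (simp add: G_def G0)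
  have lin: "linear (\<lambda>z. iter_lim r (G a z) ks)" for r a ks
  proof (rule linearI)
    show "iter_lim r (G a (y + z)) ks = iter_lim r (G a y) ks + iter_lim r (G a z) ks" for y z
      using iter_lim_add[of "G a y" "norm y" "G a z" "norm z" r ks] Gb
      by (simp add: G_def linear_add[OF G0(1)])
    show "iter_lim r (G a (c *\<^sub>R z)) ks = c *\<^sub>R iter_lim r (G a z) ks" for c z
      using iter_lim_mult[of "G a z" "norm z" r c ks] Gb
      by (simp add: G_def linear_scale[OF G0(1)])
  qed
  have ib: "\<bar>iter_lim r (G a z) ks\<bar> \<le> norm z" for r a z ks
    using abs_iter_lim_le[of "G a z" "norm z"] Gb by blast
  \<comment> \<open>The active tests are the values, at an earlier vector \<open>x j\<close>, of the
    functional norming the combination along \<open>ks\<close>. The requirement \<open>R\<close>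
    adds that each partially limited functional with earlier fixed indices is almost zero on the new
    vector; such a functional is linear and bounded, so weak nullness provides this.\<close>
  define Act where "Act = (\<lambda>h. (\<lambda>(p, a, j). (p, G a (x j))) `
     (SIGMA p:{..length h}. grid p (p + 1) \<times> set h))"
  define R where "R = (\<lambda>h k. \<forall>p\<in>{..length h}. \<forall>a\<in>grid p (p + 1). \<forall>ks\<in>{ks. set ks \<subseteq> set h \<and> length ks \<le> p}.
     \<bar>iter_lim (p - length ks) (G a (x k)) ks\<bar> < (1/2) ^ length h)"
  have evR: "eventually (R h) sequentially" for h
    unfolding R_def
    by (intro eventually_ball_finite ballI finite_grid finite_lists_length_le weakly_nullD_linear[OF wn lin ib]) auto
  have finA: "finite (Act h)" for h
    unfolding Act_def by (intro finite_imageI finite_SigmaI finite_grid) auto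
  have bA: "\<exists>B. \<forall>ks. \<bar>\<phi> ks\<bar> \<le> B" if "(n, \<phi>) \<in> Act h" for n \<phi> h
    using that Gb by (auto simp: Act_def)
  have half: "0 < (1/2::real) ^ s" for s :: nat by simp
  obtain m where sm: "strict_mono m" and R: "\<And>s. R (map m [0..<s]) (m s)" and
    step: "\<And>s n \<phi> ks. (n, \<phi>) \<in> Act (map m [0..<s]) \<Longrightarrow> set ks \<subseteq> m ` {..<s} \<Longrightarrow> length ks < n \<Longrightarrow>
       \<bar>iter_lim (n - Suc (length ks)) \<phi> (ks @ [m s]) - iter_lim (n - length ks) \<phi> ks\<bar> < (1/2) ^ s"
  proof (rule sparse_subsequence[of Act R "\<lambda>s. (1/2) ^ s", OF finA _ evR half])
    show "\<exists>B. \<forall>ks. \<bar>\<phi> ks\<bar> \<le> B" if "(n, \<phi>) \<in> Act h" for n \<phi> h using that by (rule bA)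
  qed blast
  have small: "\<bar>iter_lim (p - length ks) (G c (x (m i))) ks\<bar> < (1/2) ^ i"
    if "p \<le> i" "c \<in> grid p (p + 1)" "set ks \<subseteq> m ` {..<i}" "length ks \<le> p" for p i c ks
    using R[of i] that by (auto simp: R_def atLeast0LessThan)
  define y where "y = (\<lambda>i. x (m i))"
  have basic': "norm (\<Sum>i<t. a i *\<^sub>R y i) \<le> K * norm (\<Sum>i<n. a i *\<^sub>R y i)" if tn: "t \<le> n" for a t n
  proof -
    define b where "b = (\<lambda>j. if j \<in> range m then a (inv m j) else 0)"
    have inj: "inj m" using sm strict_mono_imp_inj_on by blast
    have e: "(\<Sum>j<m n. b j *\<^sub>R x j) = (\<Sum>i<n. a i *\<^sub>R y i)" for n
    proof -
      have "(\<Sum>j<m n. b j *\<^sub>R x j) = (\<Sum>j\<in>m ` {..<n}. b j *\<^sub>R x j)"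
        by (rule sum.mono_neutral_right) (auto simp: b_def strict_mono_less[OF sm])
      also have "\<dots> = (\<Sum>i<n. a i *\<^sub>R y i)"
        by (subst sum.reindex[OF inj_on_subset[OF inj subset_UNIV]])
          (simp add: b_def y_def inv_f_f[OF inj])
      finally show ?thesis .
    qed
    show ?thesis using basic[of "m t" "m n" b] sm tn by (simp add: e strict_mono_less_eq)
  qed
  have "norm (\<Sum>i\<in>F. a i *\<^sub>R y i) \<le> (2 + 24 * K) * norm (\<Sum>i<n. a i *\<^sub>R y i)"
    if F: "F \<subseteq> {..<n}" and cF: "\<And>i. i \<in> F \<Longrightarrow> card F \<le> i" for a F n
  proof -
    define Y where "Y = (\<Sum>i<n. a i *\<^sub>R y i)"
    \<comment> \<open>\<open>M\<close> bounds all coefficients. The errors are 2 \<open>M\<close>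
      from the grid, 2 \<open>M\<close> from \<open>g0\<close> on \<open>F\<close> and 8
      \<open>M\<close> off \<open>F\<close>; the total \<open>2 * norm Y + 12 * M\<close> is the
      factor \<open>2 + 24 * K\<close>.\<close>
    define M where "M = 2 * K * norm Y"
    have aM: "\<bar>a i\<bar> \<le> M" if "i < n" for i
    proof -
      have "\<bar>a i\<bar> = norm ((\<Sum>i<Suc i. a i *\<^sub>R y i) - (\<Sum>i<i. a i *\<^sub>R y i))" by (simp add: y_def n1)
      also have "\<dots> \<le> norm (\<Sum>i<Suc i. a i *\<^sub>R y i) + norm (\<Sum>i<i. a i *\<^sub>R y i)" by (rule norm_triangle_ineq4)
      also have "\<dots> \<le> K * norm Y + K * norm Y"
        unfolding Y_def by (intro add_mono basic') (use that in auto)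
      finally show ?thesis by (simp add: M_def)
    qed
    have K0: "0 \<le> K * norm Y" using basic'[of 0 n a] by (simp add: Y_def)
    then have M0: "0 \<le> M" by (simp add: M_def)
    have finF: "finite F" using F finite_subset by blast
    define p where "p = card F"
    define js where "js = sorted_list_of_set F"
    have js: "set js = F" "sorted_wrt (<) js" "length js = p" "distinct js"
      using finF by (auto simp: js_def p_def)
    have bij: "bij_betw (\<lambda>q. js ! q) {..<p} F" using bij_betw_nth[of js "{..<p}" F] js by simp
    obtain c where c: "c \<in> grid p (p + 1)" "\<And>q. q < p \<Longrightarrow> \<bar>a (js ! q) - M * c q\<bar> \<le> M / real (p + 1)"
    proof (rule grid_approx[of "p + 1" p "\<lambda>q. a (js ! q)" M])
      show "\<bar>a (js ! q)\<bar> \<le> M" if "q < p" for q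
        using that js F by (intro aM) (metis lessThan_iff nth_mem subsetD)
    qed auto
    define Vv where "Vv = (\<Sum>i\<in>F. a i *\<^sub>R y i)"
    define W where "W = (\<Sum>q<p. c q *\<^sub>R y (js ! q))"
    have Vv: "Vv = (\<Sum>q<p. a (js ! q) *\<^sub>R y (js ! q))"
      unfolding Vv_def using sum.reindex_bij_betw[OF bij, of "\<lambda>i. a i *\<^sub>R y i"] by simp
    have "norm (Vv - (\<Sum>q<p. (M * c q) *\<^sub>R y (js ! q))) \<le> p * (M / real (p + 1))"
      unfolding Vv by (rule norm_sum_scaleR_diff_le) (use c n1 in \<open>auto simp: y_def\<close>)
    also have "\<dots> \<le> M" using M0 by (simp add: field_simps)
    finally have d: "norm (Vv - M *\<^sub>R W) \<le> M" by (simp add: W_def scaleR_sum_right)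
    have VW: "V c (map m js) = W" by (auto simp: V_def W_def js y_def)
    define g where "g = G0 W"
    have g_eq: "g z = G c z (map m js)" for z by (simp add: g_def G_def VW)
    have ling: "linear g" by (simp add: g_def G0)
    have "g Vv = g (Vv - M *\<^sub>R W) + M * norm W"
      using linear_diff[OF ling] linear_scale[OF ling] G0(3)[of W] by (simp add: g_def)
    moreover have "\<bar>g (Vv - M *\<^sub>R W)\<bar> \<le> M" 
      unfolding g_def by (rule order_trans[OF G0(2) d])
    moreover have "norm Vv \<le> norm (Vv - M *\<^sub>R W) + M * norm W"
      using norm_triangle_ineq[of "Vv - M *\<^sub>R W" "M *\<^sub>R W"] M0 by simp
    ultimately have g1: "norm Vv - 2 * M \<le> g Vv" using d by linarith
    define g0 where "g0 = (\<lambda>z. iter_lim p (G c z) [])"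
    have ling0: "linear g0" unfolding g0_def by (rule lin)
    have g0F: "\<bar>g0 (y i)\<bar> \<le> (1/2) ^ i" if "p \<le> i" for i
      using small[of p i c "[]"] that c(1) by (simp add: g0_def y_def)
    \<comment> \<open>By telescoping, taking limits over the indices of \<open>F\<close> beyond
      \<open>i\<close> hardly changes \<open>g (y i)\<close>. If an element of \<open>F\<close> lies
      below \<open>i\<close>, then \<open>card F \<le> i\<close>, and both the remaining partially
      limited functional and \<open>g0\<close> are tiny at \<open>y i\<close>. If none does, that
      functional is \<open>g0\<close> itself: subtracting \<open>g0\<close> is what settles the
      indices \<open>i < card F\<close>, where no smallness is available.\<close>
    have off: "\<bar>g (y i) - g0 (y i)\<bar> \<le> 4 * (1/2) ^ i" if "i \<notin> F" for i
    proof -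
      define ps where "ps = filter (\<lambda>j. j < i) js"
      define qs where "qs = filter (\<lambda>j. i < j) js"
      have spl: "js = ps @ qs" unfolding ps_def qs_def using sorted_filter_split js that by metis
      have len: "length (ps @ qs) = p" using spl js by simp
      have "\<bar>G c (y i) (map m (ps @ qs)) - iter_lim (length qs) (G c (y i)) (map m ps)\<bar> \<le> (\<Sum>s\<in>set qs. (1/2) ^ s)"
      proof (rule iter_lim_telescope[OF _ _ len])
        fix s ks assume s: "s \<in> set qs" "set ks \<subseteq> m ` {..<s}" "length ks < p"
        have "p \<le> s" "i < s" using s(1) cF js(1) by (auto simp: qs_def p_def)
        then have "(p, G c (y i)) \<in> Act (map m [0..<s])"
          using c(1) by (force simp: Act_def y_def)
        then show "\<bar>iter_lim (p - Suc (length ks)) (G c (y i)) (ks @ [m s]) - iter_lim (p - length ks) (G c (y i)) ks\<bar> < (1/2) ^ s"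
          using step s by blast
      qed (use js spl in simp)
      also have "\<dots> \<le> 2 * (1/2) ^ i" by (rule sum_half_powers_le) (auto simp: qs_def)
      finally have t: "\<bar>g (y i) - iter_lim (length qs) (G c (y i)) (map m ps)\<bar> \<le> 2 * (1/2) ^ i"
        unfolding g_eq spl .
      show ?thesis
      proof (cases "ps = []")
        case True
        then show ?thesis using t len by (simp add: g0_def)
      next
        case False
        then obtain f where "f \<in> set ps" by (cases ps) auto
        then have pi: "p \<le> i" using cF[of f] js(1) by (auto simp: ps_def p_def)
        have "\<bar>iter_lim (p - length (map m ps)) (G c (x (m i))) (map m ps)\<bar> < (1/2) ^ i"
          using pi c(1) len by (intro small) (auto simp: ps_def)
        moreover have "p - length (map m ps) = length qs" using len by simp
        ultimately show ?thesis using t g0F[OF pi] by (simp add: y_def)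
      qed
    qed
    have gY: "g Y - g0 Y = g Vv - g0 Vv + (\<Sum>i\<in>{..<n} - F. a i * (g (y i) - g0 (y i)))"
    proof -
      have "Y = (\<Sum>i\<in>{..<n} - F. a i *\<^sub>R y i) + Vv"
        unfolding Y_def Vv_def using sum.subset_diff[OF F] by simp
      moreover have "f (\<Sum>i\<in>{..<n} - F. a i *\<^sub>R y i) = (\<Sum>i\<in>{..<n} - F. a i * f (y i))" if "linear f" for f
        using that by (simp add: linear_sum linear_scale)
      ultimately show ?thesis using ling ling0
        by (simp add: linear_add sum_subtractf right_diff_distrib)
    qed
    have le: "(\<Sum>i\<in>I. \<bar>a i * r i\<bar>) \<le> M * (4 * 2)" if "I \<subseteq> {..<n}" "\<And>i. i \<in> I \<Longrightarrow> \<bar>r i\<bar> \<le> 4 * (1/2) ^ i" for I and r :: "nat \<Rightarrow> real"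
    proof -
      have "(\<Sum>i\<in>I. \<bar>a i * r i\<bar>) \<le> (\<Sum>i\<in>I. M * (4 * (1/2) ^ i))"
        unfolding abs_mult using that aM M0 by (intro sum_mono mult_mono) auto
      also have "\<dots> = M * (4 * (\<Sum>i\<in>I. (1/2) ^ i))" by (simp add: sum_distrib_left)
      also have "\<dots> \<le> M * (4 * (2 * (1/2) ^ 0))"
        using M0 that(1) finite_subset[OF that(1)] by (intro mult_left_mono sum_half_powers_le) auto
      finally show ?thesis by simp
    qed
    have e1: "\<bar>\<Sum>i\<in>{..<n} - F. a i * (g (y i) - g0 (y i))\<bar> \<le> M * (4 * 2)"
      by (rule order_trans[OF sum_abs le]) (use off in auto)
    have "g0 Vv = (\<Sum>i\<in>F. a i * g0 (y i))"
      unfolding Vv_def using ling0 by (simp add: linear_sum linear_scale)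
    also have "\<bar>\<dots>\<bar> \<le> (\<Sum>i\<in>F. M * (1/2) ^ i)"
      by (rule order_trans[OF sum_abs]) (use F aM M0 g0F cF in \<open>auto simp: abs_mult p_def intro!: sum_mono mult_mono\<close>)
    also have "\<dots> = M * (\<Sum>i\<in>F. (1/2) ^ i)" by (simp add: sum_distrib_left)
    also have "\<dots> \<le> M * (2 * (1/2) ^ 0)" using M0 finF by (intro mult_left_mono sum_half_powers_le) auto
    finally have e2: "\<bar>g0 Vv\<bar> \<le> 2 * M" by simp
    have "\<bar>g Y\<bar> \<le> norm Y" "\<bar>g0 Y\<bar> \<le> norm Y" using G0(2) ib by (auto simp: g_def g0_def)
    then have "norm Vv \<le> 2 * norm Y + 12 * M" using g1 gY e1 e2 by linarith
    then show ?thesis by (simp add: Vv_def Y_def[symmetric] M_def algebra_simps)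
  qed
  then show ?thesis using that sm by (simp add: y_def)
qed

section \<open>Basic sequences and spreading models in seminormed spaces\<close>

text \<open>Turns a combination along an injective index map into one over an initial segment of the
  whole sequence, the form in which basis and projection bounds are stated.\<close>

lemma sum_reindex_extend:
  fixes u :: "nat \<Rightarrow> 'v::real_vector"
  assumes "inj_on k I" "k ` I \<subseteq> {..<R::nat}"
  obtains b :: "nat \<Rightarrow> real" where "(\<Sum>r<R. b r *\<^sub>R u r) = (\<Sum>i\<in>I. a i *\<^sub>R u (k i))"
    "\<And>i. i \<in> I \<Longrightarrow> b (k i) = a i" "\<And>r. r \<notin> k ` I \<Longrightarrow> b r = 0"
proof
  let ?b = "\<lambda>r. if r \<in> k ` I then a (inv_into I k r) else 0"
  show b: "?b (k i) = a i" if "i \<in> I" for i using that inv_into_f_f[OF assms(1)] by auto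
  have "(\<Sum>r<R. ?b r *\<^sub>R u r) = (\<Sum>r\<in>k ` I. ?b r *\<^sub>R u r)"
    using assms(2) by (intro sum.mono_neutral_right) auto
  also have "\<dots> = (\<Sum>i\<in>I. ?b (k i) *\<^sub>R u (k i))" by (simp add: sum.reindex[OF assms(1)])
  also have "\<dots> = (\<Sum>i\<in>I. a i *\<^sub>R u (k i))" by (rule sum.cong) (use b in auto)
  finally show "(\<Sum>r<R. ?b r *\<^sub>R u r) = (\<Sum>i\<in>I. a i *\<^sub>R u (k i))" .
qed simp

text \<open>One interface for \<open>UNIV\<close> with \<open>norm\<close> and for
  \<open>dual_space Y\<close> with \<open>dual_norm Y\<close>, whose elements are functions on the
  ambient type; the block construction is carried out in both.\<close>

locale seminormed =
  fixes V :: "'v::real_vector set" and N :: "'v \<Rightarrow> real"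
  assumes subspace_V: "subspace V"
    and triangle: "x \<in> V \<Longrightarrow> y \<in> V \<Longrightarrow> N (x + y) \<le> N x + N y"
    and N_scale: "x \<in> V \<Longrightarrow> N (c *\<^sub>R x) = \<bar>c\<bar> * N x"
begin

lemma N_0 [simp]: "N 0 = 0"
  using N_scale[OF subspace_0[OF subspace_V], of 0] by simp

lemma N_minus: "x \<in> V \<Longrightarrow> N (- x) = N x"
  using N_scale[of x "-1"] by simp

lemma N_nonneg: "x \<in> V \<Longrightarrow> 0 \<le> N x"
  using triangle[of x "- x"] N_minus[of x] subspace_neg[OF subspace_V, of x] by simp

lemma triangle_diff: "x \<in> V \<Longrightarrow> y \<in> V \<Longrightarrow> N (x - y) \<le> N x + N y"
  using triangle[of x "- y"] N_minus[of y] subspace_neg[OF subspace_V, of y] by simp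

lemma N_diff_comm: "x \<in> V \<Longrightarrow> y \<in> V \<Longrightarrow> N (x - y) = N (y - x)"
  using N_minus[of "x - y"] subspace_diff[OF subspace_V, of x y] by simp

lemma N_le_add_diff: "x \<in> V \<Longrightarrow> y \<in> V \<Longrightarrow> N x \<le> N y + N (x - y)"
  using triangle[of y "x - y"] subspace_diff[OF subspace_V, of x y] by simp

lemma abs_N_diff_le: "x \<in> V \<Longrightarrow> y \<in> V \<Longrightarrow> \<bar>N x - N y\<bar> \<le> N (x - y)"
  using N_le_add_diff[of x y] N_le_add_diff[of y x] N_diff_comm[of x y] by simp

lemma lincomb_in_V: "(\<And>i. i \<in> I \<Longrightarrow> u i \<in> V) \<Longrightarrow> (\<Sum>i\<in>I. a i *\<^sub>R u i) \<in> V"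
  by (intro subspace_sum[OF subspace_V] subspace_scale[OF subspace_V])

lemma N_sum_le:
  assumes "\<And>i. i \<in> I \<Longrightarrow> f i \<in> V"
  shows "N (\<Sum>i\<in>I. f i) \<le> (\<Sum>i\<in>I. N (f i))"
  using assms
proof (induction I rule: infinite_finite_induct)
  case (insert i I)
  have "N (f i + (\<Sum>i\<in>I. f i)) \<le> N (f i) + N (\<Sum>i\<in>I. f i)"
    by (rule triangle) (use insert.prems in \<open>auto intro: subspace_sum[OF subspace_V]\<close>)
  then show ?case using insert by (auto intro: order_trans)
qed auto

lemma N_lincomb_le:
  assumes "\<And>i. i \<in> I \<Longrightarrow> u i \<in> V"
  shows "N (\<Sum>i\<in>I. a i *\<^sub>R u i) \<le> (\<Sum>i\<in>I. \<bar>a i\<bar> * N (u i))"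
proof -
  have "N (\<Sum>i\<in>I. a i *\<^sub>R u i) \<le> (\<Sum>i\<in>I. N (a i *\<^sub>R u i))"
    by (rule N_sum_le) (use assms in \<open>auto intro: subspace_scale[OF subspace_V]\<close>)
  also have "\<dots> = (\<Sum>i\<in>I. \<bar>a i\<bar> * N (u i))" by (rule sum.cong) (use assms N_scale in auto)
  finally show ?thesis .
qed

text \<open>Grunblum's criterion for basic sequences, with basis constant \<open>K\<close>.\<close>

definition basis_const :: "(nat \<Rightarrow> 'v) \<Rightarrow> real \<Rightarrow> bool" where
  "basis_const u K \<longleftrightarrow> (\<forall>i. u i \<in> V) \<and>
     (\<forall>a t n. t \<le> n \<longrightarrow> N (\<Sum>i<t. a i *\<^sub>R u i) \<le> K * N (\<Sum>i<n. a i *\<^sub>R u i))"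

lemma basis_constD:
  assumes "basis_const u K"
  shows "u i \<in> V" "t \<le> n \<Longrightarrow> N (\<Sum>i<t. a i *\<^sub>R u i) \<le> K * N (\<Sum>i<n. a i *\<^sub>R u i)"
  using assms by (auto simp: basis_const_def)

lemma basis_const_coeff:
  assumes "basis_const u K" "i < n"
  shows "\<bar>a i\<bar> * N (u i) \<le> 2 * K * N (\<Sum>i<n. a i *\<^sub>R u i)"
proof -
  note V = basis_constD(1)[OF assms(1)]
  have "\<bar>a i\<bar> * N (u i) = N ((\<Sum>i<Suc i. a i *\<^sub>R u i) - (\<Sum>i<i. a i *\<^sub>R u i))"
    by (simp add: N_scale V)
  also have "\<dots> \<le> N (\<Sum>i<Suc i. a i *\<^sub>R u i) + N (\<Sum>i<i. a i *\<^sub>R u i)"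
    by (intro triangle_diff lincomb_in_V V)
  also have "\<dots> \<le> K * N (\<Sum>i<n. a i *\<^sub>R u i) + K * N (\<Sum>i<n. a i *\<^sub>R u i)"
    by (intro add_mono basis_constD(2)[OF assms(1)]) (use assms(2) in auto)
  finally show ?thesis by simp
qed

lemma basis_const_subseq:
  assumes "basis_const u K" "strict_mono m"
  shows "basis_const (\<lambda>i. u (m i)) K"
  unfolding basis_const_def
proof (intro conjI allI impI)
  show "u (m i) \<in> V" for i using basis_constD(1)[OF assms(1)] .
  fix a :: "nat \<Rightarrow> real" and t n :: nat assume tn: "t \<le> n"
  have inj: "inj_on m {..<n}" using strict_mono_imp_inj_on[OF assms(2)] inj_on_subset by blast
  obtain b where b: "(\<Sum>r<m n. b r *\<^sub>R u r) = (\<Sum>i\<in>{..<n}. a i *\<^sub>R u (m i))"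
    "\<And>i. i \<in> {..<n} \<Longrightarrow> b (m i) = a i" "\<And>r. r \<notin> m ` {..<n} \<Longrightarrow> b r = 0"
    by (rule sum_reindex_extend[OF inj, of "m n" u a]) (auto simp: strict_mono_less[OF assms(2)])
  have "(\<Sum>r<m t. b r *\<^sub>R u r) = (\<Sum>r\<in>m ` {..<t}. b r *\<^sub>R u r)"
  proof (rule sum.mono_neutral_right)
    show "\<forall>r\<in>{..<m t} - m ` {..<t}. b r *\<^sub>R u r = 0"
    proof
      fix r assume r: "r \<in> {..<m t} - m ` {..<t}"
      then have "r \<notin> m ` {..<n}" by (auto simp: strict_mono_less[OF assms(2)])
      then show "b r *\<^sub>R u r = 0" using b(3) by simp
    qed
  qed (auto simp: strict_mono_less[OF assms(2)])
  also have "\<dots> = (\<Sum>i<t. b (m i) *\<^sub>R u (m i))"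
    using sum.reindex[OF inj_on_subset[OF inj, of "{..<t}"]] tn by simp
  also have "\<dots> = (\<Sum>i<t. a i *\<^sub>R u (m i))" by (rule sum.cong) (use b(2) tn in auto)
  finally have "(\<Sum>r<m t. b r *\<^sub>R u r) = (\<Sum>i<t. a i *\<^sub>R u (m i))" .
  moreover have "m t \<le> m n" using tn strict_mono_less_eq[OF assms(2)] by simp
  ultimately show "N (\<Sum>i<t. a i *\<^sub>R u (m i)) \<le> K * N (\<Sum>i<n. a i *\<^sub>R u (m i))"
    using basis_constD(2)[OF assms(1), of "m t" "m n" b] b(1) by simp
qed

lemma basis_const_coeff_spread:
  fixes k :: "nat \<Rightarrow> nat"
  assumes "basis_const u K" "inj_on k {..<n}" "i < n"
  shows "\<bar>a i\<bar> * N (u (k i)) \<le> 2 * K * N (\<Sum>i<n. a i *\<^sub>R u (k i))"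
proof -
  define R where "R = Suc (Max (k ` {..<n}))"
  have R: "k j < R" if "j < n" for j unfolding R_def less_Suc_eq_le using that by (intro Max_ge) auto
  obtain b where b: "(\<Sum>r<R. b r *\<^sub>R u r) = (\<Sum>i\<in>{..<n}. a i *\<^sub>R u (k i))"
    "\<And>i. i \<in> {..<n} \<Longrightarrow> b (k i) = a i" "\<And>r. r \<notin> k ` {..<n} \<Longrightarrow> b r = 0"
    by (rule sum_reindex_extend[OF assms(2), of R u a]) (use R in auto)
  show ?thesis
    using basis_const_coeff[OF assms(1) R[OF assms(3)], of b] b(1) b(2)[of i] assms(3) by simp
qed

text \<open>Bounded partial-sum maps bound the coordinates, so the coefficients of approximants to
  \<open>y\<close> converge. The bound on partial sums is uniform in their length, hence the limit
  coefficients expand \<open>y\<close>; the coordinate bound also gives uniqueness. The zero padding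
  in \<open>d\<close> makes approximants of different lengths comparable.\<close>

lemma basic_seqI:
  assumes u: "basis_const u K" and pos: "\<And>i. 0 < N (u i)"
  shows "basic_seq V N u"
  unfolding basic_seq_def
proof (intro conjI ballI allI)
  note V = basis_constD(1)[OF u]
  show "u i \<in> V" for i by (rule V)
  fix y assume "y \<in> closed_span_seq V N u"
  then have yV: "y \<in> V" and "\<And>\<epsilon>. 0 < \<epsilon> \<Longrightarrow> \<exists>n c. N (y - (\<Sum>i<n. c i *\<^sub>R u i)) < \<epsilon>"
    by (auto simp: closed_span_seq_def)
  then have "\<exists>n c. N (y - (\<Sum>i<n. c i *\<^sub>R u i)) < 1 / real (Suc k)" for k by simp
  then obtain n c where c: "\<And>k. N (y - (\<Sum>i<n k. c k i *\<^sub>R u i)) < 1 / real (Suc k)" by metis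
  define d where "d = (\<lambda>k i. if i < n k then c k i else 0)"
  have dsum: "(\<Sum>i<m. d k i *\<^sub>R u i) = (\<Sum>i<n k. c k i *\<^sub>R u i)" if "n k \<le> m" for k m
    unfolding d_def using that by (intro sum.mono_neutral_cong_right) auto
  have K0: "0 \<le> K"
  proof -
    have "N (\<Sum>i<1. 1 *\<^sub>R u i) \<le> K * N (\<Sum>i<1. 1 *\<^sub>R u i)" by (rule basis_constD(2)[OF u]) simp
    then show ?thesis using pos[of 0] by simp
  qed
  have P: "N (\<Sum>i<m. (d k i - d l i) *\<^sub>R u i) \<le> K * (1 / real (Suc k) + 1 / real (Suc l))" for m k l
  proof -
    define M where "M = max m (max (n k) (n l))"
    define sk sl where "sk = (\<Sum>i<n k. c k i *\<^sub>R u i)" and "sl = (\<Sum>i<n l. c l i *\<^sub>R u i)"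
    have sV: "sk \<in> V" "sl \<in> V" by (auto simp: sk_def sl_def intro: lincomb_in_V V)
    have "N (\<Sum>i<m. (d k i - d l i) *\<^sub>R u i) \<le> K * N (\<Sum>i<M. (d k i - d l i) *\<^sub>R u i)"
      by (rule basis_constD(2)[OF u]) (simp add: M_def)
    also have "(\<Sum>i<M. (d k i - d l i) *\<^sub>R u i) = sk - sl"
      using dsum[of k M] dsum[of l M] by (simp add: scaleR_diff_left sum_subtractf M_def sk_def sl_def)
    also have "sk - sl = (y - sl) - (y - sk)" by simp
    also have "K * N \<dots> \<le> K * (N (y - sl) + N (y - sk))"
      using K0 by (intro mult_left_mono triangle_diff subspace_diff[OF subspace_V] yV sV)
    also have "\<dots> \<le> K * (1 / real (Suc k) + 1 / real (Suc l))"
      using K0 c[of k] c[of l] unfolding sk_def sl_def by (intro mult_left_mono) linarith+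
    finally show ?thesis .
  qed
  have coef: "\<bar>d k i - d l i\<bar> * N (u i) \<le> 2 * K * (K * (1 / real (Suc k) + 1 / real (Suc l)))" for k l i
    using basis_const_coeff[OF u, of i "Suc i" "\<lambda>i. d k i - d l i"] mult_left_mono[OF P[of k l "Suc i"], of "2 * K"] K0
    by linarith
  have "Cauchy (\<lambda>k. d k i)" for i
  proof (rule metric_CauchyI)
    fix e :: real assume e: "0 < e"
    define D where "D = 2 * K * K * 2 / N (u i)"
    have D0: "0 \<le> D" using K0 pos[of i] by (simp add: D_def)
    obtain M where M: "D / real (Suc M) < e"
    proof -
      obtain M where "D / e < real M" using reals_Archimedean2 by blast
      then have "D / e < real (Suc M)" by simp
      then show ?thesis using that[of M] e by (simp add: field_simps)
    qed
    show "\<exists>M. \<forall>m\<ge>M. \<forall>n\<ge>M. dist (d m i) (d n i) < e"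
    proof (intro exI allI impI)
      fix k l assume "M \<le> k" "M \<le> l"
      then have "1 / real (Suc k) + 1 / real (Suc l) \<le> 2 / real (Suc M)"
        using frac_le[of 1 1 "real (Suc M)" "real (Suc k)"] frac_le[of 1 1 "real (Suc M)" "real (Suc l)"] by simp
      then have "2 * K * (K * (1 / real (Suc k) + 1 / real (Suc l))) \<le> 2 * K * (K * (2 / real (Suc M)))"
        using K0 by (intro mult_left_mono) auto
      with coef[where k=k and l=l and i=i] have "\<bar>d k i - d l i\<bar> * N (u i) \<le> 2 * K * (K * (2 / real (Suc M)))" by linarith
      then have "\<bar>d k i - d l i\<bar> \<le> 2 * K * (K * (2 / real (Suc M))) / N (u i)"
        using pos[of i] by (subst pos_le_divide_eq)
      also have "\<dots> = D / real (Suc M)" by (simp add: D_def)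
      finally have "\<bar>d k i - d l i\<bar> \<le> D / real (Suc M)" .
      then show "dist (d k i) (d l i) < e" using M by (simp add: dist_real_def)
    qed
  qed
  then have "\<exists>l. (\<lambda>k. d k i) \<longlonglongrightarrow> l" for i by (simp add: Cauchy_convergent_iff convergent_def)
  then obtain b where b: "\<And>i. (\<lambda>k. d k i) \<longlonglongrightarrow> b i" by metis
  \<comment> \<open>Let \<open>l\<close> tend to infinity in \<open>P\<close>: for fixed
    \<open>m\<close> only finitely many coefficients move, while the resulting bound is independent
    of \<open>m\<close>.\<close>
  have Pb: "N (\<Sum>i<m. (d k i - b i) *\<^sub>R u i) \<le> K / real (Suc k)" for m k
  proof (rule LIMSEQ_le)
    have "(\<lambda>l. K * (1 / real (Suc k) + 1 / real (Suc l)) + (\<Sum>i<m. \<bar>d l i - b i\<bar> * N (u i)))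
        \<longlonglongrightarrow> K * (1 / real (Suc k) + 0) + (\<Sum>i<m. \<bar>b i - b i\<bar> * N (u i))"
      using lim_const_over_n[of 1] LIMSEQ_Suc[OF lim_const_over_n[of "1::real"]]
      by (intro tendsto_intros b) simp
    then show "(\<lambda>l. K * (1 / real (Suc k) + 1 / real (Suc l)) + (\<Sum>i<m. \<bar>d l i - b i\<bar> * N (u i)))
        \<longlonglongrightarrow> K / real (Suc k)" by simp
    show "(\<lambda>l. N (\<Sum>i<m. (d k i - b i) *\<^sub>R u i)) \<longlonglongrightarrow> N (\<Sum>i<m. (d k i - b i) *\<^sub>R u i)" by simp
    show "\<exists>M. \<forall>l\<ge>M. N (\<Sum>i<m. (d k i - b i) *\<^sub>R u i)
        \<le> K * (1 / real (Suc k) + 1 / real (Suc l)) + (\<Sum>i<m. \<bar>d l i - b i\<bar> * N (u i))"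
    proof (intro exI allI impI)
      fix l
      have "(\<Sum>i<m. (d k i - b i) *\<^sub>R u i) = (\<Sum>i<m. (d k i - d l i) *\<^sub>R u i) + (\<Sum>i<m. (d l i - b i) *\<^sub>R u i)"
        by (simp add: sum.distrib[symmetric] scaleR_add_left[symmetric])
      also have "N \<dots> \<le> N (\<Sum>i<m. (d k i - d l i) *\<^sub>R u i) + N (\<Sum>i<m. (d l i - b i) *\<^sub>R u i)"
        by (intro triangle lincomb_in_V V)
      also have "\<dots> \<le> K * (1 / real (Suc k) + 1 / real (Suc l)) + (\<Sum>i<m. \<bar>d l i - b i\<bar> * N (u i))"
        by (intro add_mono P N_lincomb_le V)
      finally show "N (\<Sum>i<m. (d k i - b i) *\<^sub>R u i)
        \<le> K * (1 / real (Suc k) + 1 / real (Suc l)) + (\<Sum>i<m. \<bar>d l i - b i\<bar> * N (u i))" .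
    qed
  qed
  have conv: "(\<lambda>m. N (y - (\<Sum>i<m. b i *\<^sub>R u i))) \<longlonglongrightarrow> 0"
  proof (rule LIMSEQ_I)
    fix e :: real assume e: "0 < e"
    obtain k where k: "(1 + K) / e < real (Suc k)"
      using reals_Archimedean2[of "(1 + K) / e"] by (metis lessI less_trans of_nat_less_iff)
    have "norm (N (y - (\<Sum>i<m. b i *\<^sub>R u i)) - 0) < e" if m: "n k \<le> m" for m
    proof -
      define s where "s = (\<Sum>i<n k. c k i *\<^sub>R u i)"
      have sV: "s \<in> V" "(\<Sum>i<m. b i *\<^sub>R u i) \<in> V" by (auto simp: s_def intro: lincomb_in_V V)
      have "y - (\<Sum>i<m. b i *\<^sub>R u i) = (y - s) + (\<Sum>i<m. (d k i - b i) *\<^sub>R u i)"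
        using dsum[OF m] by (simp add: scaleR_diff_left sum_subtractf s_def)
      also have "N \<dots> \<le> N (y - s) + N (\<Sum>i<m. (d k i - b i) *\<^sub>R u i)"
        by (intro triangle lincomb_in_V V subspace_diff[OF subspace_V] yV sV)
      also have "\<dots> \<le> 1 / real (Suc k) + K / real (Suc k)"
        using c[of k] Pb[of k m] by (simp add: s_def)
      also have "\<dots> = (1 + K) / real (Suc k)" by (simp add: add_divide_distrib)
      also have "\<dots> < e" using k e by (simp add: field_simps)
      finally show ?thesis using N_nonneg[OF subspace_diff[OF subspace_V yV sV(2)]] by simp
    qed
    then show "\<exists>no. \<forall>m\<ge>no. norm (N (y - (\<Sum>i<m. b i *\<^sub>R u i)) - 0) < e" by blast
  qed
  show "\<exists>!c. (\<lambda>n. N (y - (\<Sum>i<n. c i *\<^sub>R u i))) \<longlonglongrightarrow> 0"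
  proof (rule ex1I)
    show "(\<lambda>m. N (y - (\<Sum>i<m. b i *\<^sub>R u i))) \<longlonglongrightarrow> 0" by (rule conv)
    fix a assume a: "(\<lambda>n. N (y - (\<Sum>i<n. a i *\<^sub>R u i))) \<longlonglongrightarrow> 0"
    show "a = b"
    proof
      fix i
      have "\<bar>a i - b i\<bar> * N (u i) \<le> 0"
      proof (rule LIMSEQ_le)
        show "(\<lambda>n. \<bar>a i - b i\<bar> * N (u i)) \<longlonglongrightarrow> \<bar>a i - b i\<bar> * N (u i)" by simp
        show "(\<lambda>n. 2 * K * (N (y - (\<Sum>i<n. b i *\<^sub>R u i)) + N (y - (\<Sum>i<n. a i *\<^sub>R u i)))) \<longlonglongrightarrow> 0"
          using tendsto_mult_left[OF tendsto_add[OF conv a], of "2 * K"] by simp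
        show "\<exists>M. \<forall>n\<ge>M. \<bar>a i - b i\<bar> * N (u i)
            \<le> 2 * K * (N (y - (\<Sum>i<n. b i *\<^sub>R u i)) + N (y - (\<Sum>i<n. a i *\<^sub>R u i)))"
        proof (intro exI[of _ "Suc i"] allI impI)
          fix n assume "Suc i \<le> n"
          then have "\<bar>a i - b i\<bar> * N (u i) \<le> 2 * K * N (\<Sum>i<n. (a i - b i) *\<^sub>R u i)"
            by (intro basis_const_coeff[OF u]) simp
          also have "(\<Sum>i<n. (a i - b i) *\<^sub>R u i) = (y - (\<Sum>i<n. b i *\<^sub>R u i)) - (y - (\<Sum>i<n. a i *\<^sub>R u i))"
            by (simp add: scaleR_diff_left sum_subtractf)
          also have "2 * K * N \<dots> \<le> 2 * K * (N (y - (\<Sum>i<n. b i *\<^sub>R u i)) + N (y - (\<Sum>i<n. a i *\<^sub>R u i)))"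
            using K0 by (intro mult_left_mono triangle_diff subspace_diff[OF subspace_V] yV lincomb_in_V V) auto
          finally show "\<bar>a i - b i\<bar> * N (u i)
            \<le> 2 * K * (N (y - (\<Sum>i<n. b i *\<^sub>R u i)) + N (y - (\<Sum>i<n. a i *\<^sub>R u i)))" .
        qed
      qed
      then show "a i = b i" using pos[of i] by (simp add: mult_le_0_iff)
    qed
  qed
qed


text \<open>The Brunel-Sucheston theorem, with the stabilisation supplied by
  \<open>sparse_subsequence\<close>. The last conclusion gives the model norm as a limit over
  consecutive vectors, which is how it is evaluated on concrete coefficients later.\<close>

lemma spreading_model_subsequence:
  assumes y: "basis_const y K" and y1: "\<And>i. N (y i) = 1"
  obtains m :: "nat \<Rightarrow> nat" and S where "strict_mono m" "c00_seminorm S" "generates_sm V N (\<lambda>i. y (m i)) S"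
    "\<And>a n. (\<And>i. n \<le> i \<Longrightarrow> a i = 0) \<Longrightarrow> (\<lambda>k. N (\<Sum>i<n. a i *\<^sub>R y (m (k + i)))) \<longlonglongrightarrow> S a"
proof -
  obtain U where "free_ultrafilter U"
    using nonprincipal_ultrafilter_exists unfolding free_ultrafilter_def by blast
  then interpret free_ultrafilter U .
  note V = basis_constD(1)[OF y]
  define \<phi> where "\<phi> = (\<lambda>a ks. N (\<Sum>i<length ks. a i *\<^sub>R y (ks ! i)))"
  have \<phi>_bdd: "\<exists>B. \<forall>ks. \<bar>\<phi> a ks\<bar> \<le> B" if a: "a \<in> grid p q" for a p q
  proof (intro exI allI)
    fix ks :: "nat list"
    have "\<bar>\<phi> a ks\<bar> = \<phi> a ks" unfolding \<phi>_def by (intro abs_of_nonneg N_nonneg lincomb_in_V V)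
    also have "\<dots> \<le> (\<Sum>i<length ks. \<bar>a i\<bar> * N (y (ks ! i)))" unfolding \<phi>_def by (intro N_lincomb_le V)
    also have "\<dots> = (\<Sum>i<length ks. \<bar>a i\<bar>)" by (simp add: y1)
    also have "\<dots> = (\<Sum>i\<in>{..<length ks} \<inter> {..<p}. \<bar>a i\<bar>)"
      using a by (intro sum.mono_neutral_right) (auto simp: grid_def)
    also have "\<dots> \<le> (\<Sum>i<p. \<bar>a i\<bar>)" by (intro sum_mono2) auto
    finally show "\<bar>\<phi> a ks\<bar> \<le> (\<Sum>i<p. \<bar>a i\<bar>)" .
  qed
  \<comment> \<open>Mesh \<open>1 / 4 ^ p\<close> on \<open>p\<close> normalized vectors costs at
    most \<open>p / 4 ^ p \<le> (1/2) ^ p\<close>, the same order as the oscillation left by the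
    sparse choice.\<close>
  define Act where "Act = (\<lambda>h::nat list. (\<lambda>(p, a). (p, \<phi> a)) ` (SIGMA p:{..length h}. grid p (4 ^ p)))"
  have finA: "finite (Act h)" for h
    unfolding Act_def by (intro finite_imageI finite_SigmaI finite_grid) auto
  have half: "0 < (1/2::real) ^ s" for s :: nat by simp
  have tr: "eventually ((\<lambda>h k. True) h) sequentially" for h :: "nat list" by simp
  obtain m where sm: "strict_mono m" and
    step: "\<And>s n \<phi> ks. (n, \<phi>) \<in> Act (map m [0..<s]) \<Longrightarrow> set ks \<subseteq> m ` {..<s} \<Longrightarrow> length ks < n \<Longrightarrow>
       \<bar>iter_lim (n - Suc (length ks)) \<phi> (ks @ [m s]) - iter_lim (n - length ks) \<phi> ks\<bar> < (1/2) ^ s"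
  proof (rule sparse_subsequence[of Act "\<lambda>_ _. True" "\<lambda>s. (1/2) ^ s", OF finA _ tr half])
    show "\<exists>B. \<forall>ks. \<bar>\<psi> ks\<bar> \<le> B" if "(n, \<psi>) \<in> Act h" for n \<psi> h
      using that \<phi>_bdd by (auto simp: Act_def)
  qed blast
  define z where "z = (\<lambda>i. y (m i))"
  have zc: "basis_const z K" unfolding z_def by (rule basis_const_subseq[OF y sm])
  have z1: "N (z i) = 1" and zV: "z i \<in> V" for i by (auto simp: z_def y1 V)
  have grid_osc: "\<bar>N (\<Sum>i<p. b i *\<^sub>R z (k i)) - iter_lim p (\<phi> b) []\<bar> \<le> 2 * (1/2) ^ p"
    if b: "b \<in> grid p (4 ^ p)" and k: "strict_mono_on {..<p} k" "0 < p \<longrightarrow> p \<le> k 0" for b p k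
  proof -
    define qs where "qs = map k [0..<p]"
    have ge: "p \<le> s" if s: "s \<in> set qs" for s
    proof -
      obtain i where i: "i < p" "s = k i" using s by (auto simp: qs_def)
      have "k 0 \<le> k i" using strict_mono_onD[OF k(1), of 0 i] i by (cases "i = 0") auto
      then show ?thesis using k(2) i by auto
    qed
    have "\<bar>\<phi> b (map m ([] @ qs)) - iter_lim (length qs) (\<phi> b) (map m [])\<bar> \<le> (\<Sum>s\<in>set qs. (1/2) ^ s)"
    proof (rule iter_lim_telescope[where n=p])
      show "\<bar>iter_lim (p - Suc (length ks)) (\<phi> b) (ks @ [m s]) - iter_lim (p - length ks) (\<phi> b) ks\<bar> < (1/2) ^ s"
        if "s \<in> set qs" "set ks \<subseteq> m ` {..<s}" "length ks < p" for s ks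
      proof (rule step[OF _ that(2,3)])
        show "(p, \<phi> b) \<in> Act (map m [0..<s])" using b ge[OF that(1)] by (auto simp: Act_def)
      qed
      show "sorted_wrt (<) ([] @ qs)"
        using k(1) by (auto simp: qs_def sorted_wrt_iff_nth_less strict_mono_on_def)
    qed (simp add: qs_def)
    also have "\<dots> \<le> 2 * (1/2) ^ p" by (rule sum_half_powers_le) (use ge in auto)
    finally show ?thesis by (simp add: \<phi>_def qs_def z_def)
  qed
  have osc: "\<bar>N (\<Sum>i<p. a i *\<^sub>R z (k i)) - N (\<Sum>i<p. a i *\<^sub>R z (l i))\<bar> \<le> 6 * A * (1/2) ^ p"
    if a: "\<And>i. i < p \<Longrightarrow> \<bar>a i\<bar> \<le> A" and A: "0 \<le> A"
      and k: "strict_mono_on {..<p} k" "0 < p \<longrightarrow> p \<le> k 0" and l: "strict_mono_on {..<p} l" "0 < p \<longrightarrow> p \<le> l 0"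
    for a A p k l
  proof -
    obtain b where b: "b \<in> grid p (4 ^ p)" "\<And>i. i < p \<Longrightarrow> \<bar>a i - A * b i\<bar> \<le> A / real (4 ^ p)"
      using grid_approx[of "4 ^ p" p a A] a by auto
    define L where "L = iter_lim p (\<phi> b) []"
    have *: "\<bar>N (\<Sum>i<p. a i *\<^sub>R z (k i)) - A * L\<bar> \<le> 3 * A * (1/2) ^ p"
      if k: "strict_mono_on {..<p} k" "0 < p \<longrightarrow> p \<le> k 0" for k
    proof -
      define v w where "v = (\<Sum>i<p. a i *\<^sub>R z (k i))" and "w = (\<Sum>i<p. b i *\<^sub>R z (k i))"
      have vw: "v \<in> V" "w \<in> V" by (auto simp: v_def w_def intro: lincomb_in_V zV)
      have "v - A *\<^sub>R w = (\<Sum>i<p. (a i - A * b i) *\<^sub>R z (k i))"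
        by (simp add: v_def w_def scaleR_diff_left sum_subtractf scaleR_sum_right)
      also have "N \<dots> \<le> (\<Sum>i<p. \<bar>a i - A * b i\<bar> * N (z (k i)))" by (intro N_lincomb_le zV)
      also have "\<dots> \<le> (\<Sum>i<p. A / real (4 ^ p))" by (rule sum_mono) (use b z1 in simp)
      also have "\<dots> = A * (real p / 4 ^ p)" by simp
      also have "\<dots> \<le> A * (1/2) ^ p"
      proof (rule mult_left_mono[OF _ A])
        have "real p \<le> 2 ^ p" using of_nat_less_two_power[of p, where ?'a=real] by simp
        then have "real p / 4 ^ p \<le> 2 ^ p / 4 ^ p" by (simp add: divide_right_mono)
        also have "\<dots> = (2 / 4 :: real) ^ p" by (simp only: power_divide)
        finally show "real p / 4 ^ p \<le> (1/2) ^ p" by simp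
      qed
      finally have 1: "N (v - A *\<^sub>R w) \<le> A * (1/2) ^ p" .
      have "\<bar>N v - N (A *\<^sub>R w)\<bar> \<le> N (v - A *\<^sub>R w)"
        by (intro abs_N_diff_le vw subspace_scale[OF subspace_V])
      moreover have "N (A *\<^sub>R w) = A * N w" using N_scale[OF vw(2)] A by simp
      moreover have "\<bar>A * N w - A * L\<bar> \<le> A * (2 * (1/2) ^ p)"
        using mult_left_mono[OF grid_osc[OF b(1) k] A] A
        by (simp add: w_def L_def abs_mult flip: right_diff_distrib)
      ultimately show ?thesis using 1 by (simp add: v_def)
    qed
    show ?thesis using *[OF k] *[OF l] by linarith
  qed
  \<comment> \<open>By \<open>osc\<close> the limit does not depend on how the increasing indices
    tend to infinity; consecutive ones are chosen.\<close>
  define S where "S = (\<lambda>a. lim (\<lambda>k. N (\<Sum>i\<in>{i. a i \<noteq> 0}. a i *\<^sub>R z (k + i))))"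
  have S_lim: "(\<lambda>k. N (\<Sum>i<n. a i *\<^sub>R z (k + i))) \<longlonglongrightarrow> S a" if a0: "\<And>i. n \<le> i \<Longrightarrow> a i = 0" for a n
  proof -
    have ext: "(\<Sum>i<p. a i *\<^sub>R z (k + i)) = (\<Sum>i<n. a i *\<^sub>R z (k + i))" if "n \<le> p" for p k
      using that a0 by (intro sum.mono_neutral_right) auto
    have supp: "(\<Sum>i\<in>{i. a i \<noteq> 0}. a i *\<^sub>R z (k + i)) = (\<Sum>i<n. a i *\<^sub>R z (k + i))" for k
      using a0 by (intro sum.mono_neutral_left) (auto simp: not_less[symmetric])
    define A where "A = (\<Sum>i<n. \<bar>a i\<bar>)"
    have A0: "0 \<le> A" by (simp add: A_def sum_nonneg)
    have aA: "\<bar>a i\<bar> \<le> A" for i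
    proof (cases "i < n")
      case True then show ?thesis unfolding A_def by (intro member_le_sum) auto
    qed (use a0 A0 in simp)
    have "Cauchy (\<lambda>k. N (\<Sum>i<n. a i *\<^sub>R z (k + i)))"
    proof (rule metric_CauchyI)
      fix e :: real assume e: "0 < e"
      have "(\<lambda>p. 6 * A * (1/2::real) ^ p) \<longlonglongrightarrow> 6 * A * 0"
        by (intro tendsto_mult_left LIMSEQ_power_zero) simp
      then have "eventually (\<lambda>p. 6 * A * (1/2::real) ^ p < e) sequentially"
        using e order_tendstoD(2) by fastforce
      then have "eventually (\<lambda>p. 6 * A * (1/2::real) ^ p < e \<and> n \<le> p) sequentially"
        using eventually_conj eventually_ge_at_top by blast
      then obtain p where p: "6 * A * (1/2::real) ^ p < e" "n \<le> p"
        using eventually_happens'[of sequentially] by auto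
      show "\<exists>M. \<forall>k\<ge>M. \<forall>l\<ge>M. dist (N (\<Sum>i<n. a i *\<^sub>R z (k + i))) (N (\<Sum>i<n. a i *\<^sub>R z (l + i))) < e"
      proof (intro exI[of _ p] allI impI)
        fix k l assume "p \<le> k" "p \<le> l"
        then have "\<bar>N (\<Sum>i<p. a i *\<^sub>R z (k + i)) - N (\<Sum>i<p. a i *\<^sub>R z (l + i))\<bar> \<le> 6 * A * (1/2) ^ p"
          by (intro osc aA A0) (auto simp: strict_mono_on_def)
        then show "dist (N (\<Sum>i<n. a i *\<^sub>R z (k + i))) (N (\<Sum>i<n. a i *\<^sub>R z (l + i))) < e"
          using p(1) unfolding dist_real_def ext[OF p(2)] by linarith
      qed
    qed
    then show ?thesis
      unfolding S_def supp by (simp add: Cauchy_convergent_iff convergent_LIMSEQ_iff)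
  qed
  have S_est: "\<bar>N (\<Sum>i<p. a i *\<^sub>R z (k i)) - S (\<lambda>i. if i < p then a i else 0)\<bar> \<le> 6 * A * (1/2) ^ p"
    if a: "\<And>i. i < p \<Longrightarrow> \<bar>a i\<bar> \<le> A" and A: "0 \<le> A"
      and k: "strict_mono_on {..<p} k" "0 < p \<longrightarrow> p \<le> k 0" for a A p k
  proof (rule LIMSEQ_le)
    have "(\<lambda>l. N (\<Sum>i<p. (if i < p then a i else 0) *\<^sub>R z (l + i))) \<longlonglongrightarrow> S (\<lambda>i. if i < p then a i else 0)"
      by (rule S_lim) simp
    then show "(\<lambda>l. \<bar>N (\<Sum>i<p. a i *\<^sub>R z (k i)) - N (\<Sum>i<p. a i *\<^sub>R z (l + i))\<bar>)
      \<longlonglongrightarrow> \<bar>N (\<Sum>i<p. a i *\<^sub>R z (k i)) - S (\<lambda>i. if i < p then a i else 0)\<bar>"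
      by (intro tendsto_intros) simp
    show "(\<lambda>l. 6 * A * (1/2) ^ p) \<longlonglongrightarrow> 6 * A * (1/2) ^ p" by simp
    show "\<exists>M. \<forall>l\<ge>M. \<bar>N (\<Sum>i<p. a i *\<^sub>R z (k i)) - N (\<Sum>i<p. a i *\<^sub>R z (l + i))\<bar> \<le> 6 * A * (1/2) ^ p"
      by (intro exI[of _ p] allI impI osc a A k) (auto simp: strict_mono_on_def)
  qed
  have c00: "c00_seminorm S"
    unfolding c00_seminorm_def
  proof (intro conjI allI impI)
    fix a b :: "nat \<Rightarrow> real" assume fa: "finite {i. a i \<noteq> 0}" and fb: "finite {i. b i \<noteq> 0}"
    obtain n where n: "\<And>i. n \<le> i \<Longrightarrow> a i = 0" "\<And>i. n \<le> i \<Longrightarrow> b i = 0"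
    proof -
      have "finite ({i. a i \<noteq> 0} \<union> {i. b i \<noteq> 0})" using fa fb by simp
      then obtain n where "{i. a i \<noteq> 0} \<union> {i. b i \<noteq> 0} \<subseteq> {..<n}" using finite_nat_bounded by blast
      then show ?thesis using that[of n] by fastforce
    qed
    have "(\<lambda>k. N (\<Sum>i<n. (a i + b i) *\<^sub>R z (k + i))) \<longlonglongrightarrow> S (\<lambda>i. a i + b i)"
      by (rule S_lim) (simp add: n)
    moreover have "(\<lambda>k. N (\<Sum>i<n. a i *\<^sub>R z (k + i)) + N (\<Sum>i<n. b i *\<^sub>R z (k + i))) \<longlonglongrightarrow> S a + S b"
      by (intro tendsto_add S_lim n)
    moreover have "N (\<Sum>i<n. (a i + b i) *\<^sub>R z (k + i)) \<le> N (\<Sum>i<n. a i *\<^sub>R z (k + i)) + N (\<Sum>i<n. b i *\<^sub>R z (k + i))" for k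
      using triangle[OF lincomb_in_V lincomb_in_V, of "{..<n}" "\<lambda>i. z (k + i)" "{..<n}" "\<lambda>i. z (k + i)" a b] zV
      by (simp add: scaleR_add_left sum.distrib)
    ultimately show "S (\<lambda>i. a i + b i) \<le> S a + S b" using LIMSEQ_le by blast
  next
    fix a :: "nat \<Rightarrow> real" and c :: real assume fa: "finite {i. a i \<noteq> 0}"
    obtain n where n: "\<And>i. n \<le> i \<Longrightarrow> a i = 0"
    proof -
      obtain n where "{i. a i \<noteq> 0} \<subseteq> {..<n}" using finite_nat_bounded[OF fa] by blast
      then show ?thesis using that[of n] by fastforce
    qed
    have "(\<lambda>k. N (\<Sum>i<n. (c * a i) *\<^sub>R z (k + i))) \<longlonglongrightarrow> S (\<lambda>i. c * a i)"
      by (rule S_lim) (simp add: n)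
    moreover have "N (\<Sum>i<n. (c * a i) *\<^sub>R z (k + i)) = \<bar>c\<bar> * N (\<Sum>i<n. a i *\<^sub>R z (k + i))" for k
      using N_scale[OF lincomb_in_V, of "{..<n}" "\<lambda>i. z (k + i)" c a] zV by (simp add: scaleR_sum_right)
    moreover have "(\<lambda>k. \<bar>c\<bar> * N (\<Sum>i<n. a i *\<^sub>R z (k + i))) \<longlonglongrightarrow> \<bar>c\<bar> * S a"
      by (intro tendsto_mult_left S_lim n)
    ultimately show "S (\<lambda>i. c * a i) = \<bar>c\<bar> * S a" using LIMSEQ_unique by force
  qed
  have K1: "1 \<le> K"
    using basis_constD(2)[OF y, of 1 1 "\<lambda>_. 1"] by (simp add: y1)
  have gen: "generates_sm V N z S"
    unfolding generates_sm_def
  \<comment> \<open>The additive error is \<open>6 * A * (1/2) ^ p\<close>, and the largest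
    coefficient \<open>A\<close> is at most \<open>2 * K\<close> times either norm; this turns it
    into the relative error \<open>12 * K * (1/2) ^ p\<close>.\<close>
  proof (intro conjI exI[of _ "\<lambda>p. 12 * K * (1/2) ^ p"] allI impI)
    show "normalized_basic V N z"
      unfolding normalized_basic_def using basic_seqI[OF zc] z1 by auto
    show "decseq (\<lambda>p. 12 * K * (1/2) ^ p)"
      using K1 by (intro decseq_SucI) auto
    show "(\<lambda>p. 12 * K * (1/2) ^ p) \<longlonglongrightarrow> 0"
      using tendsto_mult_left[OF LIMSEQ_power_zero, of "1/2::real" "12 * K"] by simp
    show "0 < 12 * K * (1/2) ^ p" for p using K1 by simp
    fix p :: nat and a :: "nat \<Rightarrow> real" and k :: "nat \<Rightarrow> nat"
    assume "(\<forall>i<p. \<bar>a i\<bar> \<le> 1) \<and> strict_mono_on {..<p} k \<and> (0 < p \<longrightarrow> p \<le> k 0)"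
    then have k: "strict_mono_on {..<p} k" "0 < p \<longrightarrow> p \<le> k 0" by auto
    define s where "s = S (\<lambda>i. if i < p then a i else 0)"
    define t where "t = N (\<Sum>i<p. a i *\<^sub>R z (k i))"
    define A where "A = Max (insert 0 ((\<lambda>i. \<bar>a i\<bar>) ` {..<p}))"
    have A0: "0 \<le> A" by (simp add: A_def)
    have aA: "\<bar>a i\<bar> \<le> A" if "i < p" for i using that by (auto simp: A_def intro!: Max_ge)
    have At: "A \<le> 2 * K * N (\<Sum>i<p. a i *\<^sub>R z (k i))" if k: "strict_mono_on {..<p} k" for k
      unfolding A_def
    proof (rule Max.boundedI)
      fix r assume "r \<in> insert 0 ((\<lambda>i. \<bar>a i\<bar>) ` {..<p})"
      then consider "r = 0" | i where "i < p" "r = \<bar>a i\<bar>" by auto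
      then show "r \<le> 2 * K * N (\<Sum>i<p. a i *\<^sub>R z (k i))"
      proof cases
        case 1
        then show ?thesis using K1 N_nonneg[OF lincomb_in_V, of "{..<p}" "\<lambda>i. z (k i)" a] zV by simp
      next
        case 2
        then show ?thesis
          using basis_const_coeff_spread[OF zc strict_mono_on_imp_inj_on[OF k] 2(1), of a] z1 by simp
      qed
    qed auto
    have As: "A \<le> 2 * K * s"
    proof (rule LIMSEQ_le_const)
      have "(\<lambda>l. N (\<Sum>i<p. (if i < p then a i else 0) *\<^sub>R z (l + i))) \<longlonglongrightarrow> s"
        unfolding s_def by (rule S_lim) simp
      then show "(\<lambda>l. 2 * K * N (\<Sum>i<p. a i *\<^sub>R z (l + i))) \<longlonglongrightarrow> 2 * K * s"
        by (intro tendsto_mult_left) simp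
      show "\<exists>M. \<forall>l\<ge>M. A \<le> 2 * K * N (\<Sum>i<p. a i *\<^sub>R z (l + i))"
        by (intro exI allI impI At) (auto simp: strict_mono_on_def)
    qed
    have Ak: "A \<le> 2 * K * t" unfolding t_def by (rule At[OF k(1)])
    have d: "\<bar>t - s\<bar> \<le> 6 * A * (1/2) ^ p"
      unfolding t_def s_def by (rule S_est[OF aA A0 k])
    have bd: "6 * A * (1/2) ^ p \<le> 12 * K * (1/2) ^ p * r" if "A \<le> 2 * K * r" for r
      using mult_right_mono[OF that, of "6 * (1/2) ^ p"] by (simp add: ac_simps)
    have ts: "t \<le> (1 + 12 * K * (1/2) ^ p) * s" "s \<le> (1 + 12 * K * (1/2) ^ p) * t"
      using d bd[OF As] bd[OF Ak] unfolding distrib_right by linarith+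
    have "0 < 1 + 12 * K * (1/2) ^ p" using K1 by (simp add: add_pos_pos)
    then have "inverse (1 + 12 * K * (1/2) ^ p) * s \<le> t"
      using ts(2) by (metis divide_inverse mult.commute pos_divide_le_eq)
    then show "let s = S (\<lambda>i. if i < p then a i else 0); t = N (\<Sum>i<p. a i *\<^sub>R z (k i))
      in inverse (1 + 12 * K * (1/2) ^ p) * s \<le> t \<and> t \<le> (1 + 12 * K * (1/2) ^ p) * s"
      using ts(1) by (simp add: Let_def s_def t_def)
  qed
  show ?thesis
    by (rule that[of m S]) (use sm c00 gen S_lim in \<open>auto simp: z_def\<close>)
qed

end

section \<open>Submultiplicativity\<close>

text \<open>In particular \<open>trunc n (\<lambda>_. 1)\<close> is the vector (1, ..., 1) of length
  \<open>n\<close>, whose norm as a function of \<open>n\<close> decides between c0 and lp and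
  determines p.\<close>

definition trunc :: "nat \<Rightarrow> (nat \<Rightarrow> real) \<Rightarrow> nat \<Rightarrow> real" where
  "trunc n a = (\<lambda>i. if i < n then a i else 0)"

text \<open>\<open>tens n a b\<close> lists \<open>a \<otimes> b\<close> in lexicographic order, with \<open>b\<close> regarded as a vector of length \<open>n\<close>.\<close>

definition tens :: "nat \<Rightarrow> (nat \<Rightarrow> real) \<Rightarrow> (nat \<Rightarrow> real) \<Rightarrow> nat \<Rightarrow> real" where
  "tens n a b = (\<lambda>r. a (r div n) * b (r mod n))"

lemma finite_supp_trunc [simp]: "finite {i. trunc n a i \<noteq> 0}"
  by (rule finite_subset[of _ "{..<n}"]) (auto simp: trunc_def)

lemma trunc_eq_self: "(\<And>i. n \<le> i \<Longrightarrow> a i = 0) \<Longrightarrow> trunc n a = a"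
  by (auto simp: trunc_def fun_eq_iff)

lemma trunc_cong: "(\<And>i. i < n \<Longrightarrow> a i = b i) \<Longrightarrow> trunc n a = trunc n b"
  by (auto simp: trunc_def fun_eq_iff)

lemma finite_supp_bounded:
  assumes "finite {i::nat. a i \<noteq> (0::real)}"
  obtains n where "\<And>i. n \<le> i \<Longrightarrow> a i = 0"
proof -
  obtain n where "{i. a i \<noteq> 0} \<subseteq> {..<n}" using finite_nat_bounded[OF assms] by blast
  then show ?thesis using that[of n] by fastforce
qed

lemma c00_seminormD:
  assumes "c00_seminorm T"
  shows "T (trunc n (\<lambda>i. a i + b i)) \<le> T (trunc n a) + T (trunc n b)"
    and "T (trunc n (\<lambda>i. c * a i)) = \<bar>c\<bar> * T (trunc n a)"
proof -
  have *: "trunc n (\<lambda>i. a i + b i) = (\<lambda>i. trunc n a i + trunc n b i)"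
    "trunc n (\<lambda>i. c * a i) = (\<lambda>i. c * trunc n a i)"
    by (auto simp: trunc_def)
  have **: "\<And>a b. finite {i. a i \<noteq> 0} \<Longrightarrow> finite {i. b i \<noteq> 0} \<Longrightarrow> T (\<lambda>i. a i + b i) \<le> T a + T b"
    "\<And>a c. finite {i. a i \<noteq> 0} \<Longrightarrow> T (\<lambda>i. c * a i) = \<bar>c\<bar> * T a"
    using assms unfolding c00_seminorm_def by blast+
  show "T (trunc n (\<lambda>i. a i + b i)) \<le> T (trunc n a) + T (trunc n b)"
    unfolding * by (rule **(1)) simp_all
  show "T (trunc n (\<lambda>i. c * a i)) = \<bar>c\<bar> * T (trunc n a)"
    unfolding * by (rule **(2)) simp
qed

lemma c00_seminorm_nonneg:
  assumes S: "c00_seminorm S" and fin: "finite {i. a i \<noteq> 0}"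
  shows "0 \<le> S a"
proof -
  obtain n where "\<And>i. n \<le> i \<Longrightarrow> a i = 0" using finite_supp_bounded[OF fin] by blast
  then have a: "trunc n a = a" by (rule trunc_eq_self)
  have "S (trunc n (\<lambda>i. a i + (-1) * a i)) \<le> S (trunc n a) + S (trunc n (\<lambda>i. (-1) * a i))"
    by (rule c00_seminormD(1)[OF S])
  moreover have "S (trunc n (\<lambda>i. a i + (-1) * a i)) = 0"
    using c00_seminormD(2)[OF S, of n 0 a] by simp
  ultimately show ?thesis using c00_seminormD(2)[OF S, of n "-1" a] a by simp
qed

lemma sum_lessThan_mult:
  fixes f :: "nat \<Rightarrow> 'a::comm_monoid_add"
  shows "(\<Sum>q<m * n. f q) = (\<Sum>i<m. \<Sum>j<n. f (i * n + j))"
proof (induction m)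
  case (Suc m)
  have "(\<Sum>q<Suc m * n. f q) = (\<Sum>q<m * n. f q) + (\<Sum>q\<in>{m * n..<m * n + n}. f q)"
    by (metis add.commute atLeast0LessThan le_add1 mult_Suc sum.atLeastLessThan_concat zero_le)
  also have "(\<Sum>q\<in>{m * n..<m * n + n}. f q) = (\<Sum>j<n. f (m * n + j))"
    using sum.shift_bounds_nat_ivl[of f 0 "m * n" n] by (simp add: atLeast0LessThan add.commute)
  finally show ?case using Suc by simp
qed simp

lemma bdd_lin_functional_sum:
  assumes "bdd_lin_functional V N \<Phi>" "subspace V" "\<And>i. i \<in> I \<Longrightarrow> v i \<in> V" "finite I"
  shows "\<Phi> (\<Sum>i\<in>I. a i *\<^sub>R v i) = (\<Sum>i\<in>I. a i * \<Phi> (v i))"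
proof -
  have add: "\<And>x y. x \<in> V \<Longrightarrow> y \<in> V \<Longrightarrow> \<Phi> (x + y) = \<Phi> x + \<Phi> y"
    and sc: "\<And>x c. x \<in> V \<Longrightarrow> \<Phi> (c *\<^sub>R x) = c * \<Phi> x"
    using assms(1) by (auto simp: bdd_lin_functional_def)
  show ?thesis using assms(4,3)
  proof (induction I)
    case empty
    show ?case using sc[OF subspace_0[OF assms(2)], of 0] by simp
  next
    case (insert i I)
    have "\<Phi> (a i *\<^sub>R v i + (\<Sum>i\<in>I. a i *\<^sub>R v i)) = \<Phi> (a i *\<^sub>R v i) + \<Phi> (\<Sum>i\<in>I. a i *\<^sub>R v i)"
      using insert.prems by (intro add subspace_scale[OF assms(2)] subspace_sum[OF assms(2)]) auto
    then show ?case using insert sc by simp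
  qed
qed

section \<open>Schreier unconditional sequences and the norm of their spreading model\<close>

lemma (in seminormed) basis_const_scale:
  assumes "basis_const y K"
  shows "basis_const (\<lambda>i. d i *\<^sub>R y i) K"
  unfolding basis_const_def
proof (intro conjI allI impI)
  show "d i *\<^sub>R y i \<in> V" for i by (rule subspace_scale[OF subspace_V basis_constD(1)[OF assms]])
  show "N (\<Sum>i<t. a i *\<^sub>R d i *\<^sub>R y i) \<le> K * N (\<Sum>i<n. a i *\<^sub>R d i *\<^sub>R y i)" if "t \<le> n" for a t n
    using basis_constD(2)[OF assms that, of "\<lambda>i. a i * d i"] by simp
qed

text \<open>\<open>T\<close> matches the norm of \<open>u\<close> on Schreier supports only up to
  the constant \<open>C\<close>: this weaker link passes to biorthogonal functionals with the dual
  norm, and it suffices for statements up to equivalence. The same \<open>K\<close> is basis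
  constant and bound of the projections.\<close>

locale schreier_seq = seminormed V N for V :: "'v::real_vector set" and N +
  fixes u :: "nat \<Rightarrow> 'v" and K C :: real and T :: "(nat \<Rightarrow> real) \<Rightarrow> real"
  assumes u_basis: "basis_const u K"
    and proj_schreier: "\<And>a F n. F \<subseteq> {..<n} \<Longrightarrow> (\<And>i. i \<in> F \<Longrightarrow> card F \<le> i) \<Longrightarrow>
       N (\<Sum>i\<in>F. a i *\<^sub>R u i) \<le> K * N (\<Sum>i<n. a i *\<^sub>R u i)"
    and T: "c00_seminorm T"
    and T_lower: "\<And>a n k. strict_mono_on {..<n} k \<Longrightarrow> (0 < n \<longrightarrow> n \<le> k 0) \<Longrightarrow>
       T (trunc n a) \<le> C * N (\<Sum>i<n. a i *\<^sub>R u (k i))"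
    and T_upper: "\<And>a n k. strict_mono_on {..<n} k \<Longrightarrow> (0 < n \<longrightarrow> n \<le> k 0) \<Longrightarrow>
       N (\<Sum>i<n. a i *\<^sub>R u (k i)) \<le> C * T (trunc n a)"
    and K1: "1 \<le> K" and C1: "1 \<le> C"
    and T_pos: "0 < T (trunc 1 (\<lambda>_. 1))"
begin

lemma u_V: "u i \<in> V" using basis_constD(1)[OF u_basis] .

lemma T_nonneg: "0 \<le> T (trunc n a)"
proof -
  have "N (\<Sum>i<n. a i *\<^sub>R u (n + i)) \<le> C * T (trunc n a)"
    by (rule T_upper) (auto simp: strict_mono_on_def)
  moreover have "0 \<le> N (\<Sum>i<n. a i *\<^sub>R u (n + i))" by (intro N_nonneg lincomb_in_V u_V)
  ultimately have "0 \<le> C * T (trunc n a)" by linarith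
  then show ?thesis using C1 by (simp add: zero_le_mult_iff)
qed

lemma T_zero: "T (trunc n (\<lambda>_. 0)) = 0"
  using c00_seminormD(2)[OF T, of n 0 "\<lambda>_. 0"] by simp

lemma T_coeff:
  assumes "i < n"
  shows "\<bar>a i\<bar> * T (trunc 1 (\<lambda>_. 1)) \<le> 2 * K * C ^ 2 * T (trunc n a)"
proof -
  have "T (trunc 1 (\<lambda>_. 1)) \<le> C * N (\<Sum>j<1. 1 *\<^sub>R u ((\<lambda>j. n + i + j) j))"
    by (rule T_lower) (use assms in \<open>auto simp: strict_mono_on_def\<close>)
  then have "\<bar>a i\<bar> * T (trunc 1 (\<lambda>_. 1)) \<le> \<bar>a i\<bar> * (C * N (u (n + i)))" by (intro mult_left_mono) auto
  also have "\<dots> = C * (\<bar>a i\<bar> * N (u (n + i)))" by simp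
  also have "\<dots> \<le> C * (2 * K * N (\<Sum>i<n. a i *\<^sub>R u (n + i)))"
    using C1 by (intro mult_left_mono basis_const_coeff_spread[OF u_basis _ assms]) (auto simp: inj_on_def)
  also have "\<dots> \<le> C * (2 * K * (C * T (trunc n a)))"
    using C1 K1 by (intro mult_left_mono T_upper) (auto simp: strict_mono_on_def)
  finally show ?thesis by (simp add: power2_eq_square ac_simps)
qed

text \<open>Since \<open>n \<le> k 0\<close>, every subset of these indices has at most
  \<open>n\<close> elements, all of them at least \<open>n\<close>, so \<open>proj_schreier\<close>
  applies to it.\<close>

lemma suppression:
  assumes k: "strict_mono_on {..<n} k" "0 < n \<longrightarrow> n \<le> k 0" and A: "A \<subseteq> {..<n}"
  shows "N (\<Sum>i\<in>A. a i *\<^sub>R u (k i)) \<le> K * N (\<Sum>i<n. a i *\<^sub>R u (k i))"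
proof -
  define R where "R = Suc (Max (k ` {..<n}))"
  have R: "k j < R" if "j < n" for j unfolding R_def less_Suc_eq_le using that by (intro Max_ge) auto
  have inj: "inj_on k {..<n}" using strict_mono_on_imp_inj_on[OF k(1)] .
  obtain b where b: "(\<Sum>r<R. b r *\<^sub>R u r) = (\<Sum>i\<in>{..<n}. a i *\<^sub>R u (k i))"
    "\<And>i. i \<in> {..<n} \<Longrightarrow> b (k i) = a i" "\<And>r. r \<notin> k ` {..<n} \<Longrightarrow> b r = 0"
    by (rule sum_reindex_extend[OF inj, of R u a]) (use R in auto)
  have "N (\<Sum>r\<in>k ` A. b r *\<^sub>R u r) \<le> K * N (\<Sum>r<R. b r *\<^sub>R u r)"
  proof (rule proj_schreier)
    show "k ` A \<subseteq> {..<R}" using A R by auto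
    fix r assume "r \<in> k ` A"
    then obtain i where i: "i < n" "r = k i" using A by auto
    have "card (k ` A) \<le> n"
      using card_image_le[of A k] card_mono[OF _ A] finite_subset[OF A] by simp
    also have "n \<le> k i" using k(2) i strict_mono_onD[OF k(1), of 0 i] by (cases "i = 0") auto
    finally show "card (k ` A) \<le> r" using i by simp
  qed
  moreover have "(\<Sum>r\<in>k ` A. b r *\<^sub>R u r) = (\<Sum>i\<in>A. a i *\<^sub>R u (k i))"
    using A b(2) by (subst sum.reindex[OF inj_on_subset[OF inj A]]) (auto intro!: sum.cong)
  ultimately show ?thesis using b(1) by simp
qed

text \<open>Multipliers in [0, 1] are averages of 0-1 multipliers. The induction is over the set
  \<open>D\<close> of coordinates that may be fractional: one of them is written as a convex
  combination of the values 1 and 0, and the 0-1 case is \<open>suppression\<close>.\<close>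

lemma unconditional_nonneg:
  assumes k: "strict_mono_on {..<n} k" "0 < n \<longrightarrow> n \<le> k 0"
    and D: "finite D" and \<theta>: "\<And>i. i < n \<Longrightarrow> 0 \<le> \<theta> i \<and> \<theta> i \<le> 1"
    "\<And>i. i < n \<Longrightarrow> i \<notin> D \<Longrightarrow> \<theta> i = 0 \<or> \<theta> i = 1"
  shows "N (\<Sum>i<n. (\<theta> i * a i) *\<^sub>R u (k i)) \<le> K * N (\<Sum>i<n. a i *\<^sub>R u (k i))"
  using D \<theta>
proof (induction D arbitrary: \<theta>)
  case empty
  define A where "A = {i. i < n \<and> \<theta> i = 1}"
  have "(\<Sum>i<n. (\<theta> i * a i) *\<^sub>R u (k i)) = (\<Sum>i\<in>A. (\<theta> i * a i) *\<^sub>R u (k i))"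
    using empty.prems(2) by (intro sum.mono_neutral_right) (auto simp: A_def)
  also have "\<dots> = (\<Sum>i\<in>A. a i *\<^sub>R u (k i))" by (auto simp: A_def)
  finally show ?case using suppression[OF k, of A a] by (auto simp: A_def)
next
  case (insert d D)
  let ?s = "\<lambda>\<theta>. \<Sum>i<n. (\<theta> i * a i) *\<^sub>R u (k i)"
  have 1: "N (?s (\<theta>(d := 1))) \<le> K * N (\<Sum>i<n. a i *\<^sub>R u (k i))"
    by (rule insert.IH) (use insert.prems in auto)
  have 0: "N (?s (\<theta>(d := 0))) \<le> K * N (\<Sum>i<n. a i *\<^sub>R u (k i))"
    by (rule insert.IH) (use insert.prems in auto)
  show ?case
  proof (cases "d < n")
    case False
    then have "?s (\<theta>(d := 1)) = ?s \<theta>" by (intro sum.cong) auto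
    then show ?thesis using 1 by simp
  next
    case True
    have t: "0 \<le> \<theta> d" "\<theta> d \<le> 1" using insert.prems(1) True by auto
    have "?s \<theta> = \<theta> d *\<^sub>R ?s (\<theta>(d := 1)) + (1 - \<theta> d) *\<^sub>R ?s (\<theta>(d := 0))"
      unfolding scaleR_sum_right sum.distrib[symmetric]
    proof (rule sum.cong)
      fix i
      have "\<theta> i * a i = \<theta> d * ((\<theta>(d := 1)) i * a i) + (1 - \<theta> d) * ((\<theta>(d := 0)) i * a i)"
        by (cases "i = d") (auto simp: algebra_simps)
      then show "(\<theta> i * a i) *\<^sub>R u (k i) = \<theta> d *\<^sub>R ((\<theta>(d := 1)) i * a i) *\<^sub>R u (k i)
          + (1 - \<theta> d) *\<^sub>R ((\<theta>(d := 0)) i * a i) *\<^sub>R u (k i)"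
        by (simp only: scaleR_scaleR scaleR_add_left)
    qed simp
    also have "N \<dots> \<le> K * N (\<Sum>i<n. a i *\<^sub>R u (k i))"
    proof -
      define v w B where "v = ?s (\<theta>(d := 1))" and "w = ?s (\<theta>(d := 0))"
        and "B = K * N (\<Sum>i<n. a i *\<^sub>R u (k i))"
      have vw: "v \<in> V" "w \<in> V" unfolding v_def w_def by (rule lincomb_in_V, rule u_V)+
      have "N (\<theta> d *\<^sub>R v + (1 - \<theta> d) *\<^sub>R w) \<le> N (\<theta> d *\<^sub>R v) + N ((1 - \<theta> d) *\<^sub>R w)"
        by (intro triangle subspace_scale[OF subspace_V] vw)
      also have "\<dots> = \<theta> d * N v + (1 - \<theta> d) * N w" using t vw by (simp add: N_scale)
      also have "\<dots> \<le> \<theta> d * B + (1 - \<theta> d) * B"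
        using t 0 1 unfolding v_def[symmetric] w_def[symmetric] B_def[symmetric]
        by (intro add_mono mult_left_mono) simp_all
      also have "\<dots> = B" unfolding distrib_right[symmetric] by simp
      finally show ?thesis unfolding v_def w_def B_def .
    qed
    finally show ?thesis .
  qed
qed

lemma unconditional:
  assumes k: "strict_mono_on {..<n} k" "0 < n \<longrightarrow> n \<le> k 0" and \<theta>: "\<And>i. i < n \<Longrightarrow> \<bar>\<theta> i\<bar> \<le> 1"
  shows "N (\<Sum>i<n. (\<theta> i * a i) *\<^sub>R u (k i)) \<le> 2 * K * N (\<Sum>i<n. a i *\<^sub>R u (k i))"
proof -
  define p q where "p = (\<lambda>i. max (\<theta> i) 0)" and "q = (\<lambda>i. max (- \<theta> i) 0)"
  have "\<theta> i = p i - q i" for i by (auto simp: p_def q_def)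
  then have "(\<Sum>i<n. (\<theta> i * a i) *\<^sub>R u (k i)) = (\<Sum>i<n. (p i * a i) *\<^sub>R u (k i)) - (\<Sum>i<n. (q i * a i) *\<^sub>R u (k i))"
    by (simp add: left_diff_distrib scaleR_diff_left sum_subtractf)
  also have "N \<dots> \<le> N (\<Sum>i<n. (p i * a i) *\<^sub>R u (k i)) + N (\<Sum>i<n. (q i * a i) *\<^sub>R u (k i))"
    by (intro triangle_diff lincomb_in_V u_V)
  also have "\<dots> \<le> K * N (\<Sum>i<n. a i *\<^sub>R u (k i)) + K * N (\<Sum>i<n. a i *\<^sub>R u (k i))"
    by (intro add_mono unconditional_nonneg[OF k, where D="{..<n}"])
      (use \<theta> in \<open>auto simp: p_def q_def abs_le_iff\<close>)
  finally show ?thesis by simp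
qed

text \<open>The comparison is made on the vectors \<open>u (n + i)\<close>, which are far enough out
  for \<open>n\<close> terms; going there from \<open>T\<close> and back costs
  \<open>C ^ 2\<close>.\<close>

lemma T_unconditional:
  assumes "\<And>i. i < n \<Longrightarrow> \<bar>a i\<bar> \<le> \<bar>b i\<bar>"
  shows "T (trunc n a) \<le> 2 * K * C ^ 2 * T (trunc n b)"
proof -
  define \<theta> where "\<theta> = (\<lambda>i. if b i = 0 then 0 else a i / b i)"
  have a: "a i = \<theta> i * b i" if "i < n" for i using assms[OF that] by (auto simp: \<theta>_def)
  have t: "\<bar>\<theta> i\<bar> \<le> 1" if "i < n" for i using assms[OF that] by (auto simp: \<theta>_def abs_divide divide_le_eq_1)
  have "T (trunc n a) \<le> C * N (\<Sum>i<n. a i *\<^sub>R u (n + i))"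
    by (rule T_lower) (auto simp: strict_mono_on_def)
  also have "(\<Sum>i<n. a i *\<^sub>R u (n + i)) = (\<Sum>i<n. (\<theta> i * b i) *\<^sub>R u (n + i))"
    by (rule sum.cong) (use a in auto)
  also have "C * N \<dots> \<le> C * (2 * K * N (\<Sum>i<n. b i *\<^sub>R u (n + i)))"
    using C1 t by (intro mult_left_mono unconditional) (auto simp: strict_mono_on_def)
  also have "\<dots> \<le> C * (2 * K * (C * T (trunc n b)))"
    using C1 K1 by (intro mult_left_mono T_upper) (auto simp: strict_mono_on_def)
  finally show ?thesis by (simp add: power2_eq_square ac_simps)
qed

end

section \<open>Blocks coding a set of integers\<close>

text \<open>If \<open>T (\<alpha>\<^sub>k \<otimes> \<beta>\<^sub>k)\<close> is huge for normalized \<open>\<alpha>\<^sub>k, \<beta>\<^sub>k\<close>, then for a set \<open>A\<close> of indices the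
  blocks \<open>y A m\<close>, built from weighted copies of the \<open>\<beta>\<^sub>l\<close> with \<open>l \<in> A\<close>, \<open>l \<le> m\<close>, have a spreading
  model whose norm at \<open>\<alpha>\<^sub>k\<close> is huge exactly for \<open>k \<in> A\<close>.\<close>

locale tensor_blocks = schreier_seq V N u K C T
  for V :: "'v::real_vector set" and N u K C T +
  fixes M L :: "nat \<Rightarrow> nat" and \<alpha> \<beta> :: "nat \<Rightarrow> nat \<Rightarrow> real"
  assumes L_pos: "0 < L l"
    and T_\<alpha>: "T (trunc (M k) (\<alpha> k)) = 1"
    and T_\<beta>: "T (trunc (L k) (\<beta> k)) = 1"
    and big: "real (Suc k) * ((\<Sum>l<k. \<Sum>j<L l. \<bar>\<beta> l j\<bar>) + 2)
       \<le> ((1/2) ^ k / (1 + (\<Sum>l<k. \<Sum>i<M l. \<bar>\<alpha> l i\<bar>))) * T (trunc (M k * L k) (tens (L k) (\<alpha> k) (\<beta> k)))"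
    and wn: "weakly_null V N u"
begin

text \<open>Up to constants, \<open>nb k\<close> dominates what the levels below \<open>k\<close>
  contribute at \<open>\<alpha> k\<close>, the summand 2 being reserved for the levels above
  \<open>k\<close>. By \<open>big\<close>, level \<open>k\<close> alone exceeds it by the factor
  \<open>Suc k\<close> in spite of its weight \<open>w k\<close>.\<close>

definition nb where "nb k = (\<Sum>l<k. \<Sum>j<L l. \<bar>\<beta> l j\<bar>) + 2"
definition na where "na k = (\<Sum>i<M k. \<bar>\<alpha> k i\<bar>)"
text \<open>The factor \<open>(1/2) ^ k\<close> makes the levels summable. The denominator makes
  level \<open>k\<close> negligible at every earlier \<open>\<alpha> l\<close>, whose coefficients
  have absolute sum \<open>na l\<close>.\<close>

definition w where "w k = (1/2) ^ k / (1 + (\<Sum>l<k. na l))"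
definition wA where "wA A l = (if l \<in> A then w l else 0)"
definition off where "off l = (\<Sum>l'<l. L l')"
text \<open>\<open>y A m\<close> occupies a stretch of length \<open>off (Suc m)\<close> starting at
  \<open>base m\<close>. The sum includes \<open>i = m\<close>, so a block starts no earlier than
  its own length and each of its levels has Schreier support.\<close>

definition base where "base m = (\<Sum>i\<le>m. off (Suc i))"
definition blk where "blk m l = (\<Sum>j<L l. \<beta> l j *\<^sub>R u (base m + off l + j))"
definition y where "y A m = (\<Sum>l\<le>m. wA A l *\<^sub>R blk m l)"
definition cf where "cf A m r = (\<Sum>l\<le>m. wA A l *
   (if base m + off l \<le> r \<and> r < base m + off l + L l then \<beta> l (r - (base m + off l)) else 0))"

lemma off_Suc: "off (Suc l) = off l + L l" by (simp add: off_def)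

lemma off_mono: "l \<le> l' \<Longrightarrow> off l \<le> off l'"
  unfolding off_def by (intro sum_mono2) auto

lemma off_le_base: "off (Suc m) \<le> base m"
  unfolding base_def by (rule member_le_sum) auto

lemma block_end: "m < m' \<Longrightarrow> base m + off (Suc m) \<le> base m'"
proof (induction m')
  case (Suc m')
  have "base (Suc m') = base m' + off (Suc (Suc m'))" by (simp add: base_def)
  moreover have "off (Suc m') \<le> off (Suc (Suc m'))" by (rule off_mono) simp
  ultimately show ?case using Suc by (cases "m = m'") auto
qed simp

lemma base_mono: "m \<le> m' \<Longrightarrow> base m \<le> base m'"
  using block_end[of m m'] by (cases "m = m'") auto

lemma le_off: "l \<le> off l"
proof (induction l)
  case (Suc l) then show ?case using L_pos[of l] by (simp add: off_Suc)
qed simp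

lemma le_base: "m \<le> base m"
  using le_off[of "Suc m"] off_le_base[of m] by simp

lemma L_le_base: "l \<le> m \<Longrightarrow> L l \<le> base m"
  using off_mono[of "Suc l" "Suc m"] off_le_base[of m] by (simp add: off_Suc)

lemma na_nonneg: "0 \<le> na k" by (simp add: na_def sum_nonneg)

lemma w_pos: "0 < w k"
  unfolding w_def using sum_nonneg[of "{..<k}" na] na_nonneg by (simp add: add_pos_nonneg)

lemma w_le: "w k \<le> (1/2) ^ k"
  unfolding w_def using sum_nonneg[of "{..<k}" na] na_nonneg by (simp add: divide_le_eq)

lemma w_0: "w 0 = 1" by (simp add: w_def)

lemma w_le_na: "k < l \<Longrightarrow> w l \<le> (1/2) ^ l / (1 + na k)"
  unfolding w_def
  using member_le_sum[of k "{..<l}" na] na_nonneg by (intro divide_left_mono) (auto simp: add_pos_nonneg sum_nonneg)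

lemma wA_bounds: "0 \<le> wA A l" "wA A l \<le> w l"
  using w_pos[of l] by (auto simp: wA_def)

lemma blk_V: "blk m l \<in> V" unfolding blk_def by (intro lincomb_in_V u_V)
lemma y_V: "y A m \<in> V" unfolding y_def by (intro lincomb_in_V blk_V)

lemma sum_shifted_interval:
  fixes v :: "nat \<Rightarrow> 'v" and s d R :: nat
  assumes "s + d \<le> R"
  shows "(\<Sum>r<R. (if s \<le> r \<and> r < s + d then g (r - s) else 0) *\<^sub>R v r) = (\<Sum>j<d. g j *\<^sub>R v (s + j))"
proof -
  have "(\<Sum>r<R. (if s \<le> r \<and> r < s + d then g (r - s) else 0) *\<^sub>R v r) = (\<Sum>r\<in>{s..<s + d}. g (r - s) *\<^sub>R v r)"
    using assms by (intro sum.mono_neutral_cong_right) auto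
  also have "\<dots> = (\<Sum>j<d. g j *\<^sub>R v (s + j))"
    by (rule sum.reindex_bij_witness[of _ "\<lambda>j. s + j" "\<lambda>r. r - s"]) auto
  finally show ?thesis .
qed

lemma y_expand:
  assumes "base m + off (Suc m) \<le> R"
  shows "(\<Sum>r<R. cf A m r *\<^sub>R u r) = y A m"
proof -
  let ?i = "\<lambda>l r. if base m + off l \<le> r \<and> r < base m + off l + L l then \<beta> l (r - (base m + off l)) else 0"
  have "(\<Sum>r<R. cf A m r *\<^sub>R u r) = (\<Sum>l\<le>m. \<Sum>r<R. (wA A l * ?i l r) *\<^sub>R u r)"
    unfolding cf_def scaleR_sum_left by (rule sum.swap)
  also have "\<dots> = (\<Sum>l\<le>m. wA A l *\<^sub>R (\<Sum>r<R. ?i l r *\<^sub>R u r))"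
    by (simp only: scaleR_sum_right scaleR_scaleR)
  also have "\<dots> = y A m"
    unfolding y_def
  proof (rule sum.cong)
    fix l assume "l \<in> {..m}"
    then have "off (Suc l) \<le> off (Suc m)" by (intro off_mono) simp
    then have "base m + off l + L l \<le> R" using assms by (simp add: off_Suc)
    from sum_shifted_interval[OF this, of "\<beta> l" u]
    show "wA A l *\<^sub>R (\<Sum>r<R. ?i l r *\<^sub>R u r) = wA A l *\<^sub>R blk m l" by (simp only: blk_def)
  qed simp
  finally show ?thesis .
qed

lemma cf_zero:
  assumes "r < base m \<or> base m + off (Suc m) \<le> r"
  shows "cf A m r = 0"
  unfolding cf_def
proof (rule sum.neutral, rule ballI)
  fix l assume "l \<in> {..m}"
  then have "off l + L l \<le> off (Suc m)" using off_mono[of "Suc l" "Suc m"] by (simp add: off_Suc)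
  then have neg: "\<not> (base m + off l \<le> r \<and> r < base m + off l + L l)" using assms by linarith
  show "wA A l * (if base m + off l \<le> r \<and> r < base m + off l + L l then \<beta> l (r - (base m + off l)) else 0) = 0"
    unfolding if_not_P[OF neg] by simp
qed

lemma cf_val:
  assumes "k \<le> m" "j < L k"
  shows "cf A m (base m + off k + j) = wA A k * \<beta> k j"
proof -
  let ?r = "base m + off k + j"
  let ?t = "\<lambda>l. wA A l *
    (if base m + off l \<le> ?r \<and> ?r < base m + off l + L l then \<beta> l (?r - (base m + off l)) else 0)"
  have "cf A m ?r = (\<Sum>l\<in>{k}. ?t l)"
    unfolding cf_def
  proof (rule sum.mono_neutral_right)
    show "\<forall>l\<in>{..m} - {k}. ?t l = 0"
    proof
      fix l assume "l \<in> {..m} - {k}"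
      then consider "l < k" | "k < l" by fastforce
      then have neg: "\<not> (base m + off l \<le> ?r \<and> ?r < base m + off l + L l)"
      proof cases
        case 1
        then have "off l + L l \<le> off k" using off_mono[of "Suc l" k] by (simp add: off_Suc)
        then show ?thesis by simp
      next
        case 2
        then have "off k + L k \<le> off l" using off_mono[of "Suc k" l] by (simp add: off_Suc)
        then show ?thesis using assms(2) by simp
      qed
      show "?t l = 0" unfolding if_not_P[OF neg] by simp
    qed
  qed (use assms in auto)
  then show ?thesis using assms(2) by simp
qed

lemma y_comb:
  assumes "\<And>i. i \<in> I \<Longrightarrow> base (\<kappa> i) + off (Suc (\<kappa> i)) \<le> R"
  shows "(\<Sum>i\<in>I. c i *\<^sub>R y A (\<kappa> i)) = (\<Sum>r<R. (\<Sum>i\<in>I. c i * cf A (\<kappa> i) r) *\<^sub>R u r)"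
proof -
  have "(\<Sum>i\<in>I. c i *\<^sub>R y A (\<kappa> i)) = (\<Sum>i\<in>I. \<Sum>r<R. (c i * cf A (\<kappa> i) r) *\<^sub>R u r)"
    by (rule sum.cong) (simp_all add: y_expand[OF assms, symmetric] scaleR_sum_right)
  also have "\<dots> = (\<Sum>r<R. (\<Sum>i\<in>I. c i * cf A (\<kappa> i) r) *\<^sub>R u r)"
    unfolding scaleR_sum_left by (rule sum.swap)
  finally show ?thesis .
qed

text \<open>The blocks are successive, so partial sums of \<open>y A\<close> are partial sums of
  \<open>u\<close>.\<close>

lemma y_basis: "basis_const (y A) K"
  unfolding basis_const_def
proof (intro conjI allI impI)
  show "y A i \<in> V" for i by (rule y_V)
  fix c :: "nat \<Rightarrow> real" and t n :: nat assume tn: "t \<le> n"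
  have n: "(\<Sum>i<n. c i *\<^sub>R y A i) = (\<Sum>r<base n. (\<Sum>i<n. c i * cf A i r) *\<^sub>R u r)"
    using y_comb[of "{..<n}" "\<lambda>i. i" "base n" c A] block_end by simp
  have "(\<Sum>i<t. c i *\<^sub>R y A i) = (\<Sum>r<base t. (\<Sum>i<t. c i * cf A i r) *\<^sub>R u r)"
    using y_comb[of "{..<t}" "\<lambda>i. i" "base t" c A] block_end by simp
  also have "\<dots> = (\<Sum>r<base t. (\<Sum>i<n. c i * cf A i r) *\<^sub>R u r)"
  proof (rule sum.cong)
    fix r assume r: "r \<in> {..<base t}"
    have "(\<Sum>i<t. c i * cf A i r) = (\<Sum>i<n. c i * cf A i r)"
    proof (rule sum.mono_neutral_left)
      show "\<forall>i\<in>{..<n} - {..<t}. c i * cf A i r = 0"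
      proof
        fix i assume "i \<in> {..<n} - {..<t}"
        then have "r < base i" using r base_mono[of t i] by auto
        then show "c i * cf A i r = 0" by (simp add: cf_zero)
      qed
    qed (use tn in auto)
    then show "(\<Sum>i<t. c i * cf A i r) *\<^sub>R u r = (\<Sum>i<n. c i * cf A i r) *\<^sub>R u r" by simp
  qed simp
  finally show "N (\<Sum>i<t. c i *\<^sub>R y A i) \<le> K * N (\<Sum>i<n. c i *\<^sub>R y A i)"
    using basis_constD(2)[OF u_basis base_mono[OF tn], of "\<lambda>r. \<Sum>i<n. c i * cf A i r"] n by simp
qed

lemma blk_upper: "l \<le> m \<Longrightarrow> N (blk m l) \<le> C"
proof -
  assume "l \<le> m"
  then have "N (\<Sum>j<L l. \<beta> l j *\<^sub>R u ((\<lambda>j. base m + off l + j) j)) \<le> C * T (trunc (L l) (\<beta> l))"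
    using L_le_base[of l m] by (intro T_upper) (auto simp: strict_mono_on_def)
  then show ?thesis by (simp add: blk_def T_\<beta>)
qed

lemma blk_lower: "l \<le> m \<Longrightarrow> 1 \<le> C * N (blk m l)"
proof -
  assume "l \<le> m"
  then have "T (trunc (L l) (\<beta> l)) \<le> C * N (\<Sum>j<L l. \<beta> l j *\<^sub>R u ((\<lambda>j. base m + off l + j) j))"
    using L_le_base[of l m] by (intro T_lower) (auto simp: strict_mono_on_def)
  then show ?thesis by (simp add: blk_def T_\<beta>)
qed

lemma y_upper: "N (y A m) \<le> 2 * C"
proof -
  have "N (y A m) \<le> (\<Sum>l\<le>m. \<bar>wA A l\<bar> * N (blk m l))" unfolding y_def by (intro N_lincomb_le blk_V)
  also have "\<dots> \<le> (\<Sum>l\<le>m. (1/2) ^ l * C)"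
  proof (intro sum_mono mult_mono)
    fix l assume "l \<in> {..m}"
    show "\<bar>wA A l\<bar> \<le> (1/2) ^ l" using wA_bounds[of A l] w_le[of l] by simp
    show "N (blk m l) \<le> C" using \<open>l \<in> {..m}\<close> blk_upper by simp
  qed (auto simp: N_nonneg blk_V)
  also have "\<dots> = (\<Sum>l\<le>m. (1/2) ^ l) * C" by (simp add: sum_distrib_right)
  also have "\<dots> \<le> 2 * (1/2) ^ 0 * C"
    using C1 by (intro mult_right_mono sum_half_powers_le) auto
  finally show ?thesis by simp
qed

text \<open>For \<open>k \<in> A\<close> the copies of \<open>\<beta> k\<close> in the
  \<open>n\<close> blocks fill \<open>n * L k\<close> positions, a Schreier set once the blocks lie
  far enough out; projecting onto it removes every other level.\<close>

lemma proj_lower: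
  assumes \<kappa>: "strict_mono_on {..<n} \<kappa>" and k: "\<And>i. i < n \<Longrightarrow> k \<le> \<kappa> i" "\<And>i. i < n \<Longrightarrow> n * L k \<le> base (\<kappa> i)"
    and A: "k \<in> A"
  shows "w k * N (\<Sum>i<n. c i *\<^sub>R blk (\<kappa> i) k) \<le> K * N (\<Sum>i<n. c i *\<^sub>R y A (\<kappa> i))"
proof -
  define R where "R = Max (insert 0 ((\<lambda>i. base (\<kappa> i) + off (Suc (\<kappa> i))) ` {..<n}))"
  have R: "base (\<kappa> i) + off (Suc (\<kappa> i)) \<le> R" if "i < n" for i
    unfolding R_def using that by (intro Max_ge) auto
  define g where "g = (\<lambda>r. \<Sum>i<n. c i * cf A (\<kappa> i) r)"
  have yc: "(\<Sum>i<n. c i *\<^sub>R y A (\<kappa> i)) = (\<Sum>r<R. g r *\<^sub>R u r)"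
    unfolding g_def by (rule y_comb) (use R in auto)
  define I where "I = (\<lambda>i. (\<lambda>j. base (\<kappa> i) + off k + j) ` {..<L k})"
  have Isub: "off k + L k \<le> off (Suc (\<kappa> i))" if "i < n" for i
    using off_mono[of "Suc k" "Suc (\<kappa> i)"] k(1)[OF that] by (simp add: off_Suc)
  have sep: "base (\<kappa> i) + off (Suc (\<kappa> i)) \<le> base (\<kappa> i')" if "i < i'" "i' < n" for i i'
    using that \<kappa> by (intro block_end) (auto simp: strict_mono_on_def)
  have gval: "g (base (\<kappa> i) + off k + j) = c i * (w k * \<beta> k j)" if i: "i < n" and j: "j < L k" for i j
  proof -
    let ?r = "base (\<kappa> i) + off k + j"
    have "g ?r = (\<Sum>i'\<in>{i}. c i' * cf A (\<kappa> i') ?r)"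
      unfolding g_def
    proof (rule sum.mono_neutral_right)
      show "\<forall>i'\<in>{..<n} - {i}. c i' * cf A (\<kappa> i') ?r = 0"
      proof
        fix i' assume i': "i' \<in> {..<n} - {i}"
        then consider "i' < i" | "i < i'" by fastforce
        then have "?r < base (\<kappa> i') \<or> base (\<kappa> i') + off (Suc (\<kappa> i')) \<le> ?r"
        proof cases
          case 1 then show ?thesis using sep[of i' i] i by simp
        next
          case 2 then show ?thesis using sep[of i i'] i' Isub[OF i] j by simp
        qed
        then show "c i' * cf A (\<kappa> i') ?r = 0" by (simp add: cf_zero)
      qed
    qed (use i in auto)
    then show ?thesis using cf_val[OF k(1)[OF i] j, of A] A by (simp add: wA_def)
  qed
  have disj: "I i \<inter> I i' = {}" if ii: "i < n" "i' < n" "i \<noteq> i'" for i i'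
  proof -
    have "I i \<inter> I i' = {}" if "i < i'" "i' < n" for i i'
      using sep[OF that] Isub[of i] that by (fastforce simp: I_def)
    then show ?thesis using ii by (metis inf_commute linorder_neqE_nat)
  qed
  have inj: "inj_on (\<lambda>j. base (\<kappa> i) + off k + j) {..<L k}" for i by (auto simp: inj_on_def)
  define F where "F = (\<Union>i\<in>{..<n}. I i)"
  have "(\<Sum>r\<in>F. g r *\<^sub>R u r) = (\<Sum>i<n. \<Sum>r\<in>I i. g r *\<^sub>R u r)"
    unfolding F_def by (rule sum.UNION_disjoint) (auto simp: I_def disj[unfolded I_def])
  also have "\<dots> = (\<Sum>i<n. \<Sum>j<L k. (c i * (w k * \<beta> k j)) *\<^sub>R u (base (\<kappa> i) + off k + j))"
  proof (rule sum.cong[OF refl])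
    fix i assume "i \<in> {..<n}"
    then show "(\<Sum>r\<in>I i. g r *\<^sub>R u r) = (\<Sum>j<L k. (c i * (w k * \<beta> k j)) *\<^sub>R u (base (\<kappa> i) + off k + j))"
      unfolding I_def sum.reindex[OF inj] by (simp add: gval)
  qed
  also have "\<dots> = w k *\<^sub>R (\<Sum>i<n. c i *\<^sub>R blk (\<kappa> i) k)"
    by (simp add: blk_def scaleR_sum_right ac_simps)
  finally have F: "(\<Sum>r\<in>F. g r *\<^sub>R u r) = w k *\<^sub>R (\<Sum>i<n. c i *\<^sub>R blk (\<kappa> i) k)" .
  have "N (\<Sum>r\<in>F. g r *\<^sub>R u r) \<le> K * N (\<Sum>r<R. g r *\<^sub>R u r)"
  proof (rule proj_schreier)
    show "F \<subseteq> {..<R}" using R Isub by (fastforce simp: F_def I_def)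
    fix r assume "r \<in> F"
    then obtain i where i: "i < n" "base (\<kappa> i) \<le> r" by (auto simp: F_def I_def)
    have "card F \<le> (\<Sum>i<n. card (I i))" unfolding F_def by (rule card_UN_le) simp
    also have "\<dots> = n * L k" unfolding I_def by (simp add: card_image[OF inj])
    finally show "card F \<le> r" using k(2)[OF i(1)] i(2) by simp
  qed
  then show ?thesis
    unfolding F yc using w_pos[of k] by (simp add: N_scale lincomb_in_V blk_V)
qed

text \<open>Reading the copies of \<open>\<beta> k\<close> from left to right runs through the pairs
  (block, position) lexicographically, which is the order of \<open>tens\<close>; quotient and
  remainder by \<open>L k\<close> recover the pair.\<close>

lemma tens_lower:
  assumes \<kappa>: "strict_mono_on {..<n} \<kappa>" and k: "\<And>i. i < n \<Longrightarrow> k \<le> \<kappa> i" "\<And>i. i < n \<Longrightarrow> n * L k \<le> base (\<kappa> i)"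
  shows "T (trunc (n * L k) (tens (L k) c (\<beta> k))) \<le> C * N (\<Sum>i<n. c i *\<^sub>R blk (\<kappa> i) k)"
proof -
  define d where "d = L k"
  have d: "0 < d" using L_pos by (simp add: d_def)
  define k' where "k' = (\<lambda>q. base (\<kappa> (q div d)) + off k + q mod d)"
  have Isub: "off k + d \<le> off (Suc (\<kappa> i))" if "i < n" for i
    using off_mono[of "Suc k" "Suc (\<kappa> i)"] k(1)[OF that] by (simp add: off_Suc d_def)
  have "T (trunc (n * d) (tens d c (\<beta> k))) \<le> C * N (\<Sum>q<n * d. tens d c (\<beta> k) q *\<^sub>R u (k' q))"
  proof (rule T_lower)
    show "strict_mono_on {..<n * d} k'"
    proof (rule strict_mono_onI)
      fix q q' assume q: "q \<in> {..<n * d}" "q' \<in> {..<n * d}" "q < q'"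
      have n: "q div d < n" "q' div d < n" using q d by (auto simp: div_less_iff_less_mult)
      have "q div d \<le> q' div d" using q(3) by (simp add: div_le_mono)
      then consider "q div d = q' div d" | "q div d < q' div d" by linarith
      then show "k' q < k' q'"
      proof cases
        case 1
        then have "q mod d < q' mod d" using q(3) by (metis div_mult_mod_eq nat_add_left_cancel_less)
        then show ?thesis using 1 by (simp add: k'_def)
      next
        case 2
        then have "base (\<kappa> (q div d)) + off (Suc (\<kappa> (q div d))) \<le> base (\<kappa> (q' div d))"
          using n \<kappa> by (intro block_end) (auto simp: strict_mono_on_def)
        moreover have "q mod d < d" using d by simp
        ultimately show ?thesis using Isub[OF n(1)] by (simp add: k'_def)
      qed
    qed
    show "0 < n * d \<longrightarrow> n * d \<le> k' 0" using k(2)[of 0] by (auto simp: k'_def d_def)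
  qed
  also have "(\<Sum>q<n * d. tens d c (\<beta> k) q *\<^sub>R u (k' q)) = (\<Sum>i<n. \<Sum>j<d. (c i * \<beta> k j) *\<^sub>R u (base (\<kappa> i) + off k + j))"
    unfolding sum_lessThan_mult using d by (intro sum.cong refl) (simp add: tens_def k'_def)
  also have "\<dots> = (\<Sum>i<n. c i *\<^sub>R blk (\<kappa> i) k)" by (simp add: blk_def scaleR_sum_right d_def)
  finally show ?thesis by (simp add: d_def)
qed

text \<open>Level 0 has weight 1 and is isolated by \<open>proj_lower\<close>; this is why 0 is put
  into every index set.\<close>

lemma y_lower:
  assumes "0 \<in> A"
  shows "1 / (K * C) \<le> N (y A m)"
proof -
  have "strict_mono_on {..<1::nat} (\<lambda>_. m)" by (auto simp: strict_mono_on_def)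
  then have "N (blk m 0) \<le> K * N (y A m)"
    using proj_lower[of 1 "\<lambda>_. m" 0 A "\<lambda>_. 1"] assms L_le_base[of 0 m]
    by (simp add: w_0)
  then have "C * N (blk m 0) \<le> C * (K * N (y A m))" using C1 by (intro mult_left_mono) auto
  then have "1 \<le> C * (K * N (y A m))" using blk_lower[of 0 m] by simp
  then show ?thesis using C1 K1 by (simp add: field_simps)
qed

text \<open>Exchanging the sums leaves, for each position \<open>j\<close> within the level, a
  combination of one vector of \<open>u\<close> per block, to which \<open>T_upper\<close> applies.
  So \<open>\<beta> l\<close> enters only through its absolute sum.\<close>

lemma blk_comb_upper:
  assumes \<kappa>: "strict_mono_on {..<n} \<kappa>" and n: "0 < n \<longrightarrow> n \<le> base (\<kappa> 0)"
  shows "N (\<Sum>i<n. c i *\<^sub>R blk (\<kappa> i) l) \<le> (\<Sum>j<L l. \<bar>\<beta> l j\<bar>) * (C * T (trunc n c))"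
proof -
  have "(\<Sum>i<n. c i *\<^sub>R blk (\<kappa> i) l) = (\<Sum>i<n. \<Sum>j<L l. (c i * \<beta> l j) *\<^sub>R u (base (\<kappa> i) + off l + j))"
    by (simp add: blk_def scaleR_sum_right)
  also have "\<dots> = (\<Sum>j<L l. \<Sum>i<n. (c i * \<beta> l j) *\<^sub>R u (base (\<kappa> i) + off l + j))" by (rule sum.swap)
  also have "\<dots> = (\<Sum>j<L l. \<beta> l j *\<^sub>R (\<Sum>i<n. c i *\<^sub>R u (base (\<kappa> i) + off l + j)))"
    by (simp add: scaleR_sum_right mult.commute)
  finally have eq: "(\<Sum>i<n. c i *\<^sub>R blk (\<kappa> i) l) = (\<Sum>j<L l. \<beta> l j *\<^sub>R (\<Sum>i<n. c i *\<^sub>R u (base (\<kappa> i) + off l + j)))" .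
  have "N (\<Sum>i<n. c i *\<^sub>R blk (\<kappa> i) l) \<le> (\<Sum>j<L l. \<bar>\<beta> l j\<bar> * N (\<Sum>i<n. c i *\<^sub>R u (base (\<kappa> i) + off l + j)))"
    unfolding eq by (intro N_lincomb_le lincomb_in_V u_V)
  also have "\<dots> \<le> (\<Sum>j<L l. \<bar>\<beta> l j\<bar> * (C * T (trunc n c)))"
  proof (rule sum_mono, rule mult_left_mono)
    fix j
    have "base (\<kappa> i) < base (\<kappa> i')" if "i < i'" "i' < n" for i i'
    proof -
      have "base (\<kappa> i) + off (Suc (\<kappa> i)) \<le> base (\<kappa> i')"
        using strict_mono_onD[OF \<kappa>, of i i'] that by (intro block_end) simp
      then show ?thesis using le_off[of "Suc (\<kappa> i)"] by simp
    qed
    then show "N (\<Sum>i<n. c i *\<^sub>R u (base (\<kappa> i) + off l + j)) \<le> C * T (trunc n c)"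
      using n by (intro T_upper[of n "\<lambda>i. base (\<kappa> i) + off l + j"]) (auto simp: strict_mono_on_def)
  qed simp
  finally show ?thesis by (simp add: sum_distrib_right)
qed

text \<open>Level \<open>k\<close> is absent. The levels below it are covered by
  \<open>blk_comb_upper\<close>; those above it are estimated by the triangle inequality and are
  small by the choice of \<open>w\<close>.\<close>

lemma y_comb_upper:
  assumes \<kappa>: "strict_mono_on {..<n} \<kappa>" and n: "0 < n \<longrightarrow> n \<le> base (\<kappa> 0)"
    and k: "\<And>i. i < n \<Longrightarrow> k \<le> \<kappa> i" and A: "k \<notin> A"
  shows "N (\<Sum>i<n. c i *\<^sub>R y A (\<kappa> i))
     \<le> (\<Sum>l<k. \<Sum>j<L l. \<bar>\<beta> l j\<bar>) * (C * T (trunc n c)) + (\<Sum>i<n. \<bar>c i\<bar>) * (2 * C / (1 + na k))"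
proof -
  have spl: "y A (\<kappa> i) = (\<Sum>l<k. wA A l *\<^sub>R blk (\<kappa> i) l) + (\<Sum>l\<in>{k<..\<kappa> i}. wA A l *\<^sub>R blk (\<kappa> i) l)"
    if "i < n" for i
  proof -
    have "{..\<kappa> i} = {..<k} \<union> insert k {k<..\<kappa> i}" using k[OF that] by auto
    then have "y A (\<kappa> i) = (\<Sum>l<k. wA A l *\<^sub>R blk (\<kappa> i) l) + (\<Sum>l\<in>insert k {k<..\<kappa> i}. wA A l *\<^sub>R blk (\<kappa> i) l)"
      unfolding y_def by (simp only:) (rule sum.union_disjoint, auto)
    then show ?thesis using A by (simp add: wA_def)
  qed
  let ?t = "\<lambda>i. \<Sum>l\<in>{k<..\<kappa> i}. wA A l *\<^sub>R blk (\<kappa> i) l"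
  have tV: "?t i \<in> V" for i by (intro lincomb_in_V blk_V)
  have "(\<Sum>i<n. c i *\<^sub>R y A (\<kappa> i)) = (\<Sum>i<n. c i *\<^sub>R ((\<Sum>l<k. wA A l *\<^sub>R blk (\<kappa> i) l) + ?t i))"
    by (rule sum.cong) (simp_all add: spl)
  also have "\<dots> = (\<Sum>i<n. \<Sum>l<k. (c i * wA A l) *\<^sub>R blk (\<kappa> i) l) + (\<Sum>i<n. c i *\<^sub>R ?t i)"
    unfolding scaleR_add_right sum.distrib scaleR_sum_right[of _ _ "{..<k}"] scaleR_scaleR ..
  also have "(\<Sum>i<n. \<Sum>l<k. (c i * wA A l) *\<^sub>R blk (\<kappa> i) l) = (\<Sum>l<k. \<Sum>i<n. (c i * wA A l) *\<^sub>R blk (\<kappa> i) l)"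
    by (rule sum.swap)
  also have "\<dots> = (\<Sum>l<k. wA A l *\<^sub>R (\<Sum>i<n. c i *\<^sub>R blk (\<kappa> i) l))"
    by (simp add: scaleR_sum_right mult.commute)
  finally have "N (\<Sum>i<n. c i *\<^sub>R y A (\<kappa> i))
      \<le> N (\<Sum>l<k. wA A l *\<^sub>R (\<Sum>i<n. c i *\<^sub>R blk (\<kappa> i) l)) + N (\<Sum>i<n. c i *\<^sub>R ?t i)"
    using triangle[OF lincomb_in_V[OF lincomb_in_V[OF blk_V]] lincomb_in_V[OF tV]] by simp
  also have "\<dots> \<le> (\<Sum>l<k. \<Sum>j<L l. \<bar>\<beta> l j\<bar>) * (C * T (trunc n c)) + (\<Sum>i<n. \<bar>c i\<bar>) * (2 * C / (1 + na k))"
  proof (rule add_mono)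
    have "N (\<Sum>l<k. wA A l *\<^sub>R (\<Sum>i<n. c i *\<^sub>R blk (\<kappa> i) l)) \<le> (\<Sum>l<k. \<bar>wA A l\<bar> * N (\<Sum>i<n. c i *\<^sub>R blk (\<kappa> i) l))"
      by (intro N_lincomb_le lincomb_in_V blk_V)
    also have "\<dots> \<le> (\<Sum>l<k. 1 * ((\<Sum>j<L l. \<bar>\<beta> l j\<bar>) * (C * T (trunc n c))))"
    proof (intro sum_mono mult_mono blk_comb_upper[OF \<kappa> n])
      show "\<bar>wA A l\<bar> \<le> 1" for l
        using wA_bounds[of A l] w_le[of l] power_le_one[of "1/2::real" l] by simp
    qed (auto intro!: N_nonneg lincomb_in_V blk_V)
    finally show "N (\<Sum>l<k. wA A l *\<^sub>R (\<Sum>i<n. c i *\<^sub>R blk (\<kappa> i) l)) \<le> (\<Sum>l<k. \<Sum>j<L l. \<bar>\<beta> l j\<bar>) * (C * T (trunc n c))"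
      by (simp add: sum_distrib_right)
    have tb: "N (?t i) \<le> 2 * C / (1 + na k)" if "i < n" for i
    proof -
      have "N (?t i) \<le> (\<Sum>l\<in>{k<..\<kappa> i}. \<bar>wA A l\<bar> * N (blk (\<kappa> i) l))" by (intro N_lincomb_le blk_V)
      also have "\<dots> \<le> (\<Sum>l\<in>{k<..\<kappa> i}. ((1/2) ^ l / (1 + na k)) * C)"
      proof (intro sum_mono mult_mono)
        fix l assume l: "l \<in> {k<..\<kappa> i}"
        show "\<bar>wA A l\<bar> \<le> (1/2) ^ l / (1 + na k)" using wA_bounds[of A l] w_le_na[of k l] l by simp
        show "N (blk (\<kappa> i) l) \<le> C" using l blk_upper by simp
      qed (use na_nonneg[of k] in \<open>auto simp: N_nonneg blk_V\<close>)
      also have "\<dots> = (\<Sum>l\<in>{k<..\<kappa> i}. (1/2) ^ l) * (C / (1 + na k))"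
        by (simp add: sum_distrib_right sum_divide_distrib)
      also have "\<dots> \<le> (2 * (1/2) ^ 0) * (C / (1 + na k))"
        using C1 na_nonneg[of k] by (intro mult_right_mono sum_half_powers_le) auto
      finally show ?thesis by simp
    qed
    have "N (\<Sum>i<n. c i *\<^sub>R ?t i) \<le> (\<Sum>i<n. \<bar>c i\<bar> * N (?t i))" by (rule N_lincomb_le[OF tV])
    also have "\<dots> \<le> (\<Sum>i<n. \<bar>c i\<bar> * (2 * C / (1 + na k)))" using tb by (intro sum_mono mult_left_mono) auto
    finally show "N (\<Sum>i<n. c i *\<^sub>R ?t i) \<le> (\<Sum>i<n. \<bar>c i\<bar>) * (2 * C / (1 + na k))" by (simp only: sum_distrib_right)
  qed
  finally show ?thesis .
qed

text \<open>Any fixed number of levels tends to 0, because \<open>u\<close> is weakly null and the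
  positions tend to infinity; the remaining levels are uniformly small by their geometric
  weights.\<close>

lemma y_weakly_null_functional:
  assumes \<Phi>: "bdd_lin_functional V N \<Phi>"
  shows "(\<lambda>m. \<Phi> (y A m)) \<longlonglongrightarrow> 0"
proof -
  have "\<exists>B0. \<forall>v\<in>V. \<bar>\<Phi> v\<bar> \<le> B0 * N v" using \<Phi> by (simp add: bdd_lin_functional_def)
  then obtain B0 where B0: "\<And>v. v \<in> V \<Longrightarrow> \<bar>\<Phi> v\<bar> \<le> B0 * N v" by blast
  define B where "B = \<bar>B0\<bar> * C"
  have blkB: "\<bar>\<Phi> (blk m l)\<bar> \<le> B" if "l \<le> m" for m l
  proof -
    have "\<bar>\<Phi> (blk m l)\<bar> \<le> B0 * N (blk m l)" by (rule B0[OF blk_V])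
    also have "\<dots> \<le> \<bar>B0\<bar> * C" using blk_upper[OF that] N_nonneg[OF blk_V] by (intro mult_mono) auto
    finally show ?thesis by (simp add: B_def)
  qed
  have base_lim: "filterlim (\<lambda>m. base m + s) at_top sequentially" for s
    by (rule filterlim_at_top_mono[OF filterlim_ident]) (auto intro!: always_eventually trans_le_add1 le_base)
  have blk0: "(\<lambda>m. \<Phi> (blk m l)) \<longlonglongrightarrow> 0" for l
  proof -
    have "(\<lambda>m. \<Phi> (u (base m + (off l + j)))) \<longlonglongrightarrow> 0" for j
      using filterlim_compose[OF _ base_lim] wn \<Phi> unfolding weakly_null_def by blast
    then have "(\<lambda>m. \<Sum>j<L l. \<beta> l j * \<Phi> (u (base m + (off l + j)))) \<longlonglongrightarrow> (\<Sum>j<L l. \<beta> l j * 0)"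
      by (intro tendsto_sum tendsto_mult_left)
    moreover have "\<Phi> (blk m l) = (\<Sum>j<L l. \<beta> l j * \<Phi> (u (base m + (off l + j))))" for m
      unfolding blk_def using bdd_lin_functional_sum[OF \<Phi> subspace_V, of "{..<L l}" "\<lambda>j. u (base m + off l + j)"] u_V
      by (simp add: add.assoc)
    ultimately show ?thesis by simp
  qed
  have bound: "\<bar>\<Phi> (y A m)\<bar> \<le> (\<Sum>l<k. \<bar>\<Phi> (blk m l)\<bar>) + B * (2 * (1/2) ^ k)" if km: "k \<le> m" for k m
  proof -
    have "\<Phi> (y A m) = (\<Sum>l\<le>m. wA A l * \<Phi> (blk m l))"
      unfolding y_def by (rule bdd_lin_functional_sum[OF \<Phi> subspace_V blk_V]) simp
    also have "\<bar>\<dots>\<bar> \<le> (\<Sum>l\<le>m. \<bar>wA A l * \<Phi> (blk m l)\<bar>)" by (rule sum_abs)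
    also have "\<dots> = (\<Sum>l<k. \<bar>wA A l * \<Phi> (blk m l)\<bar>) + (\<Sum>l\<in>{k..m}. \<bar>wA A l * \<Phi> (blk m l)\<bar>)"
    proof -
      have "{..m} = {..<k} \<union> {k..m}" using km by auto
      then show ?thesis by (simp only:) (rule sum.union_disjoint, auto)
    qed
    also have "\<dots> \<le> (\<Sum>l<k. 1 * \<bar>\<Phi> (blk m l)\<bar>) + (\<Sum>l\<in>{k..m}. (1/2) ^ l * B)"
    proof (rule add_mono)
      have wb: "\<bar>wA A l\<bar> \<le> (1/2) ^ l" "\<bar>wA A l\<bar> \<le> 1" for l
        using wA_bounds[of A l] w_le[of l] power_le_one[of "1/2::real" l] by simp_all
      show "(\<Sum>l<k. \<bar>wA A l * \<Phi> (blk m l)\<bar>) \<le> (\<Sum>l<k. 1 * \<bar>\<Phi> (blk m l)\<bar>)"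
        unfolding abs_mult by (rule sum_mono, rule mult_right_mono[OF wb(2)]) simp
      show "(\<Sum>l\<in>{k..m}. \<bar>wA A l * \<Phi> (blk m l)\<bar>) \<le> (\<Sum>l\<in>{k..m}. (1/2) ^ l * B)"
        unfolding abs_mult by (rule sum_mono, rule mult_mono[OF wb(1)]) (use blkB in auto)
    qed
    also have "(\<Sum>l\<in>{k..m}. (1/2) ^ l * B) = B * (\<Sum>l\<in>{k..m}. (1/2) ^ l)" by (simp add: sum_distrib_left mult.commute)
    also have "\<dots> \<le> B * (2 * (1/2) ^ k)"
      using C1 by (intro mult_left_mono sum_half_powers_le) (auto simp: B_def)
    finally show ?thesis by simp
  qed
  show ?thesis
  proof (rule LIMSEQ_I)
    fix e :: real assume e: "0 < e"
    have "(\<lambda>k. B * (2 * (1/2::real) ^ k)) \<longlonglongrightarrow> B * (2 * 0)"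
      by (intro tendsto_mult_left LIMSEQ_power_zero) simp
    then have "eventually (\<lambda>k. B * (2 * (1/2::real) ^ k) < e / 2) sequentially"
      by (rule order_tendstoD(2)) (use e in simp)
    then obtain k where k: "B * (2 * (1/2::real) ^ k) < e / 2"
      using eventually_happens'[of sequentially] by auto
    have "(\<lambda>m. \<Sum>l<k. \<bar>\<Phi> (blk m l)\<bar>) \<longlonglongrightarrow> (\<Sum>l<k. \<bar>0\<bar>)"
      by (intro tendsto_sum tendsto_rabs blk0)
    then have "eventually (\<lambda>m. (\<Sum>l<k. \<bar>\<Phi> (blk m l)\<bar>) < e / 2) sequentially"
      by (rule order_tendstoD(2)) (use e in simp)
    then obtain m0 where m0: "\<And>m. m0 \<le> m \<Longrightarrow> (\<Sum>l<k. \<bar>\<Phi> (blk m l)\<bar>) < e / 2"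
      by (auto simp: eventually_sequentially)
    have "norm (\<Phi> (y A m) - 0) < e" if m: "max m0 k \<le> m" for m
    proof -
      have "\<bar>\<Phi> (y A m)\<bar> \<le> (\<Sum>l<k. \<bar>\<Phi> (blk m l)\<bar>) + B * (2 * (1/2) ^ k)" using bound m by simp
      also have "\<dots> < e / 2 + e / 2" using m0[of m] m k by (intro add_strict_mono) auto
      finally show ?thesis by simp
    qed
    then show "\<exists>no. \<forall>m\<ge>no. norm (\<Phi> (y A m) - 0) < e" by blast
  qed
qed


end

section \<open>Uncountably many inequivalent spreading models\<close>

context tensor_blocks
begin

text \<open>Absorbs the constants of both estimates in \<open>model_exists\<close>. What matters is
  that it is the same for every \<open>A\<close>.\<close>

definition D where "D = 4 * K ^ 2 * C ^ 4 * (2 * K * C ^ 2)"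

lemma nb_ge: "2 \<le> nb k" by (simp add: nb_def sum_nonneg)

lemma D_pos: "0 < D" using K1 C1 by (simp add: D_def)

lemma model_exists:
  assumes A: "0 \<in> A"
  obtains S where "c00_seminorm S" "{T. c00_seminorm T \<and> sm_equiv S T} \<in> SPw V N"
    "\<And>k. k \<in> A \<Longrightarrow> real (Suc k) * nb k \<le> D * S (trunc (M k) (\<alpha> k))"
    "\<And>k. k \<notin> A \<Longrightarrow> S (trunc (M k) (\<alpha> k)) \<le> D * nb k"
proof -
  \<comment> \<open>Block norms lie between \<open>1 / (K * C)\<close> and \<open>2 * C\<close>, so
    normalizing changes coefficients by bounded factors, which \<open>T_unconditional\<close>
    absorbs.\<close>
  define \<nu> where "\<nu> = (\<lambda>m. N (y A m))"
  have \<nu>: "1 / (K * C) \<le> \<nu> m" "\<nu> m \<le> 2 * C" for m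
    unfolding \<nu>_def by (rule y_lower[OF A], rule y_upper)
  have \<nu>0: "0 < \<nu> m" for m
    by (rule less_le_trans[OF _ \<nu>(1)]) (use K1 C1 in simp)
  define z where "z = (\<lambda>m. (1 / \<nu> m) *\<^sub>R y A m)"
  have zb: "basis_const z K" unfolding z_def by (rule basis_const_scale[OF y_basis])
  have z1: "N (z m) = 1" for m 
    unfolding z_def N_scale[OF y_V] using \<nu>0[of m] by (simp add: \<nu>_def)
  obtain m S where m: "strict_mono m" and S: "c00_seminorm S" and gen: "generates_sm V N (\<lambda>i. z (m i)) S"
    and lim: "\<And>a n. (\<And>i. n \<le> i \<Longrightarrow> a i = 0) \<Longrightarrow> (\<lambda>k. N (\<Sum>i<n. a i *\<^sub>R z (m (k + i)))) \<longlonglongrightarrow> S a"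
    using spreading_model_subsequence[OF zb z1] by blast
  have wnz: "weakly_null V N (\<lambda>i. z (m i))"
    unfolding weakly_null_def
  proof (intro conjI allI impI)
    show "z (m i) \<in> V" for i using basis_constD(1)[OF zb] .
    fix \<Phi> assume \<Phi>: "bdd_lin_functional V N \<Phi>"
    have "(\<lambda>n. \<Phi> (z n)) \<longlonglongrightarrow> 0"
    proof (rule Lim_null_comparison)
      have "(\<lambda>n. K * C * \<bar>\<Phi> (y A n)\<bar>) \<longlonglongrightarrow> K * C * \<bar>0\<bar>"
        by (intro tendsto_mult_left tendsto_rabs y_weakly_null_functional \<Phi>)
      then show "(\<lambda>n. K * C * \<bar>\<Phi> (y A n)\<bar>) \<longlonglongrightarrow> 0" by simp
      have "\<bar>\<Phi> (z n)\<bar> \<le> K * C * \<bar>\<Phi> (y A n)\<bar>" for n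
      proof -
        have "\<Phi> (z n) = (1 / \<nu> n) * \<Phi> (y A n)" using \<Phi> y_V unfolding z_def bdd_lin_functional_def by blast
        moreover have "1 / \<nu> n \<le> K * C" using \<nu>(1)[of n] \<nu>0[of n] K1 C1 by (simp add: field_simps)
        ultimately show ?thesis using \<nu>0[of n] by (simp add: abs_mult mult_right_mono del: times_divide_eq_left)
      qed
      then show "\<forall>\<^sub>F n in sequentially. norm (\<Phi> (z n)) \<le> K * C * \<bar>\<Phi> (y A n)\<bar>" by simp
    qed
    from LIMSEQ_subseq_LIMSEQ[OF this m] show "(\<lambda>n. \<Phi> (z (m n))) \<longlonglongrightarrow> 0" by (simp add: o_def)
  qed
  have cls: "{T. c00_seminorm T \<and> sm_equiv S T} \<in> SPw V N"
    unfolding SPw_def using S wnz gen by blast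
  have S_lim: "(\<lambda>s. N (\<Sum>i<M k. (\<alpha> k i / \<nu> (m (s + i))) *\<^sub>R y A (m (s + i)))) \<longlonglongrightarrow> S (trunc (M k) (\<alpha> k))" for k
  proof -
    have "(\<lambda>s. N (\<Sum>i<M k. trunc (M k) (\<alpha> k) i *\<^sub>R z (m (s + i)))) \<longlonglongrightarrow> S (trunc (M k) (\<alpha> k))"
      by (rule lim) (simp add: trunc_def)
    moreover have "(\<Sum>i<M k. trunc (M k) (\<alpha> k) i *\<^sub>R z (m (s + i)))
      = (\<Sum>i<M k. (\<alpha> k i / \<nu> (m (s + i))) *\<^sub>R y A (m (s + i)))" for s
      by (rule sum.cong) (auto simp: trunc_def z_def)
    ultimately show ?thesis by simp
  qed
  have \<kappa>: "strict_mono_on {..<n} (\<lambda>i. m (s + i))" for n s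
    using m by (auto simp: strict_mono_on_def strict_mono_def)
  have ms: "s \<le> m (s + i)" "s \<le> base (m (s + i))" for s i
    using strict_mono_imp_increasing[OF m, of "s + i"] le_base[of "m (s + i)"] by linarith+
  have up: "S (trunc (M k) (\<alpha> k)) \<le> D * nb k" if k: "k \<notin> A" for k
  proof (rule LIMSEQ_le_const2[OF S_lim])
    show "\<exists>s0. \<forall>s\<ge>s0. N (\<Sum>i<M k. (\<alpha> k i / \<nu> (m (s + i))) *\<^sub>R y A (m (s + i))) \<le> D * nb k"
    proof (intro exI[of _ "M k + k"] allI impI)
      fix s assume s: "M k + k \<le> s"
      define c where "c = (\<lambda>i. \<alpha> k i / \<nu> (m (s + i)))"
      have c: "\<bar>c i\<bar> \<le> \<bar>(K * C) * \<alpha> k i\<bar>" for i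
      proof -
        have "1 / \<nu> (m (s + i)) \<le> K * C" using \<nu>(1)[of "m (s + i)"] \<nu>0[of "m (s + i)"] K1 C1 by (simp add: field_simps)
        then have "\<bar>\<alpha> k i\<bar> * (1 / \<nu> (m (s + i))) \<le> \<bar>\<alpha> k i\<bar> * (K * C)" by (intro mult_left_mono) auto
        then show ?thesis using \<nu>0[of "m (s + i)"] K1 C1 by (simp add: c_def abs_mult mult.commute)
      qed
      have Tc: "T (trunc (M k) c) \<le> 2 * K * C ^ 2 * (K * C)"
        using T_unconditional[of "M k" c "\<lambda>i. (K * C) * \<alpha> k i"] c c00_seminormD(2)[OF T, of "M k" "K * C" "\<alpha> k"] K1 C1
        by (simp add: T_\<alpha>)
      have "(\<Sum>i<M k. \<bar>c i\<bar>) \<le> (\<Sum>i<M k. (K * C) * \<bar>\<alpha> k i\<bar>)"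
        using c K1 C1 by (intro sum_mono) (simp add: abs_mult)
      also have "\<dots> = (K * C) * na k" by (simp add: na_def sum_distrib_left)
      finally have c1: "(\<Sum>i<M k. \<bar>c i\<bar>) \<le> (K * C) * na k" .
      have "N (\<Sum>i<M k. c i *\<^sub>R y A (m (s + i)))
        \<le> (\<Sum>l<k. \<Sum>j<L l. \<bar>\<beta> l j\<bar>) * (C * T (trunc (M k) c)) + (\<Sum>i<M k. \<bar>c i\<bar>) * (2 * C / (1 + na k))"
      proof (rule y_comb_upper[OF \<kappa> _ _ k])
        show "0 < M k \<longrightarrow> M k \<le> base (m (s + 0))" using ms(2)[of s 0] s by linarith
        show "k \<le> m (s + i)" for i using ms(1)[of s i] s by linarith
      qed
      also have "\<dots> \<le> (\<Sum>l<k. \<Sum>j<L l. \<bar>\<beta> l j\<bar>) * (C * (2 * K * C ^ 2 * (K * C))) + 2 * (C * (2 * K * C ^ 2 * (K * C)))"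
      proof (rule add_mono)
        show "(\<Sum>l<k. \<Sum>j<L l. \<bar>\<beta> l j\<bar>) * (C * T (trunc (M k) c)) \<le> (\<Sum>l<k. \<Sum>j<L l. \<bar>\<beta> l j\<bar>) * (C * (2 * K * C ^ 2 * (K * C)))"
          using Tc C1 by (intro mult_left_mono) (auto intro: sum_nonneg)
        have "(\<Sum>i<M k. \<bar>c i\<bar>) * (2 * C / (1 + na k)) \<le> (K * C) * na k * (2 * C / (1 + na k))"
          using c1 C1 na_nonneg[of k] by (intro mult_right_mono) auto
        also have "\<dots> = 2 * (C * (K * C)) * (na k / (1 + na k))" by simp
        also have "\<dots> \<le> 2 * (C * (K * C)) * 1"
          using C1 K1 na_nonneg[of k] by (intro mult_left_mono) auto
        also have "\<dots> \<le> 2 * (C * ((2 * K * C ^ 2) * (K * C)))"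
        proof -
          have "1 * (K * C) \<le> (2 * K * C ^ 2) * (K * C)"
          proof (rule mult_right_mono)
            have "1 * 1 \<le> K * C ^ 2" using C1 K1 by (intro mult_mono one_le_power) auto
            then show "1 \<le> 2 * K * C ^ 2" by linarith
          qed (use C1 K1 in auto)
          then have "C * (1 * (K * C)) \<le> C * ((2 * K * C ^ 2) * (K * C))"
            by (rule mult_left_mono) (use C1 in simp)
          then show ?thesis by linarith
        qed
        finally show "(\<Sum>i<M k. \<bar>c i\<bar>) * (2 * C / (1 + na k)) \<le> 2 * (C * (2 * K * C ^ 2 * (K * C)))" .
      qed
      also have "\<dots> = (2 * K ^ 2 * C ^ 4) * nb k" by (simp add: nb_def algebra_simps power2_eq_square numeral_eq_Suc)
      also have "\<dots> \<le> D * nb k"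
      proof (rule mult_right_mono)
        have "1 * 1 \<le> K * C ^ 2" using C1 K1 by (intro mult_mono one_le_power) auto
        then have "(2 * K ^ 2 * C ^ 4) * 1 \<le> (4 * K ^ 2 * C ^ 4) * (2 * K * C ^ 2)"
          by (intro mult_mono) auto
        then show "2 * K ^ 2 * C ^ 4 \<le> D" by (simp add: D_def)
      qed (use nb_ge[of k] in simp)
      finally show "N (\<Sum>i<M k. (\<alpha> k i / \<nu> (m (s + i))) *\<^sub>R y A (m (s + i))) \<le> D * nb k" by (simp only: c_def)
    qed
  qed
  have lo: "real (Suc k) * nb k \<le> D * S (trunc (M k) (\<alpha> k))" if k: "k \<in> A" for k
  proof (rule LIMSEQ_le_const[OF tendsto_mult_left[OF S_lim]])
    show "\<exists>s0. \<forall>s\<ge>s0. real (Suc k) * nb k \<le> D * N (\<Sum>i<M k. (\<alpha> k i / \<nu> (m (s + i))) *\<^sub>R y A (m (s + i)))"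
    \<comment> \<open>From here on every block has a level \<open>k\<close> and starts after
      \<open>M k * L k\<close> positions, as the projection onto that level requires.\<close>
    proof (intro exI[of _ "M k * L k + k"] allI impI)
      fix s assume s: "M k * L k + k \<le> s"
      define c where "c = (\<lambda>i. \<alpha> k i / \<nu> (m (s + i)))"
      define X where "X = N (\<Sum>i<M k. c i *\<^sub>R blk (m (s + i)) k)"
      define Z where "Z = N (\<Sum>i<M k. c i *\<^sub>R y A (m (s + i)))"
      have k1: "k \<le> m (s + i)" "M k * L k \<le> base (m (s + i))" for i
        using ms[of s i] s by linarith+
      have XZ: "w k * X \<le> K * Z"
        unfolding X_def Z_def by (rule proj_lower[OF \<kappa> k1 k])
      have TX: "T (trunc (M k * L k) (tens (L k) c (\<beta> k))) \<le> C * X"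
        unfolding X_def by (rule tens_lower[OF \<kappa> k1])
      have "T (trunc (M k * L k) (tens (L k) (\<alpha> k) (\<beta> k)))
        \<le> 2 * K * C ^ 2 * T (trunc (M k * L k) (\<lambda>r. (2 * C) * tens (L k) c (\<beta> k) r))"
      proof (rule T_unconditional)
        fix r
        let ?i = "r div L k"
        have "\<bar>\<alpha> k ?i\<bar> = \<nu> (m (s + ?i)) * \<bar>c ?i\<bar>" using \<nu>0[of "m (s + ?i)"] by (simp add: c_def)
        also have "\<dots> \<le> 2 * C * \<bar>c ?i\<bar>" by (intro mult_right_mono \<nu>(2)) simp
        finally have "\<bar>\<alpha> k ?i\<bar> * \<bar>\<beta> k (r mod L k)\<bar> \<le> (2 * C * \<bar>c ?i\<bar>) * \<bar>\<beta> k (r mod L k)\<bar>"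
          by (rule mult_right_mono) simp
        then show "\<bar>tens (L k) (\<alpha> k) (\<beta> k) r\<bar> \<le> \<bar>(2 * C) * tens (L k) c (\<beta> k) r\<bar>"
          using C1 by (simp add: tens_def abs_mult mult.assoc)
      qed
      also have "\<dots> = 2 * K * C ^ 2 * (2 * C * T (trunc (M k * L k) (tens (L k) c (\<beta> k))))"
        using C1 by (simp add: c00_seminormD(2)[OF T])
      also have "\<dots> \<le> 2 * K * C ^ 2 * (2 * C * (C * X))"
        using TX C1 K1 by (intro mult_left_mono) auto
      finally have Tt: "T (trunc (M k * L k) (tens (L k) (\<alpha> k) (\<beta> k))) \<le> 2 * K * C ^ 2 * (2 * C * (C * X))" .
      have "real (Suc k) * nb k \<le> w k * T (trunc (M k * L k) (tens (L k) (\<alpha> k) (\<beta> k)))"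
        using big[of k] by (simp add: nb_def w_def na_def)
      also have "\<dots> \<le> w k * (2 * K * C ^ 2 * (2 * C * (C * X)))"
        using w_pos[of k] by (intro mult_left_mono Tt) simp
      also have "\<dots> = (4 * K * C ^ 4) * (w k * X)" by (simp add: power2_eq_square numeral_eq_Suc)
      also have "\<dots> \<le> (4 * K * C ^ 4) * (K * Z)" using XZ K1 C1 by (intro mult_left_mono) auto
      also have "\<dots> = (4 * K ^ 2 * C ^ 4) * Z" by (simp add: power2_eq_square)
      also have "\<dots> \<le> D * Z"
      proof (rule mult_right_mono)
        have "1 * 1 \<le> K * C ^ 2" using C1 K1 by (intro mult_mono one_le_power) auto
        then have "(4 * K ^ 2 * C ^ 4) * 1 \<le> (4 * K ^ 2 * C ^ 4) * (2 * K * C ^ 2)"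
          by (intro mult_left_mono) auto
        then show "4 * K ^ 2 * C ^ 4 \<le> D" by (simp add: D_def)
        show "0 \<le> Z" unfolding Z_def by (intro N_nonneg lincomb_in_V y_V)
      qed
      finally show "real (Suc k) * nb k \<le> D * N (\<Sum>i<M k. (\<alpha> k i / \<nu> (m (s + i))) *\<^sub>R y A (m (s + i)))"
        by (simp only: Z_def c_def)
    qed
  qed
  show ?thesis by (rule that[OF S cls lo up])
qed

text \<open>At \<open>\<alpha> k\<close> with \<open>k \<in> A - B\<close> the first norm exceeds
  the second by a factor of at least \<open>Suc k / D ^ 2\<close>, which is unbounded over an
  infinite difference.\<close>

lemma not_equiv:
  assumes S: "\<And>k. k \<in> A \<Longrightarrow> real (Suc k) * nb k \<le> D * S (trunc (M k) (\<alpha> k))"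
    and S': "\<And>k. k \<notin> B \<Longrightarrow> S' (trunc (M k) (\<alpha> k)) \<le> D * nb k"
    and inf: "infinite (A - B)"
  shows "\<not> sm_equiv S S'"
proof
  assume "sm_equiv S S'"
  then obtain E where E: "0 < E" "\<And>a. finite {i. a i \<noteq> 0} \<Longrightarrow> S a \<le> E * S' a"
    unfolding sm_equiv_def by blast
  obtain n where n: "D * (E * D) < real n" using reals_Archimedean2 by blast
  obtain k where k: "k \<in> A - B" "n \<le> k" using inf infinite_nat_iff_unbounded_le by blast
  have "real (Suc k) * nb k \<le> D * S (trunc (M k) (\<alpha> k))" using S k by simp
  also have "\<dots> \<le> D * (E * S' (trunc (M k) (\<alpha> k)))" using D_pos E(2)[of "trunc (M k) (\<alpha> k)"] by simp
  also have "\<dots> \<le> D * (E * (D * nb k))" using D_pos E(1) S'[of k] k by simp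
  finally have "real (Suc k) * nb k \<le> (D * (E * D)) * nb k" by (simp add: mult.assoc)
  then have "real (Suc k) \<le> D * (E * D)" using nb_ge[of k] by simp
  then show False using n k(2) by simp
qed

lemma uncountable_SPw: "uncountable (SPw V N)"
proof
  assume cnt: "countable (SPw V N)"
  \<comment> \<open>Codes of the finite initial segments of \<open>\<sigma>\<close>: two different
    sequences share only finitely many, so the differences are infinite. \<open>Suc\<close> keeps 0
    free as the common element.\<close>
  define A :: "(nat \<Rightarrow> bool) \<Rightarrow> nat set"
    where "A = (\<lambda>\<sigma>. insert 0 (range (\<lambda>n. Suc (to_nat (map \<sigma> [0..<n])))))"
  define PP where "PP = (\<lambda>\<sigma> S. c00_seminorm S \<and> {T. c00_seminorm T \<and> sm_equiv S T} \<in> SPw V N \<and>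
    (\<forall>k\<in>A \<sigma>. real (Suc k) * nb k \<le> D * S (trunc (M k) (\<alpha> k))) \<and>
    (\<forall>k. k \<notin> A \<sigma> \<longrightarrow> S (trunc (M k) (\<alpha> k)) \<le> D * nb k))"
  have "\<exists>S. PP \<sigma> S" for \<sigma>
  proof -
    have 0: "0 \<in> A \<sigma>" by (simp add: A_def)
    show ?thesis
    proof (rule model_exists[OF 0])
      fix S assume "c00_seminorm S" "{T. c00_seminorm T \<and> sm_equiv S T} \<in> SPw V N"
        "\<And>k. k \<in> A \<sigma> \<Longrightarrow> real (Suc k) * nb k \<le> D * S (trunc (M k) (\<alpha> k))"
        "\<And>k. k \<notin> A \<sigma> \<Longrightarrow> S (trunc (M k) (\<alpha> k)) \<le> D * nb k"
      then have "PP \<sigma> S" unfolding PP_def by simp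
      then show ?thesis by blast
    qed
  qed
  then have "\<exists>S. \<forall>\<sigma>. PP \<sigma> (S \<sigma>)" by (intro choice allI)
  then obtain S where "\<And>\<sigma>. PP \<sigma> (S \<sigma>)" by blast
  then have S: "\<And>\<sigma>. c00_seminorm (S \<sigma>)" "\<And>\<sigma>. {T. c00_seminorm T \<and> sm_equiv (S \<sigma>) T} \<in> SPw V N"
    "\<And>\<sigma> k. k \<in> A \<sigma> \<Longrightarrow> real (Suc k) * nb k \<le> D * S \<sigma> (trunc (M k) (\<alpha> k))"
    "\<And>\<sigma> k. k \<notin> A \<sigma> \<Longrightarrow> S \<sigma> (trunc (M k) (\<alpha> k)) \<le> D * nb k" unfolding PP_def by blast+
  have inf: "infinite (A \<sigma> - A \<tau>)" if ne: "\<sigma> \<noteq> \<tau>" for \<sigma> \<tau>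
  proof -
    obtain i where i: "\<sigma> i \<noteq> \<tau> i" using ne by (auto simp: fun_eq_iff)
    let ?f = "\<lambda>n. Suc (to_nat (map \<sigma> [0..<n]))"
    have inj: "inj_on ?f {i<..}"
      by (rule inj_onI) (metis Suc_inject diff_zero length_map length_upt to_nat_split)
    have "?f n \<in> A \<sigma> - A \<tau>" if "n \<in> {i<..}" for n
    proof -
      have "?f n \<noteq> Suc (to_nat (map \<tau> [0..<n']))" for n'
      proof
        assume "?f n = Suc (to_nat (map \<tau> [0..<n']))"
        then have eq: "map \<sigma> [0..<n] = map \<tau> [0..<n']" by simp
        then have "n = n'" by (metis diff_zero length_map length_upt)
        moreover have "map \<sigma> [0..<n] ! i = map \<tau> [0..<n'] ! i" by (simp only: eq)
        ultimately show False using i that by simp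
      qed
      then show ?thesis by (auto simp: A_def)
    qed
    then have "?f ` {i<..} \<subseteq> A \<sigma> - A \<tau>" by blast
    moreover have "infinite (?f ` {i<..})" using inj finite_imageD infinite_Ioi by blast
    ultimately show ?thesis using finite_subset by blast
  qed
  define Q where "Q = (\<lambda>\<sigma>. {T. c00_seminorm T \<and> sm_equiv (S \<sigma>) T})"
  have "inj Q"
  proof (rule injI, rule ccontr)
    fix \<sigma> \<tau> assume Q: "Q \<sigma> = Q \<tau>" and ne: "\<sigma> \<noteq> \<tau>"
    have "S \<tau> \<in> Q \<tau>" using S(1)[of \<tau>] c00_seminorm_nonneg[OF S(1)[of \<tau>]] by (auto simp: Q_def sm_equiv_def intro!: exI[of _ 1])
    then have "sm_equiv (S \<sigma>) (S \<tau>)" using Q by (auto simp: Q_def)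
    moreover have "\<not> sm_equiv (S \<sigma>) (S \<tau>)"
      using not_equiv[of "A \<sigma>" "S \<sigma>" "A \<tau>" "S \<tau>"] S(3,4) inf[OF ne] by blast
    ultimately show False by blast
  qed
  moreover have "range Q \<subseteq> SPw V N" using S(2) by (auto simp: Q_def)
  ultimately have "countable (UNIV :: (nat \<Rightarrow> bool) set)"
    using cnt countable_subset countable_image_inj_on by blast
  then obtain f :: "nat \<Rightarrow> nat \<Rightarrow> bool" where f: "range f = UNIV"
    using uncountable_def by blast
  then obtain n where "f n = (\<lambda>i. \<not> f i i)" by (metis surjD)
  then have "f n n = (\<not> f n n)" by metis
  then show False by simp
qed

end

text \<open>If no constant works, homogeneity supplies normalized pairs of arbitrarily large tensor
  norm. They are picked one after another, each large enough for \<open>tensor_blocks\<close>, which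
  contradicts countability.\<close>

lemma (in schreier_seq) submultiplicative:
  assumes wn: "weakly_null V N u" and cnt: "countable (SPw V N)"
  shows "\<exists>E. \<forall>m n a b. 0 < n \<longrightarrow> T (trunc (m * n) (tens n a b)) \<le> E * (T (trunc m a) * T (trunc n b))"
proof (rule ccontr)
  assume neg: "\<not> ?thesis"
  have fail: "\<exists>m n a b. 0 < n \<and> T (trunc m a) = 1 \<and> T (trunc n b) = 1 \<and> E \<le> T (trunc (m * n) (tens n a b))" for E
  proof -
    obtain m n a b where n: "0 < n" and gt: "E * (T (trunc m a) * T (trunc n b)) < T (trunc (m * n) (tens n a b))"
      using neg unfolding not_ex not_all not_imp not_le by blast
    have zero: "c i = 0" if "T (trunc l c) = 0" "i < l" for c l i
    proof -
      have "\<bar>c i\<bar> * T (trunc 1 (\<lambda>_. 1)) \<le> 0" using T_coeff[OF that(2), of c] that(1) by simp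
      then show ?thesis using T_pos by (simp add: mult_le_0_iff)
    qed
    \<comment> \<open>A vector of norm zero has zero coefficients by \<open>T_coeff\<close>, so its
      tensor products vanish too; hence both factors can be normalized.\<close>
    have "T (trunc m a) \<noteq> 0 \<and> T (trunc n b) \<noteq> 0"
    proof (rule ccontr)
      assume z: "\<not> ?thesis"
      then consider "T (trunc m a) = 0" | "T (trunc n b) = 0" by blast
      then have "trunc (m * n) (tens n a b) = trunc (m * n) (\<lambda>_. 0)"
      proof cases
        case 1
        show ?thesis
          by (rule trunc_cong) (use zero[OF 1] n in \<open>auto simp: tens_def div_less_iff_less_mult\<close>)
      next
        case 2
        show ?thesis by (rule trunc_cong) (use zero[OF 2] n in \<open>auto simp: tens_def\<close>)
      qed
      then have "T (trunc (m * n) (tens n a b)) = 0" by (simp add: T_zero)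
      then show False using gt z by auto
    qed
    then have pos: "0 < T (trunc m a)" "0 < T (trunc n b)" using T_nonneg less_le by metis+
    define c d where "c = 1 / T (trunc m a)" and "d = 1 / T (trunc n b)"
    have cd: "0 < c" "0 < d" using pos by (auto simp: c_def d_def)
    have "tens n (\<lambda>i. c * a i) (\<lambda>i. d * b i) = (\<lambda>r. (c * d) * tens n a b r)"
      by (auto simp: tens_def fun_eq_iff)
    then have "T (trunc (m * n) (tens n (\<lambda>i. c * a i) (\<lambda>i. d * b i))) = c * d * T (trunc (m * n) (tens n a b))"
      using c00_seminormD(2)[OF T, of "m * n" "c * d"] cd by simp
    moreover have "E = c * d * (E * (T (trunc m a) * T (trunc n b)))" using pos by (simp add: c_def d_def)
    moreover have "c * d * (E * (T (trunc m a) * T (trunc n b))) < c * d * T (trunc (m * n) (tens n a b))"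
      using gt cd by (intro mult_strict_left_mono) auto
    ultimately have "E \<le> T (trunc (m * n) (tens n (\<lambda>i. c * a i) (\<lambda>i. d * b i)))" by linarith
    moreover have "T (trunc m (\<lambda>i. c * a i)) = 1" "T (trunc n (\<lambda>i. d * b i)) = 1"
      unfolding c00_seminormD(2)[OF T] using cd pos by (simp_all add: c_def d_def)
    ultimately show ?thesis using n by blast
  qed
  \<comment> \<open>The history \<open>h\<close> enters through the absolute sums of the earlier
    vectors, which fix the bound and the weight before the next pair is chosen.\<close>
  define P where "P = (\<lambda>(h :: (nat \<times> nat \<times> (nat \<Rightarrow> real) \<times> (nat \<Rightarrow> real)) list) (m, n, a, b).
    0 < n \<and> T (trunc m a) = 1 \<and> T (trunc n b) = 1 \<and>
    real (Suc (length h)) * ((\<Sum>l<length h. case h ! l of (m, n, a, b) \<Rightarrow> \<Sum>j<n. \<bar>b j\<bar>) + 2)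
       \<le> ((1/2) ^ length h / (1 + (\<Sum>l<length h. case h ! l of (m, n, a, b) \<Rightarrow> \<Sum>i<m. \<bar>a i\<bar>))) * T (trunc (m * n) (tens n a b)))"
  have "\<exists>x. P h x" for h
  proof -
    define x where "x = real (Suc (length h)) * ((\<Sum>l<length h. case h ! l of (m, n, a, b) \<Rightarrow> \<Sum>j<n. \<bar>b j\<bar>) + 2)"
    define v where "v = (1/2::real) ^ length h / (1 + (\<Sum>l<length h. case h ! l of (m, n, a, b) \<Rightarrow> \<Sum>i<m. \<bar>a i\<bar>))"
    have "0 \<le> (\<Sum>l<length h. case h ! l of (m, n, a, b) \<Rightarrow> \<Sum>i<m. \<bar>a i\<bar>)"
      by (rule sum_nonneg) (auto split: prod.split intro: sum_nonneg)
    then have v: "0 < v" by (simp add: v_def)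
    obtain m n a b where *: "0 < n" "T (trunc m a) = 1" "T (trunc n b) = 1" "x / v \<le> T (trunc (m * n) (tens n a b))"
      using fail by blast
    then have "x \<le> v * T (trunc (m * n) (tens n a b))" using v by (simp add: field_simps)
    then have "P h (m, n, a, b)" using * by (simp add: P_def x_def v_def)
    then show ?thesis by blast
  qed
  then obtain f where f: "\<And>s. P (map f [0..<s]) (f s)" using history_choice[of P] by blast
  define M L \<alpha> \<beta> where "M = (\<lambda>k. fst (f k))" and "L = (\<lambda>k. fst (snd (f k)))"
    and "\<alpha> = (\<lambda>k. fst (snd (snd (f k))))" and "\<beta> = (\<lambda>k. snd (snd (snd (f k))))"
  have feq: "f k = (M k, L k, \<alpha> k, \<beta> k)" for k by (simp add: M_def L_def \<alpha>_def \<beta>_def)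
  have "tensor_blocks V N u K C T M L \<alpha> \<beta>"
  proof
    fix k
    have *: "P (map f [0..<k]) (M k, L k, \<alpha> k, \<beta> k)" using f[of k] by (simp only: feq)
    show "0 < L k" "T (trunc (M k) (\<alpha> k)) = 1" "T (trunc (L k) (\<beta> k)) = 1" using * by (auto simp: P_def)
    show "real (Suc k) * ((\<Sum>l<k. \<Sum>j<L l. \<bar>\<beta> l j\<bar>) + 2)
       \<le> ((1/2) ^ k / (1 + (\<Sum>l<k. \<Sum>i<M l. \<bar>\<alpha> l i\<bar>))) * T (trunc (M k * L k) (tens (L k) (\<alpha> k) (\<beta> k)))"
      using * by (simp add: P_def feq)
  qed (rule wn)
  then show False using tensor_blocks.uncountable_SPw cnt by blast
qed

section \<open>Indicators, constant vectors and truncations\<close>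

context schreier_seq
begin

text \<open>The vectors \<open>u (n + i)\<close> with \<open>i \<in> J\<close> can be read as
  \<open>card J\<close> vectors far out or as part of \<open>n\<close> such vectors. So the norm of
  an indicator depends, up to \<open>C ^ 2\<close>, only on the size of the set.\<close>

lemma T_indicator:
  assumes J: "J \<subseteq> {..<n}"
  shows "T (trunc (card J) (\<lambda>_. 1)) \<le> C ^ 2 * T (trunc n (indicator J))"
    and "T (trunc n (indicator J)) \<le> C ^ 2 * T (trunc (card J) (\<lambda>_. 1))"
proof -
  have fin: "finite J" using J finite_subset by blast
  define js where "js = sorted_list_of_set J"
  define p where "p = card J"
  have js: "set js = J" "sorted_wrt (<) js" "length js = p" "distinct js"
    using fin by (auto simp: js_def p_def)
  have bij: "bij_betw (\<lambda>q. js ! q) {..<p} J" using bij_betw_nth[of js "{..<p}" J] js by simp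
  have pn: "p \<le> n" using card_mono[OF _ J] by (simp add: p_def)
  define k where "k = (\<lambda>q. n + js ! q)"
  have k: "strict_mono_on {..<p} k" "0 < p \<longrightarrow> p \<le> k 0"
    using js pn by (auto simp: k_def strict_mono_on_def sorted_wrt_iff_nth_less)
  have n: "strict_mono_on {..<n} (\<lambda>i. n + i)" "0 < n \<longrightarrow> n \<le> n + 0" by (auto simp: strict_mono_on_def)
  have "(\<Sum>i<n. indicator J i *\<^sub>R u (n + i)) = (\<Sum>i\<in>J. indicator J i *\<^sub>R u (n + i))"
    using J by (intro sum.mono_neutral_right) auto
  also have "\<dots> = (\<Sum>i\<in>J. 1 *\<^sub>R u (n + i))" by (rule sum.cong) auto
  also have "\<dots> = (\<Sum>q<p. 1 *\<^sub>R u (k q))"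
    using sum.reindex_bij_betw[OF bij, of "\<lambda>i. 1 *\<^sub>R u (n + i)"] by (simp add: k_def)
  finally have eq: "(\<Sum>i<n. indicator J i *\<^sub>R u (n + i)) = (\<Sum>q<p. 1 *\<^sub>R u (k q))" .
  have "T (trunc p (\<lambda>_. 1)) \<le> C * N (\<Sum>q<p. 1 *\<^sub>R u (k q))" by (rule T_lower[OF k])
  also have "\<dots> \<le> C * (C * T (trunc n (indicator J)))"
    using T_upper[OF n, of "indicator J"] C1 unfolding eq by (intro mult_left_mono) auto
  finally show "T (trunc (card J) (\<lambda>_. 1)) \<le> C ^ 2 * T (trunc n (indicator J))"
    by (simp add: p_def power2_eq_square mult.assoc)
  have "T (trunc n (indicator J)) \<le> C * N (\<Sum>q<p. 1 *\<^sub>R u (k q))"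
    using T_lower[OF n, of "indicator J"] unfolding eq .
  also have "\<dots> \<le> C * (C * T (trunc p (\<lambda>_. 1)))"
    using T_upper[OF k, of "\<lambda>_. 1"] C1 by (intro mult_left_mono) auto
  finally show "T (trunc n (indicator J)) \<le> C ^ 2 * T (trunc (card J) (\<lambda>_. 1))"
    by (simp add: p_def power2_eq_square mult.assoc)
qed

lemma T_ones_mono:
  assumes "p \<le> q"
  shows "T (trunc p (\<lambda>_. 1)) \<le> 2 * K * C ^ 2 * T (trunc q (\<lambda>_. 1))"
proof -
  have "trunc q (trunc p (\<lambda>_. 1)) = trunc p (\<lambda>_. 1)" using assms by (auto simp: trunc_def fun_eq_iff)
  then show ?thesis
    using T_unconditional[of q "trunc p (\<lambda>_. 1)" "\<lambda>_. 1"] by (simp add: trunc_def)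
qed

lemma T_trunc_le:
  assumes "finite {i. a i \<noteq> 0}"
  shows "T (trunc n a) \<le> 2 * K * C ^ 2 * T a"
proof -
  obtain m where m: "\<And>i. m \<le> i \<Longrightarrow> a i = 0" using finite_supp_bounded[OF assms] by blast
  define q where "q = max m n"
  have "trunc q (trunc n a) = trunc n a" by (auto simp: trunc_def q_def fun_eq_iff)
  moreover have "trunc q a = a" by (rule trunc_eq_self) (use m in \<open>auto simp: q_def\<close>)
  ultimately show ?thesis using T_unconditional[of q "trunc n a" a] by (simp add: trunc_def)
qed

end

section \<open>Duality\<close>

lemma sum_fun_apply: "(\<Sum>i\<in>I. g i) x = (\<Sum>i\<in>I. g i x)"
  by (induction I rule: infinite_finite_induct) auto

lemma subspace_closure:
  fixes W :: "'a::real_normed_vector set"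
  assumes "subspace W"
  shows "subspace (closure W)"
proof (rule subspaceI)
  show "0 \<in> closure W" using subspace_0[OF assms] closure_subset by blast
  show "x + y \<in> closure W" if xy: "x \<in> closure W" "y \<in> closure W" for x y
  proof -
    obtain f g where "\<And>n. f n \<in> W" "f \<longlonglongrightarrow> x" "\<And>n. g n \<in> W" "g \<longlonglongrightarrow> y"
      using xy unfolding closure_sequential by blast
    then show ?thesis unfolding closure_sequential
      by (intro exI[of _ "\<lambda>n. f n + g n"]) (auto intro: tendsto_add subspace_add[OF assms])
  qed
  show "c *\<^sub>R x \<in> closure W" if x: "x \<in> closure W" for c x
  proof -
    obtain f where "\<And>n. f n \<in> W" "f \<longlonglongrightarrow> x" using x unfolding closure_sequential by blast
    then show ?thesis unfolding closure_sequential
      by (intro exI[of _ "\<lambda>n. c *\<^sub>R f n"]) (auto intro: tendsto_scaleR subspace_scale[OF assms])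
  qed
qed

lemma span_range_nat:
  fixes z :: "nat \<Rightarrow> 'a::real_vector"
  assumes "v \<in> span (range z)"
  obtains n a where "v = (\<Sum>j<n. a j *\<^sub>R z j)"
proof -
  define W where "W = {v. \<exists>n a. v = (\<Sum>j<n. a j *\<^sub>R z j)}"
  have ext: "(\<Sum>j<n. a j *\<^sub>R z j) = (\<Sum>j<m. trunc n a j *\<^sub>R z j)" if "n \<le> m" for n m a
    using that by (intro sum.mono_neutral_cong_left) (auto simp: trunc_def)
  have "subspace W"
  proof (rule subspaceI)
    show "0 \<in> W" unfolding W_def by (intro CollectI exI[of _ 0]) simp
    show "x + y \<in> W" if xy: "x \<in> W" "y \<in> W" for x y
    proof -
      obtain n a m b where x: "x = (\<Sum>j<n. a j *\<^sub>R z j)" and y: "y = (\<Sum>j<m. b j *\<^sub>R z j)"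
        using xy by (auto simp: W_def)
      have "x + y = (\<Sum>j<max n m. (trunc n a j + trunc m b j) *\<^sub>R z j)"
        unfolding x y using ext[of n "max n m" a] ext[of m "max n m" b]
        by (simp add: scaleR_add_left sum.distrib)
      then show ?thesis unfolding W_def
        by (intro CollectI exI[of _ "max n m"] exI[of _ "\<lambda>j. trunc n a j + trunc m b j"])
    qed
    show "c *\<^sub>R x \<in> W" if x: "x \<in> W" for c x
    proof -
      obtain n a where "x = (\<Sum>j<n. a j *\<^sub>R z j)" using x by (auto simp: W_def)
      then have "c *\<^sub>R x = (\<Sum>j<n. (c * a j) *\<^sub>R z j)" by (simp add: scaleR_sum_right)
      then show ?thesis unfolding W_def by (intro CollectI exI[of _ n] exI[of _ "\<lambda>j. c * a j"])
    qed
  qed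
  moreover have "range z \<subseteq> W"
  proof
    fix v assume "v \<in> range z"
    then obtain i where i: "v = z i" by blast
    have "(\<Sum>j<Suc i. (if j = i then 1 else 0) *\<^sub>R z j) = z i"
      by (simp add: if_distrib[of "\<lambda>c. c *\<^sub>R _"] cong: if_cong)
    then show "v \<in> W" unfolding W_def i
      by (intro CollectI exI[of _ "Suc i"] exI[of _ "\<lambda>j. if j = i then 1 else 0"]) (rule sym)
  qed
  ultimately have "v \<in> W" using span_minimal assms by blast
  then show ?thesis using that by (auto simp: W_def)
qed

lemma dual_spaceD:
  assumes "f \<in> dual_space Y"
  shows "x \<in> Y \<Longrightarrow> y \<in> Y \<Longrightarrow> f (x + y) = f x + f y" "x \<in> Y \<Longrightarrow> f (c *\<^sub>R x) = c * f x"
    "x \<notin> Y \<Longrightarrow> f x = 0" "\<exists>B\<ge>0. \<forall>y\<in>Y. \<bar>f y\<bar> \<le> B * norm y"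
proof -
  obtain B where B: "\<forall>y\<in>Y. \<bar>f y\<bar> \<le> B * norm y"
    using assms unfolding dual_space_def bdd_lin_functional_def by blast
  have "\<forall>y\<in>Y. \<bar>f y\<bar> \<le> \<bar>B\<bar> * norm y"
    using B by (meson abs_ge_self mult_right_mono norm_ge_zero order_trans)
  then show "\<exists>B\<ge>0. \<forall>y\<in>Y. \<bar>f y\<bar> \<le> B * norm y" by (intro exI[of _ "\<bar>B\<bar>"]) simp
qed (use assms in \<open>auto simp: dual_space_def bdd_lin_functional_def\<close>)

lemma dual_norm_set:
  assumes Y: "subspace Y" and f: "f \<in> dual_space Y"
  shows "bdd_above {\<bar>f y\<bar> | y. y \<in> Y \<and> norm y \<le> 1}" "{\<bar>f y\<bar> | y. y \<in> Y \<and> norm y \<le> 1} \<noteq> {}"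
proof -
  obtain B where B: "0 \<le> B" "\<forall>y\<in>Y. \<bar>f y\<bar> \<le> B * norm y" using dual_spaceD(4)[OF f] by blast
  show "bdd_above {\<bar>f y\<bar> | y. y \<in> Y \<and> norm y \<le> 1}"
  proof (rule bdd_aboveI)
    fix r assume "r \<in> {\<bar>f y\<bar> | y. y \<in> Y \<and> norm y \<le> 1}"
    then obtain y where y: "y \<in> Y" "norm y \<le> 1" "r = \<bar>f y\<bar>" by blast
    then have "r \<le> B * norm y" using B(2) by blast
    also have "\<dots> \<le> B * 1" using y(2) B(1) by (rule mult_left_mono)
    finally show "r \<le> B * 1" .
  qed
  show "{\<bar>f y\<bar> | y. y \<in> Y \<and> norm y \<le> 1} \<noteq> {}"
    using subspace_0[OF Y] by (auto intro!: exI[of _ 0])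
qed

lemma dual_norm_bound:
  assumes Y: "subspace Y" and f: "f \<in> dual_space Y" and y: "y \<in> Y"
  shows "\<bar>f y\<bar> \<le> dual_norm Y f * norm y"
proof (cases "y = 0")
  case True
  then show ?thesis using dual_spaceD(2)[OF f y, of 0] by simp
next
  case False
  define v where "v = (1 / norm y) *\<^sub>R y"
  have v: "v \<in> Y" "norm v \<le> 1" using y False by (auto simp: v_def intro: subspace_scale[OF Y])
  have "\<bar>f v\<bar> \<le> dual_norm Y f"
    unfolding dual_norm_def using v by (intro cSup_upper dual_norm_set(1)[OF Y f]) blast
  moreover have "f v = (1 / norm y) * f y" unfolding v_def by (rule dual_spaceD(2)[OF f y])
  ultimately show ?thesis using False by (simp add: abs_mult field_simps)
qed

lemma dual_norm_le:
  assumes Y: "subspace Y" and f: "f \<in> dual_space Y" and B: "0 \<le> B" "\<And>y. y \<in> Y \<Longrightarrow> \<bar>f y\<bar> \<le> B * norm y"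
  shows "dual_norm Y f \<le> B"
  unfolding dual_norm_def
proof (rule cSup_least[OF dual_norm_set(2)[OF Y f]])
  fix r assume "r \<in> {\<bar>f y\<bar> | y. y \<in> Y \<and> norm y \<le> 1}"
  then obtain y where y: "y \<in> Y" "norm y \<le> 1" "r = \<bar>f y\<bar>" by blast
  then have "r \<le> B * norm y" using B(2) by blast
  also have "\<dots> \<le> B * 1" using y(2) B(1) by (rule mult_left_mono)
  finally show "r \<le> B" by simp
qed

lemma subspace_dual_space:
  assumes Y: "subspace Y"
  shows "subspace (dual_space Y)"
proof (rule subspaceI)
  show "0 \<in> dual_space Y"
    by (auto simp: dual_space_def bdd_lin_functional_def intro!: exI[of _ 0])
next
  fix f g assume fg: "f \<in> dual_space Y" "g \<in> dual_space Y"
  obtain B B' where B: "\<forall>y\<in>Y. \<bar>f y\<bar> \<le> B * norm y" "\<forall>y\<in>Y. \<bar>g y\<bar> \<le> B' * norm y"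
    using dual_spaceD(4)[OF fg(1)] dual_spaceD(4)[OF fg(2)] by blast
  have "\<bar>f y + g y\<bar> \<le> (B + B') * norm y" if "y \<in> Y" for y
    using B that abs_triangle_ineq[of "f y" "g y"] by (fastforce simp: distrib_right)
  then have "\<exists>B. \<forall>y\<in>Y. \<bar>f y + g y\<bar> \<le> B * norm y" by blast
  then show "f + g \<in> dual_space Y"
    using fg by (simp add: dual_space_def bdd_lin_functional_def algebra_simps)
next
  fix f and c :: real assume f: "f \<in> dual_space Y"
  obtain B where B: "\<forall>y\<in>Y. \<bar>f y\<bar> \<le> B * norm y" using dual_spaceD(4)[OF f] by blast
  have "\<bar>c * f y\<bar> \<le> (\<bar>c\<bar> * B) * norm y" if "y \<in> Y" for y
    using mult_left_mono[OF bspec[OF B that], of "\<bar>c\<bar>"] by (simp add: abs_mult mult.assoc)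
  then have "\<exists>B. \<forall>y\<in>Y. \<bar>c * f y\<bar> \<le> B * norm y" by blast
  then show "c *\<^sub>R f \<in> dual_space Y"
    using f by (simp add: dual_space_def bdd_lin_functional_def scaleR_fun_def algebra_simps)
qed

lemma dual_norm_nonneg:
  assumes Y: "subspace Y" and f: "f \<in> dual_space Y"
  shows "0 \<le> dual_norm Y f"
proof -
  have "0 \<in> {\<bar>f y\<bar> | y. y \<in> Y \<and> norm y \<le> 1}"
    using subspace_0[OF Y] dual_spaceD(2)[OF f subspace_0[OF Y], of 0]
    by (auto intro!: exI[of _ "0::'a"])
  then show ?thesis unfolding dual_norm_def by (intro cSup_upper dual_norm_set(1)[OF Y f])
qed

lemma seminormed_dual:
  assumes Y: "subspace Y"
  shows "seminormed (dual_space Y) (dual_norm Y)"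
proof
  note sub = subspace_dual_space[OF Y]
  show "subspace (dual_space Y)" by (rule sub)
  show "dual_norm Y (f + g) \<le> dual_norm Y f + dual_norm Y g" if fg: "f \<in> dual_space Y" "g \<in> dual_space Y" for f g
  proof (rule dual_norm_le[OF Y subspace_add[OF sub fg]])
    show "0 \<le> dual_norm Y f + dual_norm Y g" using dual_norm_nonneg[OF Y] fg by simp
    show "\<bar>(f + g) y\<bar> \<le> (dual_norm Y f + dual_norm Y g) * norm y" if "y \<in> Y" for y
      using dual_norm_bound[OF Y fg(1) that] dual_norm_bound[OF Y fg(2) that] by (simp add: distrib_right)
  qed
  have le: "dual_norm Y (c *\<^sub>R f) \<le> \<bar>c\<bar> * dual_norm Y f" if f: "f \<in> dual_space Y" for f and c :: real
  proof (rule dual_norm_le[OF Y subspace_scale[OF sub f]])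
    show "0 \<le> \<bar>c\<bar> * dual_norm Y f" using dual_norm_nonneg[OF Y f] by simp
    show "\<bar>(c *\<^sub>R f) y\<bar> \<le> \<bar>c\<bar> * dual_norm Y f * norm y" if "y \<in> Y" for y
      using mult_left_mono[OF dual_norm_bound[OF Y f that], of "\<bar>c\<bar>"] by (simp add: scaleR_fun_def abs_mult mult.assoc)
  qed
  show "dual_norm Y (c *\<^sub>R f) = \<bar>c\<bar> * dual_norm Y f" if f: "f \<in> dual_space Y" for f and c :: real
  proof (cases "c = 0")
    case True
    then show ?thesis using le[OF f, of 0] dual_norm_nonneg[OF Y subspace_scale[OF sub f, of 0]] by simp
  next
    case False
    have "dual_norm Y ((1 / c) *\<^sub>R (c *\<^sub>R f)) \<le> \<bar>1 / c\<bar> * dual_norm Y (c *\<^sub>R f)"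
      by (rule le[OF subspace_scale[OF sub f]])
    then have "\<bar>c\<bar> * dual_norm Y f \<le> dual_norm Y (c *\<^sub>R f)" using False by (simp add: field_simps)
    then show ?thesis using le[OF f, of c] by simp
  qed
qed

lemma seminormed_UNIV: "seminormed UNIV (norm :: 'a::real_normed_vector \<Rightarrow> real)"
  by standard (auto intro: norm_triangle_ineq)

section \<open>Biorthogonal functionals in the dual of the closed span\<close>

locale schreier_basis = schreier_seq UNIV norm z K C S
  for z :: "nat \<Rightarrow> 'a::real_normed_vector" and K C S +
  assumes norm_z: "norm (z i) = 1"
begin

definition Y where "Y = closure (span (range z))"

lemma subspace_Y: "subspace Y" unfolding Y_def by (rule subspace_closure) simp

lemma comb_in_Y: "(\<Sum>i\<in>I. a i *\<^sub>R z i) \<in> Y"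
proof -
  have "(\<Sum>i\<in>I. a i *\<^sub>R z i) \<in> span (range z)" by (intro span_sum span_scale span_base) auto
  then show ?thesis unfolding Y_def using closure_subset by blast
qed

lemma z_coeff: "i < n \<Longrightarrow> \<bar>a i\<bar> \<le> 2 * K * norm (\<Sum>j<n. a j *\<^sub>R z j)"
  using basis_const_coeff[OF u_basis, of i n a] norm_z by simp

text \<open>Makes the countability hypothesis on duals applicable to \<open>Y\<close>. The
  coordinate bounds give linear independence of the \<open>z i\<close>.\<close>

lemma infinite_dim_Y: "infinite_dim Y"
  unfolding infinite_dim_def
proof
  assume "\<exists>B. finite B \<and> span B = Y"
  then obtain B where B: "finite B" "span B = Y" by blast
  have inj: "inj z"
  proof (rule injI, rule ccontr)
    fix i j assume eq: "z i = z j" and ne: "i \<noteq> j"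
    define a where "a = (\<lambda>l. if l = i then 1 else if l = j then -1 else (0::real))"
    define n where "n = Suc (max i j)"
    have "(\<Sum>l<n. a l *\<^sub>R z l) = (\<Sum>l\<in>{i, j}. a l *\<^sub>R z l)"
      by (rule sum.mono_neutral_right) (auto simp: a_def n_def)
    also have "\<dots> = 0" using ne eq by (simp add: a_def)
    finally have "\<bar>a i\<bar> \<le> 0" using z_coeff[of i n a] by (simp add: n_def)
    then show False by (simp add: a_def)
  qed
  have ind: "independent (range z)"
    unfolding independent_explicit_module
  proof (intro allI impI)
    fix t c v assume t: "finite t" "t \<subseteq> range z" and s: "(\<Sum>v\<in>t. c v *\<^sub>R v) = 0" and v: "v \<in> t"
    obtain i where i: "v = z i" using t v by blast
    define J where "J = z -` t"
    have J: "finite J" "z ` J = t" using t inj by (auto simp: J_def finite_vimageI)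
    obtain n where n: "J \<subseteq> {..<n}" using finite_nat_bounded[OF J(1)] by blast
    define a where "a = (\<lambda>j. if j \<in> J then c (z j) else 0)"
    have "(\<Sum>j<n. a j *\<^sub>R z j) = (\<Sum>j\<in>J. c (z j) *\<^sub>R z j)"
      using n by (intro sum.mono_neutral_cong_right) (auto simp: a_def)
    also have "\<dots> = (\<Sum>v\<in>t. c v *\<^sub>R v)"
      using sum.reindex[OF inj_on_subset[OF inj subset_UNIV], of "\<lambda>v. c v *\<^sub>R v" J] J(2) by simp
    finally have "(\<Sum>j<n. a j *\<^sub>R z j) = 0" using s by simp
    moreover have "i \<in> J" using v i by (simp add: J_def)
    ultimately have "\<bar>a i\<bar> \<le> 0" using z_coeff[of i n a] n by auto
    then show "c v = 0" using \<open>i \<in> J\<close> i by (simp add: a_def)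
  qed
  have "range z \<subseteq> span B" unfolding B Y_def using closure_subset span_superset by fastforce
  then have "finite (range z)" using independent_span_bound[OF B(1) ind] by blast
  then show False using finite_imageD[OF _ inj] by simp
qed

text \<open>The functional is prescribed through its graph, spanned by \<open>(z i, 1)\<close> and
  the pairs \<open>(z j, 0)\<close> for other \<open>j\<close>; \<open>z_coeff\<close> bounds it by
  \<open>2 * K\<close>, and Hahn-Banach extends it to the whole space.\<close>

lemma coordinate_functional:
  "\<exists>f. linear f \<and> (\<forall>v. \<bar>f v\<bar> \<le> 2 * K * norm v) \<and> (\<forall>j. f (z j) = (if j = i then 1 else 0))"
proof -
  define g where "g = (\<lambda>j. (z j, if j = i then 1 else 0 :: real))"
  have bd: "t \<le> 2 * K * norm v" if vs: "(v, t) \<in> span (range g)" for v t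
  proof -
    obtain n a where vt: "(v, t) = (\<Sum>j<n. a j *\<^sub>R g j)" using span_range_nat[OF vs] by blast
    have v: "v = (\<Sum>j<n. a j *\<^sub>R z j)" using arg_cong[OF vt, of fst] by (simp add: fst_sum g_def)
    have t: "t = (\<Sum>j<n. a j * (if j = i then 1 else 0))" using arg_cong[OF vt, of snd] by (simp add: snd_sum g_def)
    show ?thesis
    proof (cases "i < n")
      case True
      then have "t = a i" unfolding t by (simp add: if_distrib[of "\<lambda>c. _ * c"] cong: if_cong)
      then show ?thesis using z_coeff[OF True, of a] v by simp
    next
      case False
      then have "t = 0" unfolding t by (intro sum.neutral) auto
      then show ?thesis using K1 by simp
    qed
  qed
  show ?thesis
  proof (rule hahn_banach_graph[of "span (range g)" "2 * K"])
    fix f assume f: "linear f" "\<And>v. \<bar>f v\<bar> \<le> 2 * K * norm v" "\<And>v t. (v, t) \<in> span (range g) \<Longrightarrow> f v = t"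
    have "f (z j) = (if j = i then 1 else 0)" for j
      by (rule f(3), rule span_base) (simp add: g_def)
    then show ?thesis using f by blast
  qed (use bd K1 in auto)
qed

text \<open>\<open>F i\<close> lives on the whole space, which keeps linear algebra free of
  membership conditions; \<open>f i\<close> is its restriction to \<open>Y\<close> in the convention
  of \<open>dual_space\<close>, zero off \<open>Y\<close>.\<close>

definition F where "F i = (SOME f. linear f \<and> (\<forall>v. \<bar>f v\<bar> \<le> 2 * K * norm v) \<and>
  (\<forall>j. f (z j) = (if j = i then 1 else 0)))"
definition f where "f i = (\<lambda>v. if v \<in> Y then F i v else 0)"

lemma F: "linear (F i)" "\<bar>F i v\<bar> \<le> 2 * K * norm v" "F i (z j) = (if j = i then 1 else 0)"
  using someI_ex[OF coordinate_functional[of i]] unfolding F_def by blast+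

lemma f_dual: "f i \<in> dual_space Y"
  unfolding dual_space_def bdd_lin_functional_def
proof (intro CollectI conjI ballI allI impI exI[of _ "2 * K"])
  show "f i (x + y) = f i x + f i y" if "x \<in> Y" "y \<in> Y" for x y
    using that subspace_add[OF subspace_Y that] by (simp add: f_def linear_add[OF F(1)])
  show "f i (c *\<^sub>R x) = c * f i x" if "x \<in> Y" for c x
    using that subspace_scale[OF subspace_Y that] by (simp add: f_def linear_scale[OF F(1)])
  show "\<bar>f i x\<bar> \<le> 2 * K * norm x" if "x \<in> Y" for x using that F(2) by (simp add: f_def)
qed (simp add: f_def)

lemma f_comb_apply:
  assumes "finite I" "finite J"
  shows "(\<Sum>i\<in>I. b i *\<^sub>R f (k i)) (\<Sum>j\<in>J. a j *\<^sub>R z j) = (\<Sum>i\<in>I. b i * (if k i \<in> J then a (k i) else 0))"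
proof -
  have "f i (\<Sum>j\<in>J. a j *\<^sub>R z j) = (if i \<in> J then a i else 0)" for i
  proof -
    have "f i (\<Sum>j\<in>J. a j *\<^sub>R z j) = (\<Sum>j\<in>J. a j * (if j = i then 1 else 0))"
      using comb_in_Y by (simp add: f_def linear_sum[OF F(1)] linear_scale[OF F(1)] F(3))
    also have "\<dots> = (if i \<in> J then a i else 0)"
      using assms(2) by (simp add: if_distrib[of "\<lambda>c. _ * c"] cong: if_cong)
    finally show ?thesis .
  qed
  then show ?thesis by (simp add: sum_fun_apply scaleR_fun_def)
qed

sublocale dual: seminormed "dual_space Y" "dual_norm Y"
  by (rule seminormed_dual[OF subspace_Y])

lemma f_comb_dual: "(\<Sum>i\<in>I. b i *\<^sub>R f (k i)) \<in> dual_space Y"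
  by (intro dual.lincomb_in_V f_dual)

lemma dual_norm_le_dense:
  assumes g: "g \<in> dual_space Y" and B: "0 \<le> B"
    and bd: "\<And>n a. \<bar>g (\<Sum>j<n. a j *\<^sub>R z j)\<bar> \<le> B * norm (\<Sum>j<n. a j *\<^sub>R z j)"
  shows "dual_norm Y g \<le> B"
proof (rule dual_norm_le[OF subspace_Y g B])
  fix y assume y: "y \<in> Y"
  then obtain s where s: "\<And>n. s n \<in> span (range z)" "s \<longlonglongrightarrow> y" unfolding Y_def closure_sequential by blast
  have sY: "s n \<in> Y" for n using s(1) closure_subset unfolding Y_def by blast
  show "\<bar>g y\<bar> \<le> B * norm y"
  proof (rule LIMSEQ_le_const)
    have "(\<lambda>n. B * norm (s n) + dual_norm Y g * norm (y - s n)) \<longlonglongrightarrow> B * norm y + dual_norm Y g * norm (y - y)"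
      by (intro tendsto_intros s)
    then show "(\<lambda>n. B * norm (s n) + dual_norm Y g * norm (y - s n)) \<longlonglongrightarrow> B * norm y" by simp
    have "\<bar>g y\<bar> \<le> B * norm (s n) + dual_norm Y g * norm (y - s n)" for n
    proof -
      have "g y = g (s n) + g (y - s n)"
        using dual_spaceD(1)[OF g sY[of n] subspace_diff[OF subspace_Y y sY[of n]]] by simp
      moreover have "\<bar>g (s n)\<bar> \<le> B * norm (s n)" using span_range_nat[OF s(1)[of n]] bd by metis
      moreover have "\<bar>g (y - s n)\<bar> \<le> dual_norm Y g * norm (y - s n)"
        by (rule dual_norm_bound[OF subspace_Y g subspace_diff[OF subspace_Y y sY]])
      ultimately show ?thesis by linarith
    qed
    then show "\<exists>N. \<forall>n\<ge>N. \<bar>g y\<bar> \<le> B * norm (s n) + dual_norm Y g * norm (y - s n)" by blast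
  qed
qed

lemma f_comb_bound: "\<bar>(\<Sum>i\<in>I. b i *\<^sub>R f (k i)) (\<Sum>j\<in>J. a j *\<^sub>R z j)\<bar>
    \<le> dual_norm Y (\<Sum>i\<in>I. b i *\<^sub>R f (k i)) * norm (\<Sum>j\<in>J. a j *\<^sub>R z j)"
  by (rule dual_norm_bound[OF subspace_Y f_comb_dual comb_in_Y])

text \<open>The combination over \<open>G\<close> is the full one composed with the coordinate
  projection onto \<open>G\<close>, so a bound for the projection passes to the dual with the same
  constant.\<close>

lemma f_projection:
  assumes G: "G \<subseteq> {..<n}"
    and proj: "\<And>m a. norm (\<Sum>j\<in>G \<inter> {..<m}. a j *\<^sub>R z j) \<le> K * norm (\<Sum>j<m. a j *\<^sub>R z j)"
  shows "dual_norm Y (\<Sum>i\<in>G. b i *\<^sub>R f i) \<le> K * dual_norm Y (\<Sum>i<n. b i *\<^sub>R f i)"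
proof (rule dual_norm_le_dense)
  have fG: "finite G" using G finite_subset by blast
  show "(\<Sum>i\<in>G. b i *\<^sub>R f i) \<in> dual_space Y" by (rule f_comb_dual)
  show "0 \<le> K * dual_norm Y (\<Sum>i<n. b i *\<^sub>R f i)"
    using K1 dual_norm_nonneg[OF subspace_Y f_comb_dual[of b "\<lambda>i. i" "{..<n}"]] by simp
  fix m :: nat and a :: "nat \<Rightarrow> real"
  have "(\<Sum>i\<in>G. b i *\<^sub>R f i) (\<Sum>j<m. a j *\<^sub>R z j) = (\<Sum>i\<in>G. b i * (if i \<in> {..<m} then a i else 0))"
    by (rule f_comb_apply) (use fG in auto)
  also have "\<dots> = (\<Sum>i<n. b i * (if i \<in> G \<inter> {..<m} then a i else 0))"
    using G by (intro sum.mono_neutral_cong_left) auto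
  also have "\<dots> = (\<Sum>i<n. b i *\<^sub>R f i) (\<Sum>j\<in>G \<inter> {..<m}. a j *\<^sub>R z j)"
    by (rule f_comb_apply[symmetric]) (use fG in auto)
  finally have "\<bar>(\<Sum>i\<in>G. b i *\<^sub>R f i) (\<Sum>j<m. a j *\<^sub>R z j)\<bar>
      \<le> dual_norm Y (\<Sum>i<n. b i *\<^sub>R f i) * norm (\<Sum>j\<in>G \<inter> {..<m}. a j *\<^sub>R z j)"
    using f_comb_bound[of b "\<lambda>i. i" "{..<n}" a "G \<inter> {..<m}"] by simp
  also have "\<dots> \<le> dual_norm Y (\<Sum>i<n. b i *\<^sub>R f i) * (K * norm (\<Sum>j<m. a j *\<^sub>R z j))"
    by (rule mult_left_mono[OF proj dual_norm_nonneg[OF subspace_Y f_comb_dual]])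
  finally show "\<bar>(\<Sum>i\<in>G. b i *\<^sub>R f i) (\<Sum>j<m. a j *\<^sub>R z j)\<bar>
      \<le> K * dual_norm Y (\<Sum>i<n. b i *\<^sub>R f i) * norm (\<Sum>j<m. a j *\<^sub>R z j)" by (simp add: ac_simps)
qed

text \<open>The norm dual to \<open>S\<close> on finitely supported sequences under the coordinate
  pairing. Up to constants it is the norm of \<open>f\<close> on Schreier supports. Not to be
  confused with the constant \<open>D\<close> of \<open>tensor_blocks\<close>.\<close>

definition D where "D b = Sup {\<bar>\<Sum>i\<in>{i. b i \<noteq> 0}. a i * b i\<bar> | a. finite {i. a i \<noteq> 0} \<and> S a \<le> 1}"

lemma S_coeff:
  assumes "finite {i. a i \<noteq> 0}"
  shows "\<bar>a i\<bar> \<le> (2 * K * C ^ 2 / S (trunc 1 (\<lambda>_. 1))) * S a"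
proof -
  obtain n where n: "\<And>i. n \<le> i \<Longrightarrow> a i = 0" using finite_supp_bounded[OF assms] by blast
  have "trunc (n + Suc i) a = a" by (rule trunc_eq_self) (use n in auto)
  then have "\<bar>a i\<bar> * S (trunc 1 (\<lambda>_. 1)) \<le> 2 * K * C ^ 2 * S a" using T_coeff[of i "n + Suc i" a] by simp
  then show ?thesis using T_pos by (simp add: field_simps)
qed

lemma D_pairing:
  assumes b: "finite {i. b i \<noteq> 0}" and a: "finite {i. a i \<noteq> 0}"
  shows "\<bar>\<Sum>i\<in>{i. b i \<noteq> 0}. a i * b i\<bar> \<le> D b * S a"
proof -
  define c where "c = 2 * K * C ^ 2 / S (trunc 1 (\<lambda>_. 1))"
  have c0: "0 \<le> c" using K1 C1 T_pos by (simp add: c_def)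
  have S0: "0 \<le> S a" by (rule c00_seminorm_nonneg[OF T a])
  have bdd: "bdd_above {\<bar>\<Sum>i\<in>{i. b i \<noteq> 0}. a i * b i\<bar> | a. finite {i. a i \<noteq> 0} \<and> S a \<le> 1}"
  proof (rule bdd_aboveI)
    fix r assume "r \<in> {\<bar>\<Sum>i\<in>{i. b i \<noteq> 0}. a i * b i\<bar> | a. finite {i. a i \<noteq> 0} \<and> S a \<le> 1}"
    then obtain a where a: "r = \<bar>\<Sum>i\<in>{i. b i \<noteq> 0}. a i * b i\<bar>" "finite {i. a i \<noteq> 0}" "S a \<le> 1" by blast
    have "\<bar>a i\<bar> \<le> c" for i
      using S_coeff[OF a(2), of i] mult_left_mono[OF a(3) c0] by (simp add: c_def)
    then have "r \<le> (\<Sum>i\<in>{i. b i \<noteq> 0}. c * \<bar>b i\<bar>)"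
      unfolding a(1) by (intro order_trans[OF sum_abs] sum_mono) (auto simp: abs_mult intro: mult_right_mono)
    then show "r \<le> (\<Sum>i\<in>{i. b i \<noteq> 0}. c * \<bar>b i\<bar>)" .
  qed
  show ?thesis
  proof (cases "S a = 0")
    case True
    then have "a i = 0" for i using S_coeff[OF a, of i] by simp
    then show ?thesis using True by simp
  next
    case False
    define t where "t = 1 / S a"
    have t: "0 < t" using S0 False by (simp add: t_def)
    have ft: "finite {i. t * a i \<noteq> 0}" using a t by simp
    have "S (\<lambda>i. t * a i) = \<bar>t\<bar> * S a" using T a unfolding c00_seminorm_def by blast
    then have "S (\<lambda>i. t * a i) \<le> 1" using t False by (simp add: t_def)
    then have "\<bar>\<Sum>i\<in>{i. b i \<noteq> 0}. (t * a i) * b i\<bar> \<le> D b"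
      unfolding D_def using ft by (intro cSup_upper bdd CollectI exI[of _ "\<lambda>i. t * a i"] conjI) auto
    moreover have "(\<Sum>i\<in>{i. b i \<noteq> 0}. (t * a i) * b i) = t * (\<Sum>i\<in>{i. b i \<noteq> 0}. a i * b i)"
      by (simp add: sum_distrib_left mult.assoc)
    ultimately have "t * \<bar>\<Sum>i\<in>{i. b i \<noteq> 0}. a i * b i\<bar> \<le> D b" using t by (simp add: abs_mult)
    then show ?thesis using S0 False by (simp add: t_def field_simps)
  qed
qed

lemma D_le:
  assumes B: "0 \<le> B" "\<And>a. finite {i. a i \<noteq> 0} \<Longrightarrow> \<bar>\<Sum>i\<in>{i. b i \<noteq> 0}. a i * b i\<bar> \<le> B * S a"
  shows "D b \<le> B"
  unfolding D_def
proof (rule cSup_least)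
  have "S (\<lambda>_. 0) \<le> 1" using T_zero[of 0] by (simp add: trunc_def)
  then have "\<bar>\<Sum>i\<in>{i. b i \<noteq> 0}. (\<lambda>_. 0) i * b i\<bar> \<in> {\<bar>\<Sum>i\<in>{i. b i \<noteq> 0}. a i * b i\<bar> | a. finite {i. a i \<noteq> 0} \<and> S a \<le> 1}"
    by (intro CollectI exI[of _ "\<lambda>_. 0"]) auto
  then show "{\<bar>\<Sum>i\<in>{i. b i \<noteq> 0}. a i * b i\<bar> | a. finite {i. a i \<noteq> 0} \<and> S a \<le> 1} \<noteq> {}" by blast
  fix r assume "r \<in> {\<bar>\<Sum>i\<in>{i. b i \<noteq> 0}. a i * b i\<bar> | a. finite {i. a i \<noteq> 0} \<and> S a \<le> 1}"
  then obtain a where a: "r = \<bar>\<Sum>i\<in>{i. b i \<noteq> 0}. a i * b i\<bar>" "finite {i. a i \<noteq> 0}" "S a \<le> 1" by blast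
  have "r \<le> B * S a" unfolding a(1) by (rule B(2)[OF a(2)])
  also have "\<dots> \<le> B * 1" by (rule mult_left_mono[OF a(3) B(1)])
  finally show "r \<le> B" by simp
qed

lemma sum_supp:
  fixes b :: "nat \<Rightarrow> real"
  assumes "\<And>i. n \<le> i \<Longrightarrow> b i = 0"
  shows "(\<Sum>i\<in>{i. b i \<noteq> 0}. a i * b i) = (\<Sum>i<n. a i * b i)"
proof (rule sum.mono_neutral_left)
  show "{i. b i \<noteq> 0} \<subseteq> {..<n}" using assms by (metis (mono_tags) lessThan_iff mem_Collect_eq not_le subsetI)
qed auto

lemma sum_supp_trunc: "(\<Sum>i\<in>{i. trunc n b i \<noteq> 0}. a i * trunc n b i) = (\<Sum>i<n. a i * b i)"
  by (subst sum_supp[of n]) (auto simp: trunc_def)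

lemma D_pairing_trunc: "\<bar>\<Sum>i<n. a i * b i\<bar> \<le> D (trunc n b) * S (trunc n a)"
proof -
  have "(\<Sum>i<n. trunc n a i * b i) = (\<Sum>i<n. a i * b i)" by (rule sum.cong) (auto simp: trunc_def)
  then show ?thesis using D_pairing[of "trunc n b" "trunc n a"] by (simp add: sum_supp_trunc)
qed

text \<open>Test vectors may be cut off after \<open>n\<close> coordinates, at the price of the
  truncation constant of \<open>S\<close>.\<close>

lemma D_le_trunc:
  assumes B: "0 \<le> B" "\<And>a. \<bar>\<Sum>i<n. a i * b i\<bar> \<le> B * S (trunc n a)"
  shows "D (trunc n b) \<le> (2 * K * C ^ 2) * B"
proof (rule D_le)
  show "0 \<le> (2 * K * C ^ 2) * B" using B(1) K1 by simp
  fix a :: "nat \<Rightarrow> real" assume a: "finite {i. a i \<noteq> 0}"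
  have "\<bar>\<Sum>i\<in>{i. trunc n b i \<noteq> 0}. a i * trunc n b i\<bar> \<le> B * S (trunc n a)"
    unfolding sum_supp_trunc by (rule B(2))
  also have "\<dots> \<le> B * (2 * K * C ^ 2 * S a)" by (rule mult_left_mono[OF T_trunc_le[OF a] B(1)])
  finally show "\<bar>\<Sum>i\<in>{i. trunc n b i \<noteq> 0}. a i * trunc n b i\<bar> \<le> (2 * K * C ^ 2) * B * S a"
    by (simp add: ac_simps)
qed

lemma D_nonneg: "finite {i. b i \<noteq> 0} \<Longrightarrow> 0 \<le> D b"
proof -
  assume b: "finite {i. b i \<noteq> 0}"
  have "0 \<le> D b * S (trunc 1 (\<lambda>_. 1))" using D_pairing[OF b, of "trunc 1 (\<lambda>_. 1)"] by simp
  then show ?thesis using T_pos by (simp add: zero_le_mult_iff)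
qed

lemma D_seminorm: "c00_seminorm D"
  unfolding c00_seminorm_def
proof (intro conjI allI impI)
  fix b b' :: "nat \<Rightarrow> real" assume b: "finite {i. b i \<noteq> 0}" "finite {i. b' i \<noteq> 0}"
  obtain n n' where n: "\<And>i. n \<le> i \<Longrightarrow> b i = 0" "\<And>i. n' \<le> i \<Longrightarrow> b' i = 0"
    using finite_supp_bounded[OF b(1)] finite_supp_bounded[OF b(2)] by metis
  define q where "q = max n n'"
  have q: "\<And>i. q \<le> i \<Longrightarrow> b i = 0" "\<And>i. q \<le> i \<Longrightarrow> b' i = 0" using n by (auto simp: q_def)
  show "D (\<lambda>i. b i + b' i) \<le> D b + D b'"
  proof (rule D_le)
    show "0 \<le> D b + D b'" using D_nonneg b by simp
    fix a :: "nat \<Rightarrow> real" assume a: "finite {i. a i \<noteq> 0}"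
    have "(\<Sum>i\<in>{i. b i + b' i \<noteq> 0}. a i * (b i + b' i)) = (\<Sum>i<q. a i * (b i + b' i))"
      by (rule sum_supp) (use q in auto)
    also have "\<dots> = (\<Sum>i\<in>{i. b i \<noteq> 0}. a i * b i) + (\<Sum>i\<in>{i. b' i \<noteq> 0}. a i * b' i)"
      using sum_supp[of q b a] sum_supp[of q b' a] q by (simp add: distrib_left sum.distrib)
    finally show "\<bar>\<Sum>i\<in>{i. b i + b' i \<noteq> 0}. a i * (b i + b' i)\<bar> \<le> (D b + D b') * S a"
      using D_pairing[OF b(1) a] D_pairing[OF b(2) a] unfolding distrib_right by linarith
  qed
next
  have le: "D (\<lambda>i. c * b i) \<le> \<bar>c\<bar> * D b" if b: "finite {i. b i \<noteq> 0}" for b and c :: real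
  proof (rule D_le)
    show "0 \<le> \<bar>c\<bar> * D b" using D_nonneg[OF b] by simp
    fix a :: "nat \<Rightarrow> real" assume a: "finite {i. a i \<noteq> 0}"
    have "(\<Sum>i\<in>{i. c * b i \<noteq> 0}. a i * (c * b i)) = (\<Sum>i\<in>{i. b i \<noteq> 0}. a i * (c * b i))"
      by (rule sum.mono_neutral_left) (use b in auto)
    also have "\<dots> = c * (\<Sum>i\<in>{i. b i \<noteq> 0}. a i * b i)" by (simp add: sum_distrib_left ac_simps)
    finally show "\<bar>\<Sum>i\<in>{i. c * b i \<noteq> 0}. a i * (c * b i)\<bar> \<le> \<bar>c\<bar> * D b * S a"
      using mult_left_mono[OF D_pairing[OF b a], of "\<bar>c\<bar>"] by (simp add: abs_mult mult.assoc)
  qed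
  fix b :: "nat \<Rightarrow> real" and c :: real assume b: "finite {i. b i \<noteq> 0}"
  show "D (\<lambda>i. c * b i) = \<bar>c\<bar> * D b"
  proof (cases "c = 0")
    case True
    then show ?thesis using le[OF b, of 0] D_nonneg[of "\<lambda>i. c * b i"] by simp
  next
    case False
    have "finite {i. c * b i \<noteq> 0}" using b False by simp
    from le[OF this, of "1 / c"] have "D b \<le> \<bar>1 / c\<bar> * D (\<lambda>i. c * b i)" using False by simp
    then have "\<bar>c\<bar> * D b \<le> D (\<lambda>i. c * b i)" using False by (simp add: field_simps)
    then show ?thesis using le[OF b, of c] by simp
  qed
qed

lemma K_C_le: "K * C \<le> 2 * K * C ^ 3"
proof -
  have "C * 1 \<le> C * C ^ 2" using C1 by (intro mult_left_mono one_le_power) auto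
  then have "K * C \<le> K * C ^ 3" using K1 by (simp add: power3_eq_cube power2_eq_square)
  moreover have "0 \<le> K * C ^ 3" using K1 C1 by simp
  ultimately show ?thesis by linarith
qed

text \<open>The functional is tested on combinations of the same \<open>z (k i)\<close>, whose norms
  \<open>S\<close> controls from above.\<close>

lemma f_lower:
  assumes k: "strict_mono_on {..<n} k" "0 < n \<longrightarrow> n \<le> k 0"
  shows "D (trunc n b) \<le> (2 * K * C ^ 3) * dual_norm Y (\<Sum>i<n. b i *\<^sub>R f (k i))"
proof -
  define X where "X = dual_norm Y (\<Sum>i<n. b i *\<^sub>R f (k i))"
  have X0: "0 \<le> X" unfolding X_def by (rule dual_norm_nonneg[OF subspace_Y f_comb_dual])
  have inj: "inj_on k {..<n}" by (rule strict_mono_on_imp_inj_on[OF k(1)])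
  have "D (trunc n b) \<le> (2 * K * C ^ 2) * (C * X)"
  proof (rule D_le_trunc)
    show "0 \<le> C * X" using X0 C1 by simp
    fix a :: "nat \<Rightarrow> real"
    define a' where "a' = (\<lambda>r. a (inv_into {..<n} k r))"
    have a': "a' (k i) = a i" if "i < n" for i using inv_into_f_f[OF inj] that by (simp add: a'_def)
    have v: "(\<Sum>r\<in>k ` {..<n}. a' r *\<^sub>R z r) = (\<Sum>i<n. a i *\<^sub>R z (k i))"
      by (subst sum.reindex[OF inj]) (simp add: a')
    have "(\<Sum>i<n. b i *\<^sub>R f (k i)) (\<Sum>r\<in>k ` {..<n}. a' r *\<^sub>R z r)
        = (\<Sum>i<n. b i * (if k i \<in> k ` {..<n} then a' (k i) else 0))"
      by (rule f_comb_apply) auto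
    also have "\<dots> = (\<Sum>i<n. a i * b i)" by (rule sum.cong) (auto simp: a')
    finally have "\<bar>\<Sum>i<n. a i * b i\<bar> \<le> X * norm (\<Sum>i<n. a i *\<^sub>R z (k i))"
      using f_comb_bound[of b k "{..<n}" a' "k ` {..<n}"] by (simp add: X_def v)
    also have "\<dots> \<le> X * (C * S (trunc n a))" by (rule mult_left_mono[OF T_upper[OF k] X0])
    finally show "\<bar>\<Sum>i<n. a i * b i\<bar> \<le> C * X * S (trunc n a)" by (simp add: ac_simps)
  qed
  then show ?thesis by (simp add: X_def power3_eq_cube power2_eq_square ac_simps)
qed

text \<open>A general vector is first restricted to the positions \<open>k i\<close>; bounding this
  restriction is where Schreier unconditionality of \<open>z\<close> enters the dual. The argument
  gives \<open>K * C\<close>, enlarged so that one constant serves both estimates.\<close>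

lemma f_upper:
  assumes k: "strict_mono_on {..<n} k" "0 < n \<longrightarrow> n \<le> k 0"
  shows "dual_norm Y (\<Sum>i<n. b i *\<^sub>R f (k i)) \<le> (2 * K * C ^ 3) * D (trunc n b)"
proof -
  have D0: "0 \<le> D (trunc n b)" by (rule D_nonneg) simp
  have inj: "inj_on k {..<n}" by (rule strict_mono_on_imp_inj_on[OF k(1)])
  have "dual_norm Y (\<Sum>i<n. b i *\<^sub>R f (k i)) \<le> (K * C) * D (trunc n b)"
  proof (rule dual_norm_le_dense[OF f_comb_dual])
    show "0 \<le> (K * C) * D (trunc n b)" using D0 K1 C1 by simp
    fix m :: nat and a :: "nat \<Rightarrow> real"
    define R where "R = max m (Suc (Max (insert 0 (k ` {..<n}))))"
    have kR: "k i < R" if "i < n" for i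
      unfolding R_def less_max_iff_disj less_Suc_eq_le using that by (intro disjI2 Max_ge) auto
    have y: "(\<Sum>j<R. trunc m a j *\<^sub>R z j) = (\<Sum>j<m. a j *\<^sub>R z j)"
      by (rule sum.mono_neutral_cong_right) (auto simp: trunc_def R_def)
    have "(\<Sum>i<n. b i *\<^sub>R f (k i)) (\<Sum>j<m. a j *\<^sub>R z j) = (\<Sum>i<n. b i * (if k i \<in> {..<m} then a (k i) else 0))"
      by (rule f_comb_apply) auto
    also have "\<dots> = (\<Sum>i<n. trunc m a (k i) * b i)" by (rule sum.cong) (auto simp: trunc_def)
    finally have "\<bar>(\<Sum>i<n. b i *\<^sub>R f (k i)) (\<Sum>j<m. a j *\<^sub>R z j)\<bar> \<le> D (trunc n b) * S (trunc n (\<lambda>i. trunc m a (k i)))"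
      using D_pairing_trunc[of "\<lambda>i. trunc m a (k i)" b n] by simp
    also have "\<dots> \<le> D (trunc n b) * (C * norm (\<Sum>i<n. trunc m a (k i) *\<^sub>R z (k i)))"
      by (rule mult_left_mono[OF T_lower[OF k] D0])
    also have "(\<Sum>i<n. trunc m a (k i) *\<^sub>R z (k i)) = (\<Sum>r\<in>k ` {..<n}. trunc m a r *\<^sub>R z r)"
      by (simp add: sum.reindex[OF inj])
    also have "D (trunc n b) * (C * norm (\<Sum>r\<in>k ` {..<n}. trunc m a r *\<^sub>R z r))
        \<le> D (trunc n b) * (C * (K * norm (\<Sum>r<R. trunc m a r *\<^sub>R z r)))"
    proof (rule mult_left_mono[OF mult_left_mono D0])
      show "norm (\<Sum>r\<in>k ` {..<n}. trunc m a r *\<^sub>R z r) \<le> K * norm (\<Sum>r<R. trunc m a r *\<^sub>R z r)"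
      proof (rule proj_schreier)
        show "k ` {..<n} \<subseteq> {..<R}" using kR by auto
        fix r assume "r \<in> k ` {..<n}"
        then obtain i where i: "i < n" "r = k i" by auto
        have "card (k ` {..<n}) = n" using card_image[OF inj] by simp
        also have "n \<le> k i" using k(2) i strict_mono_onD[OF k(1), of 0 i] by (cases "i = 0") auto
        finally show "card (k ` {..<n}) \<le> r" using i by simp
      qed
    qed (use C1 in simp)
    finally show "\<bar>(\<Sum>i<n. b i *\<^sub>R f (k i)) (\<Sum>j<m. a j *\<^sub>R z j)\<bar> \<le> K * C * D (trunc n b) * norm (\<Sum>j<m. a j *\<^sub>R z j)"
      by (simp add: y ac_simps)
  qed
  also have "\<dots> \<le> (2 * K * C ^ 3) * D (trunc n b)" by (rule mult_right_mono[OF K_C_le D0])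
  finally show ?thesis .
qed

text \<open>Makes what is proved for \<open>schreier_seq\<close>, in particular
  \<open>submultiplicative\<close>, available in the dual.\<close>

lemma dual_schreier_seq: "schreier_seq (dual_space Y) (dual_norm Y) f K (2 * K * C ^ 3) D"
proof
  show "dual.basis_const f K"
    unfolding dual.basis_const_def
  proof (intro conjI allI impI)
    show "f i \<in> dual_space Y" for i by (rule f_dual)
    fix b :: "nat \<Rightarrow> real" and t n :: nat assume tn: "t \<le> n"
    show "dual_norm Y (\<Sum>i<t. b i *\<^sub>R f i) \<le> K * dual_norm Y (\<Sum>i<n. b i *\<^sub>R f i)"
    proof (rule f_projection)
      show "norm (\<Sum>j\<in>{..<t} \<inter> {..<m}. a j *\<^sub>R z j) \<le> K * norm (\<Sum>j<m. a j *\<^sub>R z j)" for m a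
      proof -
        have "{..<t} \<inter> {..<m} = {..<min t m}" by auto
        then show ?thesis using basis_constD(2)[OF u_basis, of "min t m" m a] by simp
      qed
    qed (use tn in auto)
  qed
  show "dual_norm Y (\<Sum>i\<in>G. b i *\<^sub>R f i) \<le> K * dual_norm Y (\<Sum>i<n. b i *\<^sub>R f i)"
    if G: "G \<subseteq> {..<n}" and cG: "\<And>i. i \<in> G \<Longrightarrow> card G \<le> i" for b G n
  proof (rule f_projection[OF G])
    show "norm (\<Sum>j\<in>G \<inter> {..<m}. a j *\<^sub>R z j) \<le> K * norm (\<Sum>j<m. a j *\<^sub>R z j)" for m a
    proof (rule proj_schreier)
      have "card (G \<inter> {..<m}) \<le> card G" using finite_subset[OF G] by (intro card_mono) auto
      then show "card (G \<inter> {..<m}) \<le> i" if "i \<in> G \<inter> {..<m}" for i using cG[of i] that by simp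
    qed simp
  qed
  show "c00_seminorm D" by (rule D_seminorm)
  show "1 \<le> K" by (rule K1)
  have "1 * 1 \<le> K * C ^ 3" using C1 K1 by (intro mult_mono one_le_power) auto
  then show "1 \<le> 2 * K * C ^ 3" by linarith
  have "\<bar>\<Sum>i<1::nat. 1 * 1 :: real\<bar> \<le> D (trunc 1 (\<lambda>_. 1)) * S (trunc 1 (\<lambda>_. 1))"
    using D_pairing_trunc[of "\<lambda>_. 1" "\<lambda>_. 1" 1] .
  then have "0 < D (trunc 1 (\<lambda>_. 1)) * S (trunc 1 (\<lambda>_. 1))" by simp
  then show "0 < D (trunc 1 (\<lambda>_. 1))" using T_pos by (simp add: zero_less_mult_iff)
qed (use f_lower f_upper in auto)

end

section \<open>Weak nullness of the functionals and the reverse tensor inequality\<close>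

context schreier_basis
begin

text \<open>If an element of the bidual stays away from 0 on infinitely many \<open>f n\<close>,
  then \<open>D\<close> of (1, ..., 1) grows linearly. By duality some vector of length
  \<open>n\<close> has a positive proportion of its coordinates comparable to its
  \<open>S\<close>-norm, and unconditionality then bounds \<open>S\<close> on their indicator. Hence
  \<open>S\<close> of (1, ..., 1) would be bounded.\<close>

lemma dual_weakly_null:
  assumes unb: "\<And>B. \<exists>n. B < S (trunc n (\<lambda>_. 1))"
  shows "weakly_null (dual_space Y) (dual_norm Y) f"
  unfolding weakly_null_def
proof (intro conjI allI impI, rule f_dual, rule ccontr)
  fix \<Phi> assume \<Phi>: "bdd_lin_functional (dual_space Y) (dual_norm Y) \<Phi>" and neg: "\<not> (\<lambda>n. \<Phi> (f n)) \<longlonglongrightarrow> 0"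
  interpret dual: schreier_seq "dual_space Y" "dual_norm Y" f K "2 * K * C ^ 3" D by (rule dual_schreier_seq)
  obtain B where B: "0 < B" "\<And>g. g \<in> dual_space Y \<Longrightarrow> \<bar>\<Phi> g\<bar> \<le> B * dual_norm Y g"
  proof -
    obtain B where *: "\<forall>g\<in>dual_space Y. \<bar>\<Phi> g\<bar> \<le> B * dual_norm Y g"
      using \<Phi> unfolding bdd_lin_functional_def by blast
    have "\<bar>\<Phi> g\<bar> \<le> (\<bar>B\<bar> + 1) * dual_norm Y g" if g: "g \<in> dual_space Y" for g
    proof -
      have "B * dual_norm Y g \<le> (\<bar>B\<bar> + 1) * dual_norm Y g"
        by (rule mult_right_mono[OF _ dual_norm_nonneg[OF subspace_Y g]]) simp
      then show ?thesis using * g by fastforce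
    qed
    then show ?thesis using that[of "\<bar>B\<bar> + 1"] by simp
  qed
  obtain e where e: "0 < e" "\<And>n0. \<exists>n\<ge>n0. e \<le> \<bar>\<Phi> (f n)\<bar>"
    using neg unfolding LIMSEQ_def by (auto simp: dist_real_def not_less)
  define J where "J = {n. e \<le> \<bar>\<Phi> (f n)\<bar>}"
  have "infinite J" unfolding infinite_nat_iff_unbounded_le J_def using e(2) by blast
  \<comment> \<open>The denominator collects the bound of \<open>\<Phi>\<close>, the constant of
    \<open>f_upper\<close>, and the unconditional constant of \<open>D\<close> that removes the
    signs \<open>s\<close>.\<close>
  define \<delta> where "\<delta> = e / (B * (2 * K * C ^ 3) * (2 * K * (2 * K * C ^ 3) ^ 2))"
  have C'0: "0 < 2 * K * C ^ 3" using K1 C1 by simp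
  have den0: "0 < B * (2 * K * C ^ 3) * (2 * K * (2 * K * C ^ 3) ^ 2)"
    by (intro mult_pos_pos[OF mult_pos_pos[OF B(1) C'0]] mult_pos_pos[OF _ zero_less_power[OF C'0]]) (use K1 in simp)
  have \<delta>0: "0 < \<delta>" unfolding \<delta>_def by (rule divide_pos_pos[OF e(1) den0])
  have Dbig: "\<delta> * n \<le> D (trunc n (\<lambda>_. 1))" for n
  proof -
    define J' where "J' = J \<inter> {n..}"
    have "infinite J'"
    proof
      assume "finite J'"
      moreover have "J \<subseteq> J' \<union> {..<n}" by (auto simp: J'_def)
      ultimately show False using \<open>infinite J\<close> finite_subset by blast
    qed
    define k where "k = enumerate J'"
    have k: "strict_mono_on {..<n} k" "0 < n \<longrightarrow> n \<le> k 0"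
      and kJ: "k i \<in> J'" for i
      using strict_mono_enumerate[OF \<open>infinite J'\<close>] enumerate_in_set[OF \<open>infinite J'\<close>]
      by (auto simp: k_def strict_mono_on_def strict_mono_def J'_def)
    define s where "s = (\<lambda>i. sgn (\<Phi> (f (k i))))"
    have "e * n = (\<Sum>i<n. e)" by simp
    also have "\<dots> \<le> (\<Sum>i<n. s i * \<Phi> (f (k i)))"
      by (rule sum_mono) (use kJ in \<open>auto simp: s_def J'_def J_def simp flip: abs_sgn mult.commute\<close>)
    also have "\<dots> = \<Phi> (\<Sum>i<n. s i *\<^sub>R f (k i))"
      by (rule bdd_lin_functional_sum[OF \<Phi> dual.subspace_V f_dual, symmetric]) simp
    also have "\<dots> \<le> B * dual_norm Y (\<Sum>i<n. s i *\<^sub>R f (k i))"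
      using B(2)[OF f_comb_dual[of s k "{..<n}"]] by simp
    also have "\<dots> \<le> B * ((2 * K * C ^ 3) * D (trunc n s))"
      using B(1) by (intro mult_left_mono f_upper[OF k]) simp
    also have "\<dots> \<le> B * ((2 * K * C ^ 3) * ((2 * K * (2 * K * C ^ 3) ^ 2) * D (trunc n (\<lambda>_. 1))))"
      using B(1) C'0 by (intro mult_left_mono dual.T_unconditional) (auto simp: s_def sgn_if)
    finally have "e * n \<le> (B * (2 * K * C ^ 3) * (2 * K * (2 * K * C ^ 3) ^ 2)) * D (trunc n (\<lambda>_. 1))"
      by (simp only: mult.assoc)
    then show ?thesis unfolding \<delta>_def times_divide_eq_left pos_divide_le_eq[OF den0] by (simp only: mult.commute)
  qed
  define c where "c = 2 * K * C ^ 2 / S (trunc 1 (\<lambda>_. 1))"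
  have c0: "0 < c" using K1 C1 T_pos by (simp add: c_def)
  define L where "L = 2 * K * C ^ 2"
  have L0: "0 < L" using K1 C1 by (simp add: L_def)
  have bounded: "S (trunc p (\<lambda>_. 1)) \<le> L * (C ^ 2 * (L * (L * (4 / \<delta>))))" for p
  proof -
    \<comment> \<open>The large coordinates found below are at least a proportion
      \<open>\<delta> / (4 * c)\<close> of all; \<open>n\<close> is chosen so that they number at
      least \<open>p\<close>.\<close>
    obtain n where n: "real p * (4 * c / \<delta>) < real n" using reals_Archimedean2 by blast
    have "0 \<le> real p * (4 * c / \<delta>)" using c0 \<delta>0 by simp
    then have n0: "0 < real n" using n by linarith
    have "\<exists>a. finite {i. a i \<noteq> 0} \<and> (\<delta> / 2 * n) * S a < \<bar>\<Sum>i\<in>{i. trunc n (\<lambda>_. 1) i \<noteq> 0}. a i * trunc n (\<lambda>_. 1) i\<bar>"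
    proof (rule ccontr)
      assume "\<not> ?thesis"
      then have "D (trunc n (\<lambda>_. 1)) \<le> \<delta> / 2 * n" using \<delta>0 by (intro D_le) (auto simp: not_less)
      then have "\<delta> * n \<le> \<delta> / 2 * n" using Dbig[of n] by linarith
      then show False using \<delta>0 n0 by simp
    qed
    then obtain a where a: "finite {i. a i \<noteq> 0}" "(\<delta> / 2 * n) * S a < \<bar>\<Sum>i<n. a i\<bar>"
      unfolding sum_supp_trunc by auto
    have S0: "0 \<le> S a" by (rule c00_seminorm_nonneg[OF T a(1)])
    \<comment> \<open>Coordinates below the threshold account for at most half of the lower bound on
      the sum, and no coordinate exceeds \<open>c * S a\<close>; so \<open>J\<close> must be
      large.\<close>
    define J where "J = {i. i < n \<and> \<delta> / 4 * S a \<le> \<bar>a i\<bar>}"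
    have finJ: "finite J" "J \<subseteq> {..<n}" by (auto simp: J_def)
    have Spos: "0 < S a"
    proof (rule ccontr)
      assume "\<not> 0 < S a"
      then have "S a = 0" using S0 by simp
      then have "a i = 0" for i using S_coeff[OF a(1), of i] by simp
      then show False using a(2) \<open>S a = 0\<close> by simp
    qed
    have "(\<delta> / 2 * n) * S a < (\<Sum>i<n. \<bar>a i\<bar>)" using a(2) sum_abs[of a "{..<n}"] by linarith
    also have "(\<Sum>i<n. \<bar>a i\<bar>) = (\<Sum>i\<in>J. \<bar>a i\<bar>) + (\<Sum>i\<in>{..<n} - J. \<bar>a i\<bar>)"
      using sum.subset_diff[OF finJ(2), of "\<lambda>i. \<bar>a i\<bar>"] by simp
    also have "\<dots> \<le> (\<Sum>i\<in>J. c * S a) + (\<Sum>i\<in>{..<n} - J. \<delta> / 4 * S a)"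
    proof (rule add_mono)
      show "(\<Sum>i\<in>J. \<bar>a i\<bar>) \<le> (\<Sum>i\<in>J. c * S a)" unfolding c_def by (rule sum_mono, rule S_coeff[OF a(1)])
      show "(\<Sum>i\<in>{..<n} - J. \<bar>a i\<bar>) \<le> (\<Sum>i\<in>{..<n} - J. \<delta> / 4 * S a)" by (rule sum_mono) (auto simp: J_def)
    qed
    also have "\<dots> \<le> card J * (c * S a) + n * (\<delta> / 4 * S a)"
    proof -
      have "card ({..<n} - J) \<le> n" using card_mono[of "{..<n}" "{..<n} - J"] by simp
      then have "real (card ({..<n} - J)) * (\<delta> / 4 * S a) \<le> real n * (\<delta> / 4 * S a)"
        using \<delta>0 S0 by (intro mult_right_mono) auto
      then show ?thesis by simp
    qed
    finally have "\<delta> / 4 * n * S a < (card J * c) * S a" by (simp add: algebra_simps)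
    then have "\<delta> / 4 * n < card J * c" using Spos by simp
    then have "real n < card J * (4 * c / \<delta>)" using \<delta>0 by (simp add: field_simps)
    then have "real p * (4 * c / \<delta>) < card J * (4 * c / \<delta>)" using n by linarith
    moreover have "0 < 4 * c / \<delta>" using c0 \<delta>0 by simp
    ultimately have pJ: "p \<le> card J" using mult_less_cancel_right_pos by fastforce
    have "S (trunc n (indicator J)) \<le> L * S (trunc n (\<lambda>i. (4 / (\<delta> * S a)) * a i))"
      unfolding L_def
    proof (rule T_unconditional)
      fix i
      show "\<bar>indicator J i :: real\<bar> \<le> \<bar>4 / (\<delta> * S a) * a i\<bar>"
      proof (cases "i \<in> J")
        case True
        then have "\<delta> / 4 * S a \<le> \<bar>a i\<bar>" by (simp add: J_def)
        then have "1 \<le> 4 / (\<delta> * S a) * \<bar>a i\<bar>" using \<delta>0 Spos by (simp add: field_simps)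
        then show ?thesis using True \<delta>0 Spos by (simp add: abs_mult)
      qed simp
    qed
    also have "\<dots> = L * (4 / (\<delta> * S a) * S (trunc n a))"
      using c00_seminormD(2)[OF T, of n "4 / (\<delta> * S a)" a] \<delta>0 Spos by simp
    also have "\<dots> \<le> L * (4 / (\<delta> * S a) * (L * S a))"
      unfolding L_def using T_trunc_le[OF a(1), of n] \<delta>0 Spos K1 C1 by (intro mult_left_mono) auto
    also have "\<dots> = L * (L * (4 / \<delta>))" using Spos by simp
    finally have ind: "S (trunc n (indicator J)) \<le> L * (L * (4 / \<delta>))" .
    have "S (trunc p (\<lambda>_. 1)) \<le> L * S (trunc (card J) (\<lambda>_. 1))" unfolding L_def by (rule T_ones_mono[OF pJ])
    also have "\<dots> \<le> L * (C ^ 2 * S (trunc n (indicator J)))"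
      using L0 by (intro mult_left_mono T_indicator(1)[OF finJ(2)]) simp
    also have "\<dots> \<le> L * (C ^ 2 * (L * (L * (4 / \<delta>))))"
      using L0 ind by (intro mult_left_mono) auto
    finally show ?thesis .
  qed
  then show False using unb by (meson not_le)
qed

text \<open>A Hahn-Banach functional norming the combination of the \<open>z (n + i)\<close> is read
  off on these vectors; its values almost norm \<open>a\<close> for the pairing of \<open>S\<close>
  and \<open>D\<close>.\<close>

lemma dual_norming:
  obtains g where "D (trunc n g) \<le> 2 * K * C ^ 3" "S (trunc n a) \<le> C * (\<Sum>i<n. a i * g i)"
proof -
  obtain G where G: "linear G" "\<And>w. \<bar>G w\<bar> \<le> norm w"
    "G (\<Sum>i<n. a i *\<^sub>R z (n + i)) = norm (\<Sum>i<n. a i *\<^sub>R z (n + i))"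
    using norming_functional[of "\<Sum>i<n. a i *\<^sub>R z (n + i)"] by blast
  define g where "g = (\<lambda>i. G (z (n + i)))"
  have k: "strict_mono_on {..<n} (\<lambda>i. n + i)" "0 < n \<longrightarrow> n \<le> n + 0" by (auto simp: strict_mono_on_def)
  have Gs: "G (\<Sum>i<n. c i *\<^sub>R z (n + i)) = (\<Sum>i<n. c i * g i)" for c
    by (simp add: linear_sum[OF G(1)] linear_scale[OF G(1)] g_def)
  have "D (trunc n g) \<le> (2 * K * C ^ 2) * C"
  proof (rule D_le_trunc)
    show "0 \<le> C" using C1 by simp
    show "\<bar>\<Sum>i<n. c i * g i\<bar> \<le> C * S (trunc n c)" for c
      unfolding Gs[symmetric] by (rule order_trans[OF G(2) T_upper[OF k]])
  qed
  moreover have "S (trunc n a) \<le> C * (\<Sum>i<n. a i * g i)"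
    using T_lower[OF k, of a] unfolding Gs[symmetric] G(3) .
  ultimately show ?thesis
    by (intro that[of g]) (simp_all add: power3_eq_cube power2_eq_square ac_simps)
qed

text \<open>Dual to \<open>submultiplicative\<close>: if \<open>g\<close> and \<open>h\<close>
  almost norm \<open>a\<close> and \<open>b\<close>, then \<open>tens n g h\<close> pairs with
  \<open>tens n a b\<close> to the product of the two pairings, and its \<open>D\<close>-norm is
  bounded by the tensor inequality for \<open>D\<close>.\<close>

lemma supermultiplicative:
  assumes unb: "\<And>B. \<exists>n. B < S (trunc n (\<lambda>_. 1))"
    and cnt: "countable (SPw (dual_space Y) (dual_norm Y))"
  shows "\<exists>E. \<forall>m n a b. 0 < n \<longrightarrow> S (trunc m a) * S (trunc n b) \<le> E * S (trunc (m * n) (tens n a b))"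
proof -
  interpret dual: schreier_seq "dual_space Y" "dual_norm Y" f K "2 * K * C ^ 3" D by (rule dual_schreier_seq)
  obtain E0 where E0: "\<And>m n a b. 0 < n \<Longrightarrow> D (trunc (m * n) (tens n a b)) \<le> E0 * (D (trunc m a) * D (trunc n b))"
    using dual.submultiplicative[OF dual_weakly_null[OF unb] cnt] by blast
  define C' where "C' = 2 * K * C ^ 3"
  have C'0: "0 < C'" using K1 C1 by (simp add: C'_def)
  have "S (trunc m a) * S (trunc n b) \<le> (C ^ 2 * (\<bar>E0\<bar> * (C' * C'))) * S (trunc (m * n) (tens n a b))"
    if n: "0 < n" for m n a b
  proof -
    obtain g where g: "D (trunc m g) \<le> C'" "S (trunc m a) \<le> C * (\<Sum>i<m. a i * g i)"
      unfolding C'_def using dual_norming by blast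
    obtain h where h: "D (trunc n h) \<le> C'" "S (trunc n b) \<le> C * (\<Sum>i<n. b i * h i)"
      unfolding C'_def using dual_norming by blast
    have g0: "0 \<le> C * (\<Sum>i<m. a i * g i)" using g(2) T_nonneg[of m a] by linarith
    have "S (trunc m a) * S (trunc n b) \<le> (C * (\<Sum>i<m. a i * g i)) * (C * (\<Sum>i<n. b i * h i))"
      by (intro mult_mono g h g0 T_nonneg)
    also have "\<dots> = C ^ 2 * ((\<Sum>i<m. a i * g i) * (\<Sum>j<n. b j * h j))" by (simp add: power2_eq_square ac_simps)
    also have "(\<Sum>i<m. a i * g i) * (\<Sum>j<n. b j * h j) = (\<Sum>q<m * n. tens n a b q * tens n g h q)"
      unfolding sum_lessThan_mult sum_product using n by (intro sum.cong refl) (simp add: tens_def)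
    also have "C ^ 2 * \<dots> \<le> C ^ 2 * (D (trunc (m * n) (tens n g h)) * S (trunc (m * n) (tens n a b)))"
      using D_pairing_trunc[of "tens n a b" "tens n g h" "m * n"] C1 by (intro mult_left_mono) auto
    also have "\<dots> \<le> C ^ 2 * ((\<bar>E0\<bar> * (C' * C')) * S (trunc (m * n) (tens n a b)))"
    proof (rule mult_left_mono[OF mult_right_mono[OF _ T_nonneg]])
      have "D (trunc (m * n) (tens n g h)) \<le> E0 * (D (trunc m g) * D (trunc n h))" by (rule E0[OF n])
      also have "\<dots> \<le> \<bar>E0\<bar> * (D (trunc m g) * D (trunc n h))"
        by (rule mult_right_mono) (auto intro!: mult_nonneg_nonneg D_nonneg)
      also have "\<dots> \<le> \<bar>E0\<bar> * (C' * C')"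
        using g(1) h(1) C'0 by (intro mult_left_mono mult_mono) (auto intro!: D_nonneg)
      finally show "D (trunc (m * n) (tens n g h)) \<le> \<bar>E0\<bar> * (C' * C')" .
    qed simp
    finally show ?thesis by (simp only: mult.assoc)
  qed
  then show ?thesis by blast
qed

end

section \<open>Almost multiplicative norms\<close>

lemma nonpos_if_multiples_bounded:
  fixes x B :: real
  assumes "\<And>k::nat. real k * x \<le> B"
  shows "x \<le> 0"
proof (rule ccontr)
  assume x: "\<not> x \<le> 0"
  obtain k :: nat where "B / x < real k" using reals_Archimedean2 by blast
  then have "B < real k * x" using x by (simp add: field_simps)
  then show False using assms[of k] by simp
qed

text \<open>For \<open>t > 1\<close> let \<open>u\<close> be the root of \<open>t\<close> of order
  \<open>m + 1\<close>. Bernoulli's inequality bounds \<open>u ^ k\<close> below by a multiple of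
  \<open>Suc k\<close>, so \<open>t ^ k\<close> grows at least like a polynomial of degree
  \<open>m + 1\<close>, too fast for the assumed degree \<open>m\<close>.\<close>

lemma le_one_if_powers_poly_bounded:
  fixes t A :: real
  assumes t: "0 < t" and le: "\<And>k::nat. t ^ k \<le> A * real (Suc k) ^ m"
  shows "t \<le> 1"
proof (rule ccontr)
  assume "\<not> t \<le> 1"
  define u where "u = root (Suc m) t"
  have u: "u ^ Suc m = t" unfolding u_def using t by (simp del: power_Suc)
  have u1: "1 < u" unfolding u_def using \<open>\<not> t \<le> 1\<close> by simp
  define h where "h = min 1 (u - 1)"
  have h: "0 < h" "h \<le> 1" "h \<le> u - 1" using u1 by (auto simp: h_def)
  have key: "real k * h ^ Suc m \<le> A" for k
  proof -
    have "h * real (Suc k) \<le> 1 + real k * (u - 1)"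
      using mult_left_mono[OF h(3), of "real k"] h(2) by (simp add: algebra_simps)
    also have "\<dots> \<le> (1 + (u - 1)) ^ k" by (rule Bernoulli_inequality) (use u1 in simp)
    finally have "(h * real (Suc k)) ^ Suc m \<le> (u ^ k) ^ Suc m"
      by (intro power_mono) (use h in auto)
    also have "\<dots> = (u ^ Suc m) ^ k" by (metis power_mult mult.commute)
    also have "\<dots> = t ^ k" by (simp only: u)
    also have "\<dots> \<le> A * real (Suc k) ^ m" by (rule le)
    finally have "(h ^ Suc m * real (Suc k)) * real (Suc k) ^ m \<le> A * real (Suc k) ^ m"
      by (simp add: power_mult_distrib ac_simps)
    then have "h ^ Suc m * real (Suc k) \<le> A" by (rule mult_right_le_imp_le) simp
    moreover have "real k * h ^ Suc m \<le> h ^ Suc m * real (Suc k)" using h(1) by (simp add: algebra_simps)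
    ultimately show ?thesis by linarith
  qed
  from nonpos_if_multiples_bounded[OF key] show False
    using zero_less_power[OF h(1), of "Suc m"] by linarith
qed

text \<open>With \<open>g = ln l\<close>, the value \<open>g (n ^ k)\<close> equals
  \<open>k * g n\<close> up to an error linear in \<open>k\<close>. Comparing powers
  \<open>m ^ r \<le> n ^ k\<close> through almost monotonicity shows that \<open>g n\<close> is
  proportional to \<open>ln n\<close> up to a bounded error.\<close>

lemma almost_multiplicative_powr:
  fixes l :: "nat \<Rightarrow> real"
  assumes pos: "\<And>n. 0 < n \<Longrightarrow> 0 < l n" and E: "1 \<le> E"
    and sub: "\<And>m n. 0 < m \<Longrightarrow> 0 < n \<Longrightarrow> l (m * n) \<le> E * (l m * l n)"
    and sup: "\<And>m n. 0 < m \<Longrightarrow> 0 < n \<Longrightarrow> l m * l n \<le> E * l (m * n)"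
    and mono: "\<And>m n. 0 < m \<Longrightarrow> m \<le> n \<Longrightarrow> l m \<le> E * l n"
    and lin: "\<And>n. 0 < n \<Longrightarrow> l n \<le> E * n"
  obtains s where "0 \<le> s" "s \<le> 1" "\<And>n. 0 < n \<Longrightarrow> l n \<le> E * real n powr s"
    "\<And>n. 0 < n \<Longrightarrow> real n powr s \<le> E * l n"
proof -
  define c where "c = ln E"
  have c0: "0 \<le> c" using E by (simp add: c_def)
  define g where "g = (\<lambda>n. ln (l n))"
  have E0: "0 < E" using E by simp
  have g_sub: "g (m * n) \<le> c + g m + g n" if "0 < m" "0 < n" for m n
  proof -
    have "ln (l (m * n)) \<le> ln (E * (l m * l n))" using sub[OF that] pos that by (subst ln_le_cancel_iff) (auto simp: E0)
    also have "\<dots> = c + g m + g n" using pos[OF that(1)] pos[OF that(2)] E0 by (simp add: ln_mult c_def g_def)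
    finally show ?thesis by (simp add: g_def)
  qed
  have g_sup: "g m + g n \<le> c + g (m * n)" if "0 < m" "0 < n" for m n
  proof -
    have "ln (l m * l n) \<le> ln (E * l (m * n))" using sup[OF that] pos that by (subst ln_le_cancel_iff) (auto simp: E0)
    then show ?thesis using pos[OF that(1)] pos[OF that(2)] pos[of "m * n"] that E0 by (simp add: ln_mult c_def g_def)
  qed
  have g_mono: "g m \<le> c + g n" if "0 < m" "m \<le> n" for m n
  proof -
    have "ln (l m) \<le> ln (E * l n)" using mono[OF that] pos[of m] pos[of n] that by (subst ln_le_cancel_iff) (auto simp: E0)
    then show ?thesis using pos[of n] that E0 by (simp add: ln_mult c_def g_def)
  qed
  have g_lin: "g n \<le> c + ln n" if "0 < n" for n
  proof -
    have "ln (l n) \<le> ln (E * n)" using lin[OF that] pos[of n] that by (subst ln_le_cancel_iff) (auto simp: E0)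
    then show ?thesis using that E0 by (simp add: ln_mult c_def g_def)
  qed
  have g1: "g 1 \<le> c" "- c \<le> g 1" using g_sub[of 1 1] g_sup[of 1 1] by simp_all
  have pow_up: "g (n ^ k) \<le> k * (g n + c) + c" if "0 < n" for n k
  proof (induction k)
    case (Suc k)
    have "g (n ^ Suc k) \<le> c + g n + g (n ^ k)" using g_sub[of n "n ^ k"] that by simp
    then show ?case using Suc by (simp add: algebra_simps)
  qed (use g1 in simp)
  have pow_lo: "k * (g n - c) - c \<le> g (n ^ k)" if "0 < n" for n k
  proof (induction k)
    case (Suc k)
    have "g n + g (n ^ k) \<le> c + g (n ^ Suc k)" using g_sup[of n "n ^ k"] that by simp
    then show ?case using Suc by (simp add: algebra_simps)
  qed (use g1 in simp)
  have cross: "(g m - c) / ln m \<le> (g n + c) / ln n" if mn: "2 \<le> m" "2 \<le> n" for m n :: nat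
  proof -
    have lm: "0 < ln (real m)" "0 < ln (real n)" using mn by simp_all
    define \<theta> where "\<theta> = ln (real n) / ln (real m)"
    have \<theta>0: "0 < \<theta>" using lm by (simp add: \<theta>_def)
    have "real k * (\<theta> * (g m - c) - (g n + c)) \<le> \<bar>g m - c\<bar> + 3 * c" for k
    proof -
      \<comment> \<open>The largest \<open>r\<close> with \<open>m ^ r \<le> n ^ k\<close>; rounding
        down loses less than one factor \<open>m\<close>, which \<open>\<bar>g m - c\<bar>\<close>
        absorbs.\<close>
      define r where "r = nat \<lfloor>real k * \<theta>\<rfloor>"
      have r: "real r \<le> real k * \<theta>" "real k * \<theta> \<le> real r + 1"
        using \<theta>0 by (auto simp: r_def)
      have "real r * ln (real m) \<le> real k * ln (real n)"
        using mult_right_mono[OF r(1), of "ln (real m)"] lm by (simp add: \<theta>_def)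
      then have "ln (real (m ^ r)) \<le> ln (real (n ^ k))" using mn by (simp add: ln_realpow)
      then have "real (m ^ r) \<le> real (n ^ k)" using mn by (subst (asm) ln_le_cancel_iff) auto
      then have "m ^ r \<le> n ^ k" by (simp only: of_nat_le_iff)
      then have "g (m ^ r) \<le> c + g (n ^ k)" using mn by (intro g_mono) auto
      then have "r * (g m - c) \<le> k * (g n + c) + 3 * c"
        using pow_lo[of m r] pow_up[of n k] mn by simp
      moreover have "real k * \<theta> * (g m - c) \<le> r * (g m - c) + \<bar>g m - c\<bar>"
      proof (cases "0 \<le> g m - c")
        case True
        then show ?thesis using mult_right_mono[OF r(2) True] by (simp add: algebra_simps)
      next
        case False
        then show ?thesis using mult_right_mono_neg[OF r(1), of "g m - c"] by linarith
      qed
      ultimately show ?thesis by (simp add: algebra_simps)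
    qed
    then have "\<theta> * (g m - c) - (g n + c) \<le> 0" by (rule nonpos_if_multiples_bounded)
    then show ?thesis using lm by (simp add: \<theta>_def field_simps)
  qed
  \<comment> \<open>By \<open>cross\<close> every lower quotient is below every upper one, so the
    supremum satisfies both \<open>s_ge\<close> and \<open>s_le\<close>.\<close>
  define s where "s = (SUP m\<in>{2..}. (g m - c) / ln (real m))"
  have bdd: "bdd_above ((\<lambda>m. (g m - c) / ln (real m)) ` {2..})"
    by (rule bdd_aboveI2[of _ _ "(g 2 + c) / ln (real 2)"], rule cross) auto
  have s_ge: "g n - c \<le> s * ln (real n)" if "2 \<le> n" for n
  proof -
    have "(g n - c) / ln (real n) \<le> s" unfolding s_def by (rule cSUP_upper[OF _ bdd]) (use that in simp)
    then show ?thesis using that by (simp add: pos_divide_le_eq)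
  qed
  have s_le: "s * ln (real n) \<le> g n + c" if "2 \<le> n" for n
  proof -
    have "s \<le> (g n + c) / ln (real n)" unfolding s_def by (rule cSUP_least) (use cross that in auto)
    then show ?thesis using that by (simp add: pos_le_divide_eq)
  qed
  have ln2: "0 < ln (2::real)" by simp
  \<comment> \<open>Powers of 2 locate \<open>s\<close>: almost monotonicity gives
    \<open>0 \<le> s\<close>, and the linear bound gives \<open>s \<le> 1\<close>.\<close>
  have "real k * (- s * ln 2) \<le> 3 * c" for k
  proof (cases "k = 0")
    case False
    then have "2 \<le> (2::nat) ^ k" using power_increasing[of 1 k "2::nat"] by simp
    then have "g (2 ^ k) - c \<le> s * ln (real (2 ^ k))" by (rule s_ge)
    moreover have "g 1 \<le> c + g (2 ^ k)" by (rule g_mono) auto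
    ultimately have "- 3 * c \<le> s * ln (real (2 ^ k))" using g1 by linarith
    then show ?thesis by (simp add: ln_realpow algebra_simps)
  qed (use c0 in simp)
  then have "- s * ln 2 \<le> 0" by (rule nonpos_if_multiples_bounded)
  then have s0: "0 \<le> s" using ln2 by (simp add: zero_le_mult_iff)
  have "real k * ((s - 1) * ln 2) \<le> 2 * c" for k
  proof (cases "k = 0")
    case False
    then have "2 \<le> (2::nat) ^ k" using power_increasing[of 1 k "2::nat"] by simp
    then have "s * ln (real (2 ^ k)) \<le> g (2 ^ k) + c" by (rule s_le)
    moreover have "g (2 ^ k) \<le> c + ln (real (2 ^ k))" by (rule g_lin) simp
    ultimately have "(s - 1) * ln (real (2 ^ k)) \<le> 2 * c" by (simp add: algebra_simps)
    then show ?thesis by (simp add: ln_realpow algebra_simps)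
  qed (use c0 in simp)
  then have "(s - 1) * ln 2 \<le> 0" by (rule nonpos_if_multiples_bounded)
  then have s1: "s \<le> 1" using ln2 by (simp add: mult_le_0_iff)
  have bounds: "g n \<le> c + s * ln (real n)" "s * ln (real n) \<le> c + g n" if "0 < n" for n
    using s_ge[of n] s_le[of n] g1 that by (cases "n = 1"; simp)+
  have "l n \<le> E * real n powr s" if n: "0 < n" for n
  proof -
    have "l n = exp (g n)" using pos[OF n] by (simp add: g_def)
    also have "\<dots> \<le> exp (c + s * ln (real n))" using bounds(1)[OF n] by simp
    also have "\<dots> = E * real n powr s" using n E0 by (simp add: exp_add c_def powr_def)
    finally show ?thesis .
  qed
  moreover have "real n powr s \<le> E * l n" if n: "0 < n" for n
  proof -
    have "real n powr s = exp (s * ln (real n))" using n by (simp add: powr_def)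
    also have "\<dots> \<le> exp (c + g n)" using bounds(2)[OF n] by simp
    also have "\<dots> = E * l n" using pos[OF n] E0 by (simp add: exp_add c_def g_def)
    finally show ?thesis .
  qed
  ultimately show ?thesis using that s0 s1 by blast
qed

lemma c00_seminorm_sum_trunc:
  assumes T: "c00_seminorm T" and "finite W"
  shows "T (trunc n (\<lambda>i. \<Sum>v\<in>W. b v i)) \<le> (\<Sum>v\<in>W. T (trunc n (b v)))"
  using assms(2)
proof (induction W)
  case empty
  show ?case using c00_seminormD(2)[OF T, of n 0 "\<lambda>_. 0"] by simp
next
  case (insert v W)
  have "T (trunc n (\<lambda>i. b v i + (\<Sum>v\<in>W. b v i))) \<le> T (trunc n (b v)) + T (trunc n (\<lambda>i. \<Sum>v\<in>W. b v i))"
    by (rule c00_seminormD(1)[OF T])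
  then show ?case using insert by simp
qed

context schreier_seq
begin

text \<open>The lower estimate is boundedness of coordinates; for the upper one \<open>a\<close> is
  dominated coordinatewise by its maximum times (1, ..., 1).\<close>

lemma c0_equiv:
  assumes bd: "\<And>n. T (trunc n (\<lambda>_. 1)) \<le> B"
  shows "sm_equiv T c0_norm"
proof -
  define L where "L = 2 * K * C ^ 2"
  define c where "c = L / T (trunc 1 (\<lambda>_. 1))"
  have L0: "0 < L" using K1 C1 by (simp add: L_def)
  have c0: "0 < c" using L0 T_pos by (simp add: c_def)
  have B0: "0 \<le> B" using bd[of 1] T_pos by linarith
  define E where "E = L * B + c"
  have E0: "0 < E" using L0 B0 c0 by (simp add: E_def add_nonneg_pos)
  have "inverse E * c0_norm a \<le> T a \<and> T a \<le> E * c0_norm a" if a: "finite {i. a i \<noteq> 0}" for a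
  proof -
    obtain n where n: "\<And>i. n \<le> i \<Longrightarrow> a i = 0" using finite_supp_bounded[OF a] by blast
    have tr: "trunc q a = a" if "n \<le> q" for q by (rule trunc_eq_self) (use n that in auto)
    have co: "\<bar>a i\<bar> \<le> c * T a" for i
    proof -
      have "\<bar>a i\<bar> * T (trunc 1 (\<lambda>_. 1)) \<le> L * T a"
        using T_coeff[of i "n + Suc i" a] tr[of "n + Suc i"] by (simp add: L_def)
      then show ?thesis using T_pos by (simp add: c_def field_simps)
    qed
    then have bdd: "bdd_above (range (\<lambda>i. \<bar>a i\<bar>))" by (intro bdd_aboveI2[of _ _ "c * T a"])
    have up: "\<bar>a i\<bar> \<le> c0_norm a" for i unfolding c0_norm_def by (rule cSUP_upper[OF _ bdd]) simp
    have s0: "0 \<le> c0_norm a" using up[of 0] by linarith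
    have T0: "0 \<le> T a" using T_nonneg[of n a] tr[of n] by simp
    have "c0_norm a \<le> c * T a" unfolding c0_norm_def by (rule cSUP_least) (use co in auto)
    also have "\<dots> \<le> E * T a" using T0 L0 B0 by (intro mult_right_mono) (auto simp: E_def)
    finally have 1: "inverse E * c0_norm a \<le> T a" using E0 by (simp add: field_simps)
    have "T (trunc n a) \<le> L * T (trunc n (\<lambda>i. c0_norm a * 1))"
      unfolding L_def by (rule T_unconditional) (use up s0 in auto)
    also have "\<dots> = L * (c0_norm a * T (trunc n (\<lambda>_. 1)))"
      using s0 by (simp only: c00_seminormD(2)[OF T])
    also have "\<dots> \<le> L * (c0_norm a * B)" using L0 s0 bd by (intro mult_left_mono) auto
    also have "\<dots> \<le> E * c0_norm a" using s0 c0 by (simp add: E_def algebra_simps)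
    finally show ?thesis using 1 tr[of n] by simp
  qed
  then show ?thesis unfolding sm_equiv_def using E0 by blast
qed

lemma T_ones_pos: "0 < n \<Longrightarrow> 0 < T (trunc n (\<lambda>_. 1))"
proof -
  assume "0 < n"
  then have "T (trunc 1 (\<lambda>_. 1)) \<le> 2 * K * C ^ 2 * T (trunc n (\<lambda>_. 1))" by (intro T_ones_mono) simp
  then have "0 < 2 * K * C ^ 2 * T (trunc n (\<lambda>_. 1))" using T_pos by linarith
  then show ?thesis by (rule zero_less_mult_pos) (use K1 C1 in simp)
qed

lemma T_ones_linear: "T (trunc n (\<lambda>_. 1)) \<le> C ^ 2 * T (trunc 1 (\<lambda>_. 1)) * n"
proof -
  have "T (trunc n (\<lambda>i. \<Sum>v<n. indicator {v} i)) \<le> (\<Sum>v<n. T (trunc n (indicator {v})))"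
    by (rule c00_seminorm_sum_trunc[OF T]) simp
  moreover have "trunc n (\<lambda>i. \<Sum>v<n. indicator {v} i) = trunc n (\<lambda>_. 1)"
    by (rule trunc_cong) (simp add: indicator_def of_bool_def)
  moreover have "(\<Sum>v<n. T (trunc n (indicator {v}))) \<le> (\<Sum>v<n. C ^ 2 * T (trunc 1 (\<lambda>_. 1)))"
    by (rule sum_mono) (use T_indicator(2)[of "{_}" n] in auto)
  ultimately show ?thesis by (simp add: ac_simps)
qed

text \<open>Splitting \<open>b\<close> into its level sets costs only a factor \<open>card W\<close>, and on level sets the two norms
  are compared through the growth of \<open>T (1, \<dots>, 1)\<close>.\<close>

lemma compare_few_values:
  assumes s: "0 < s" "s \<le> 1" and E: "1 \<le> E"
    and up: "\<And>n. 0 < n \<Longrightarrow> T (trunc n (\<lambda>_. 1)) \<le> E * real n powr s"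
    and lo: "\<And>n. 0 < n \<Longrightarrow> real n powr s \<le> E * T (trunc n (\<lambda>_. 1))"
    and W: "finite W" "\<And>r. r < n \<Longrightarrow> \<bar>b r\<bar> \<in> W" "W \<noteq> {}"
  shows "T (trunc n b) \<le> (2 * K * C ^ 4 * E) * card W * (\<Sum>r<n. \<bar>b r\<bar> powr (1 / s)) powr s"
    and "(\<Sum>r<n. \<bar>b r\<bar> powr (1 / s)) powr s \<le> (2 * K * C ^ 4 * E) * card W * T (trunc n b)"
proof -
  define L where "L = 2 * K * C ^ 2"
  have L0: "0 < L" using K1 C1 by (simp add: L_def)
  define G where "G = 2 * K * C ^ 4 * E"
  have GL: "G = L * (C ^ 2 * E)" by (simp add: G_def L_def power2_eq_square numeral_eq_Suc)
  have G0: "0 < G" unfolding G_def using K1 C1 E by simp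
  define J where "J = (\<lambda>v. {r. r < n \<and> \<bar>b r\<bar> = v})"
  have J: "J v \<subseteq> {..<n}" "finite (J v)" for v by (auto simp: J_def)
  define Q where "Q = (\<Sum>r<n. \<bar>b r\<bar> powr (1 / s))"
  have Q0: "0 \<le> Q" by (simp add: Q_def sum_nonneg)
  have up': "T (trunc q (\<lambda>_. 1)) \<le> E * real q powr s" for q
    using up[of q] T_zero[of 0] by (cases "q = 0") (auto simp: trunc_def)
  have lo': "real q powr s \<le> E * T (trunc q (\<lambda>_. 1))" for q
    using lo[of q] T_nonneg[of 0 "\<lambda>_. 1"] E by (cases "q = 0") auto
  have W0: "0 \<le> v" if "J v \<noteq> {}" for v using that by (auto simp: J_def)
  \<comment> \<open>With \<open>p = 1 / s\<close>, the growth rate of (1, ..., 1) makes a level set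
    of value \<open>v\<close> have the size of its lp norm; this identity passes to the sum of p-th
    powers.\<close>
  have lev: "(v * real (card (J v)) powr s) powr (1 / s) = v powr (1 / s) * card (J v)" if "0 \<le> v" for v
    using that s by (simp add: powr_mult powr_powr)
  have level_sum: "(\<Sum>r\<in>J v. \<bar>b r\<bar> powr (1 / s)) = v powr (1 / s) * card (J v)" for v
  proof -
    have "(\<Sum>r\<in>J v. \<bar>b r\<bar> powr (1 / s)) = (\<Sum>r\<in>J v. v powr (1 / s))" by (rule sum.cong) (auto simp: J_def)
    then show ?thesis by simp
  qed
  have vQ: "v * real (card (J v)) powr s \<le> Q powr s" if v: "0 \<le> v" for v
  proof -
    have "v powr (1 / s) * card (J v) \<le> Q"
      unfolding level_sum[symmetric] Q_def by (rule sum_mono2) (use J in auto)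
    then have "((v * real (card (J v)) powr s) powr (1 / s)) powr s \<le> Q powr s"
      unfolding lev[OF v, symmetric] using s by (intro powr_mono2) auto
    then show ?thesis using v s by (simp add: powr_powr)
  qed
  have ind0: "0 \<le> T (trunc n (indicator (J v)))" for v by (rule T_nonneg)
  have bJ: "T (trunc n (\<lambda>i. b i * indicator (J v) i)) \<le> G * Q powr s" for v
  proof (cases "J v = {}")
    case True
    then have "trunc n (\<lambda>i. b i * indicator (J v) i) = trunc n (\<lambda>_. 0)" by (intro trunc_cong) simp
    then show ?thesis using T_zero[of n] G0 by simp
  next
    case False
    note v = W0[OF False]
    have "T (trunc n (\<lambda>i. b i * indicator (J v) i)) \<le> L * T (trunc n (\<lambda>i. v * indicator (J v) i))"
      unfolding L_def by (rule T_unconditional) (auto simp: J_def indicator_def)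
    also have "\<dots> = L * (v * T (trunc n (indicator (J v))))" using v by (simp only: c00_seminormD(2)[OF T])
    also have "\<dots> \<le> L * (v * (C ^ 2 * (E * real (card (J v)) powr s)))"
      using L0 v T_indicator(2)[OF J(1), of v] up'[of "card (J v)"]
      by (intro mult_left_mono order_trans[OF T_indicator(2)[OF J(1), of v]]) auto
    also have "\<dots> = G * (v * real (card (J v)) powr s)" by (simp add: GL ac_simps)
    also have "\<dots> \<le> G * Q powr s" using G0 vQ[OF v] by (intro mult_left_mono) auto
    finally show ?thesis .
  qed
  have "trunc n b = trunc n (\<lambda>i. \<Sum>v\<in>W. b i * indicator (J v) i)"
  proof (rule trunc_cong)
    fix i assume i: "i < n"
    have "(\<Sum>v\<in>W. b i * indicator (J v) i) = (\<Sum>v\<in>{\<bar>b i\<bar>}. b i * indicator (J v) i)"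
      using W(1) W(2)[OF i] by (intro sum.mono_neutral_right) (auto simp: J_def)
    then show "b i = (\<Sum>v\<in>W. b i * indicator (J v) i)" using i by (simp add: J_def)
  qed
  then have "T (trunc n b) \<le> (\<Sum>v\<in>W. T (trunc n (\<lambda>i. b i * indicator (J v) i)))"
    using c00_seminorm_sum_trunc[OF T W(1), of n "\<lambda>v i. b i * indicator (J v) i"] by simp
  also have "\<dots> \<le> (\<Sum>v\<in>W. G * Q powr s)" by (rule sum_mono, rule bJ)
  finally show "T (trunc n b) \<le> (2 * K * C ^ 4 * E) * card W * (\<Sum>r<n. \<bar>b r\<bar> powr (1 / s)) powr s"
    by (simp add: G_def Q_def ac_simps)
  define X where "X = G * T (trunc n b)"
  have X0: "0 \<le> X" using G0 T_nonneg by (simp add: X_def)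
  have vX: "v powr (1 / s) * card (J v) \<le> X powr (1 / s)" for v
  proof (cases "J v = {}")
    case False
    note v = W0[OF False]
    have "v * real (card (J v)) powr s \<le> v * (E * (C ^ 2 * T (trunc n (indicator (J v)))))"
      using v E T_indicator(1)[OF J(1), of v] by (intro mult_left_mono order_trans[OF lo']) auto
    also have "\<dots> = E * C ^ 2 * (v * T (trunc n (indicator (J v))))" by (simp add: ac_simps)
    also have "v * T (trunc n (indicator (J v))) = T (trunc n (\<lambda>i. v * indicator (J v) i))"
      using v by (simp only: c00_seminormD(2)[OF T])
    also have "E * C ^ 2 * \<dots> \<le> E * C ^ 2 * (L * T (trunc n b))"
      unfolding L_def using E by (intro mult_left_mono T_unconditional) (auto simp: J_def indicator_def)
    also have "\<dots> = X" by (simp add: X_def GL ac_simps)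
    finally have "(v * real (card (J v)) powr s) powr (1 / s) \<le> X powr (1 / s)"
      using v s by (intro powr_mono2) auto
    then show ?thesis using lev[OF v] by simp
  qed simp
  have "Q = (\<Sum>v\<in>W. \<Sum>r\<in>J v. \<bar>b r\<bar> powr (1 / s))"
  proof -
    have "{..<n} = (\<Union>v\<in>W. J v)" using W(2) by (auto simp: J_def)
    then have "Q = (\<Sum>r\<in>(\<Union>v\<in>W. J v). \<bar>b r\<bar> powr (1 / s))" by (simp add: Q_def)
    also have "\<dots> = (\<Sum>v\<in>W. \<Sum>r\<in>J v. \<bar>b r\<bar> powr (1 / s))"
      by (rule sum.UNION_disjoint) (use W(1) J in \<open>auto simp: J_def\<close>)
    finally show ?thesis .
  qed
  also have "\<dots> \<le> (\<Sum>v\<in>W. X powr (1 / s))" unfolding level_sum by (rule sum_mono, rule vX)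
  finally have "Q \<le> card W * X powr (1 / s)" by simp
  then have "Q powr s \<le> (card W * X powr (1 / s)) powr s" using Q0 s by (intro powr_mono2) auto
  also have "\<dots> = card W powr s * X" using X0 s by (simp add: powr_mult powr_powr)
  also have "\<dots> \<le> card W * X"
  proof (rule mult_right_mono[OF _ X0])
    have "1 \<le> card W" using W by (simp add: Suc_le_eq card_gt_0_iff)
    then have "real (card W) powr s \<le> real (card W) powr 1" using s by (intro powr_mono) auto
    then show "real (card W) powr s \<le> card W" by simp
  qed
  finally show "(\<Sum>r<n. \<bar>b r\<bar> powr (1 / s)) powr s \<le> (2 * K * C ^ 4 * E) * card W * T (trunc n b)"
    by (simp add: Q_def X_def G_def ac_simps)
qed

end

text \<open>The power has length \<open>m ^ k\<close>. At \<open>k = 0\<close> only entry 0 is read,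
  so the value 1 acts as the unit for \<open>tens\<close>.\<close>

primrec tens_pow :: "nat \<Rightarrow> (nat \<Rightarrow> real) \<Rightarrow> nat \<Rightarrow> nat \<Rightarrow> real" where
  "tens_pow m a 0 = (\<lambda>_. 1)"
| "tens_pow m a (Suc k) = tens (m ^ k) a (tens_pow m a k)"

text \<open>Entries of the power are products of \<open>k\<close> entries of \<open>a\<close>, hence
  up to sign monomials in which only the exponents matter. Leaving the sum of the exponents free
  gives the simple count \<open>Suc k ^ m\<close>.\<close>

definition tens_pow_values :: "nat \<Rightarrow> (nat \<Rightarrow> real) \<Rightarrow> nat \<Rightarrow> real set" where
  "tens_pow_values m a k = (\<lambda>c. \<Prod>i<m. \<bar>a i\<bar> ^ c i) ` ({..<m} \<rightarrow>\<^sub>E {..k})"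

lemma tens_pow_values: "r < m ^ k \<Longrightarrow> \<bar>tens_pow m a k r\<bar> \<in> tens_pow_values m a k"
proof (induction k arbitrary: r)
  case 0
  show ?case unfolding tens_pow_values_def
    by (rule image_eqI[of _ _ "\<lambda>i\<in>{..<m}. 0"]) auto
next
  case (Suc k)
  have mk: "0 < m ^ k" using Suc.prems by (cases m) auto
  define d where "d = r div m ^ k"
  have d: "d < m" using Suc.prems mk by (simp add: d_def div_less_iff_less_mult)
  obtain c where c: "c \<in> {..<m} \<rightarrow>\<^sub>E {..k}" "\<bar>tens_pow m a k (r mod m ^ k)\<bar> = (\<Prod>i<m. \<bar>a i\<bar> ^ c i)"
    using Suc.IH[of "r mod m ^ k"] mk by (auto simp: tens_pow_values_def)
  define c' where "c' = c(d := Suc (c d))"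
  have "c' \<in> {..<m} \<rightarrow>\<^sub>E {..Suc k}"
    using c(1) d by (auto simp: c'_def PiE_iff extensional_def le_SucI)
  moreover have "\<bar>tens_pow m a (Suc k) r\<bar> = (\<Prod>i<m. \<bar>a i\<bar> ^ c' i)"
  proof -
    have "(\<Prod>i<m. \<bar>a i\<bar> ^ c' i) = (\<Prod>i<m. (if i = d then \<bar>a i\<bar> else 1) * \<bar>a i\<bar> ^ c i)"
      by (rule prod.cong) (auto simp: c'_def)
    also have "\<dots> = \<bar>a d\<bar> * (\<Prod>i<m. \<bar>a i\<bar> ^ c i)" using d by (simp add: prod.distrib)
    finally show ?thesis using c(2) by (simp add: tens_def d_def abs_mult)
  qed
  ultimately show ?case unfolding tens_pow_values_def by (intro image_eqI)
qed

lemma card_tens_pow_values: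
  "finite (tens_pow_values m a k)" "tens_pow_values m a k \<noteq> {}" "card (tens_pow_values m a k) \<le> Suc k ^ m"
proof -
  have fin: "finite ({..<m} \<rightarrow>\<^sub>E {..k})" by (intro finite_PiE) auto
  show "finite (tens_pow_values m a k)" unfolding tens_pow_values_def using fin by simp
  have "card (tens_pow_values m a k) \<le> card ({..<m} \<rightarrow>\<^sub>E {..k})"
    unfolding tens_pow_values_def by (rule card_image_le[OF fin])
  also have "\<dots> = Suc k ^ m" by (simp add: card_PiE)
  finally show "card (tens_pow_values m a k) \<le> Suc k ^ m" .
  have "(\<lambda>i\<in>{..<m}. 0) \<in> {..<m} \<rightarrow>\<^sub>E {..k}" by auto
  then show "tens_pow_values m a k \<noteq> {}" unfolding tens_pow_values_def by blast
qed

text \<open>On the lp side the tensor power is exactly multiplicative, in contrast to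
  \<open>T\<close>, which loses a factor \<open>E\<close> at each step.\<close>

lemma sum_tens_pow:
  assumes m: "0 < m"
  shows "(\<Sum>r<m ^ k. \<bar>tens_pow m a k r\<bar> powr p) = (\<Sum>i<m. \<bar>a i\<bar> powr p) ^ k"
proof (induction k)
  case (Suc k)
  have "(\<Sum>r<m ^ Suc k. \<bar>tens_pow m a (Suc k) r\<bar> powr p)
      = (\<Sum>i<m. \<Sum>j<m ^ k. \<bar>a i\<bar> powr p * \<bar>tens_pow m a k j\<bar> powr p)"
    unfolding power_Suc sum_lessThan_mult using m
    by (intro sum.cong refl) (simp add: tens_def abs_mult powr_mult)
  also have "\<dots> = (\<Sum>i<m. \<bar>a i\<bar> powr p) * (\<Sum>j<m ^ k. \<bar>tens_pow m a k j\<bar> powr p)"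
    by (simp add: sum_product)
  finally show ?case using Suc by simp
qed simp

lemma power_powr_commute:
  fixes q s :: real
  assumes "0 \<le> q"
  shows "(q ^ k) powr s = (q powr s) ^ k"
  using assms by (induction k) (simp_all add: powr_mult)

text \<open>On the \<open>k\<close>-th tensor power both norms are \<open>k\<close>-th powers up to
  \<open>E ^ k\<close>, while their comparison costs a polynomial in \<open>k\<close> whose degree
  depends on the length of \<open>a\<close>. Large \<open>k\<close> removes the polynomial, so the
  final constant \<open>E\<close> is the same for all \<open>a\<close>.\<close>

lemma (in schreier_seq) lp_equiv:
  assumes E: "1 \<le> E"
    and sub: "\<And>m n a b. 0 < n \<Longrightarrow> T (trunc (m * n) (tens n a b)) \<le> E * (T (trunc m a) * T (trunc n b))"
    and sup: "\<And>m n a b. 0 < n \<Longrightarrow> T (trunc m a) * T (trunc n b) \<le> E * T (trunc (m * n) (tens n a b))"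
    and unb: "\<And>B. \<exists>n. B < T (trunc n (\<lambda>_. 1))"
  shows "\<exists>p. 1 \<le> p \<and> sm_equiv T (lp_norm p)"
proof -
  define l where "l = (\<lambda>n. T (trunc n (\<lambda>_. 1)))"
  \<comment> \<open>One constant for all premises of \<open>almost_multiplicative_powr\<close>: both
    tensor inequalities, monotonicity and linear growth of \<open>l\<close>.\<close>
  define E' where "E' = E + 2 * K * C ^ 2 + C ^ 2 * l 1"
  have l0: "0 \<le> l n" for n by (simp add: l_def T_nonneg)
  have pos1: "0 \<le> 2 * K * C ^ 2" "0 \<le> C ^ 2 * l 1" using K1 l0 by simp_all
  have E': "1 \<le> E'" "E \<le> E'" "2 * K * C ^ 2 \<le> E'" "C ^ 2 * l 1 \<le> E'"
    using E pos1 unfolding E'_def by linarith+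
  have one: "tens n (\<lambda>_. 1) (\<lambda>_. 1) = (\<lambda>_. 1)" for n by (simp add: tens_def)
  obtain s where s: "0 \<le> s" "s \<le> 1" and up: "\<And>n. 0 < n \<Longrightarrow> l n \<le> E' * real n powr s"
    and lo: "\<And>n. 0 < n \<Longrightarrow> real n powr s \<le> E' * l n"
  proof (rule almost_multiplicative_powr[of l E'])
    show "0 < l n" if "0 < n" for n using T_ones_pos[OF that] by (simp add: l_def)
    show "1 \<le> E'" by (rule E')
    show "l (m * n) \<le> E' * (l m * l n)" if "0 < m" "0 < n" for m n
      using sub[OF that(2), of m "\<lambda>_. 1" "\<lambda>_. 1"] mult_right_mono[OF E'(2), of "l m * l n"] l0
      by (simp add: one l_def)
    show "l m * l n \<le> E' * l (m * n)" if "0 < m" "0 < n" for m n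
      using sup[OF that(2), of m "\<lambda>_. 1" "\<lambda>_. 1"] mult_right_mono[OF E'(2), of "l (m * n)"] l0
      by (simp add: one l_def)
    show "l m \<le> E' * l n" if "0 < m" "m \<le> n" for m n
      using T_ones_mono[OF that(2)] mult_right_mono[OF E'(3), of "l n"] l0 by (simp add: l_def)
    show "l n \<le> E' * n" if "0 < n" for n
      using T_ones_linear[of n] mult_right_mono[OF E'(4), of "real n"] by (simp add: l_def)
  qed blast
  \<comment> \<open>Exponent 0 would bound \<open>l\<close>; excluding it makes
    \<open>p = 1 / s\<close> finite.\<close>
  have "s \<noteq> 0"
  proof
    assume "s = 0"
    obtain n where n: "E' < l n" using unb by (auto simp: l_def)
    then have "0 < n" using T_zero[of 0] E'(1) by (cases "n = 0") (auto simp: l_def trunc_def)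
    then show False using up[of n] n \<open>s = 0\<close> by simp
  qed
  then have s0: "0 < s" using s by simp
  define p where "p = 1 / s"
  have p: "1 \<le> p" "1 / p = s" using s0 s by (auto simp: p_def)
  define G where "G = 2 * K * C ^ 4 * E'"
  have G0: "0 < G" unfolding G_def using K1 C1 E'(1) by simp
  have l1: "0 < l 1" using T_pos by (simp add: l_def)
  have main: "T a \<le> E * lp_norm p a \<and> lp_norm p a \<le> E * T a" if a: "finite {i. a i \<noteq> 0}" for a
  proof -
    obtain n where n: "\<And>i. n \<le> i \<Longrightarrow> a i = 0" using finite_supp_bounded[OF a] by blast
    \<comment> \<open>\<open>Suc n\<close> rather than \<open>n\<close>, so that the lengths
      \<open>m ^ k\<close> are positive.\<close>
    define m where "m = Suc n"
    have m: "0 < m" "\<And>i. m \<le> i \<Longrightarrow> a i = 0" using n by (auto simp: m_def)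
    have Ta: "trunc m a = a" by (rule trunc_eq_self) (use m in auto)
    define Q where "Q = (\<Sum>i<m. \<bar>a i\<bar> powr p)"
    have Q0: "0 \<le> Q" by (simp add: Q_def sum_nonneg)
    define q where "q = Q powr s"
    have lp: "lp_norm p a = q"
    proof -
      have "(\<Sum>i\<in>{i. a i \<noteq> 0}. \<bar>a i\<bar> powr p) = Q"
        unfolding Q_def using m(2) by (intro sum.mono_neutral_left) (auto simp: not_less[symmetric])
      then show ?thesis by (simp add: lp_norm_def q_def p)
    qed
    have T0: "0 \<le> T a" using T_nonneg[of m a] Ta by simp
    show ?thesis
    proof (cases "a = (\<lambda>_. 0)")
      case True
      then have "q = 0" by (simp add: q_def Q_def)
      moreover have "T a = 0" using T_zero[of m] Ta True by simp
      ultimately show ?thesis by (simp add: lp)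
    next
      case False
      then obtain i where i: "a i \<noteq> 0" by auto
      then have im: "i < m" using m(2) by (meson not_le)
      have "0 < \<bar>a i\<bar> powr p" using i by simp
      also have "\<dots> \<le> Q" unfolding Q_def using im by (intro member_le_sum) auto
      finally have q0: "0 < q" by (simp add: q_def)
      have Tpos: "0 < T a"
      proof -
        have "0 < \<bar>a i\<bar> * T (trunc 1 (\<lambda>_. 1))" using i T_pos by simp
        then have "0 < 2 * K * C ^ 2 * T a" using T_coeff[OF im, of a] unfolding Ta by linarith
        then show ?thesis by (rule zero_less_mult_pos) (use K1 C1 in simp)
      qed
      define P where "P = (\<lambda>k. T (trunc (m ^ k) (tens_pow m a k)))"
      have P0: "0 \<le> P k" for k by (simp add: P_def T_nonneg)
      have P_up: "P k \<le> E ^ k * T a ^ k * l 1" for k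
      proof (induction k)
        case (Suc k)
        have "P (Suc k) \<le> E * (T a * P k)"
          using sub[of "m ^ k" m a "tens_pow m a k"] m(1) by (simp add: P_def Ta)
        also have "\<dots> \<le> E * (T a * (E ^ k * T a ^ k * l 1))"
          using Suc E T0 by (intro mult_left_mono) auto
        finally show ?case by (simp add: ac_simps)
      qed (simp add: P_def l_def)
      have P_lo: "T a ^ k * l 1 \<le> E ^ k * P k" for k
      proof (induction k)
        case (Suc k)
        have "T a * (T a ^ k * l 1) \<le> T a * (E ^ k * P k)" using Suc T0 by (intro mult_left_mono) auto
        also have "\<dots> = E ^ k * (T a * P k)" by simp
        also have "\<dots> \<le> E ^ k * (E * P (Suc k))"
          using sup[of "m ^ k" m a "tens_pow m a k"] m(1) E by (intro mult_left_mono) (auto simp: P_def Ta)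
        finally show ?case by (simp add: ac_simps)
      qed (simp add: P_def l_def)
      have qk: "(\<Sum>r<m ^ k. \<bar>tens_pow m a k r\<bar> powr (1 / s)) powr s = q ^ k" for k
        using sum_tens_pow[OF m(1), of a k p] power_powr_commute[OF Q0, of k s] by (simp add: Q_def q_def p_def)
      have cmp: "P k \<le> G * real (Suc k) ^ m * q ^ k" "q ^ k \<le> G * real (Suc k) ^ m * P k" for k
      proof -
        define W where "W = tens_pow_values m a k"
        have W: "finite W" "W \<noteq> {}" "real (card W) \<le> real (Suc k) ^ m"
          using card_tens_pow_values[where m=m and a=a and k=k] unfolding W_def
          by (auto simp flip: of_nat_power of_nat_Suc)
        have Wv: "\<bar>tens_pow m a k r\<bar> \<in> W" if "r < m ^ k" for r
          unfolding W_def by (rule tens_pow_values[OF that])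
        note up' = up[unfolded l_def] and lo' = lo[unfolded l_def]
        have "P k \<le> G * card W * q ^ k"
          using compare_few_values(1)[OF s0 s(2) E'(1) up' lo' W(1), where n="m ^ k" and b="tens_pow m a k", OF _ _ Wv W(2)] by (simp add: P_def G_def qk)
        also have "\<dots> \<le> G * real (Suc k) ^ m * q ^ k"
          using W(3) G0 q0 by (intro mult_right_mono mult_left_mono) auto
        finally show "P k \<le> G * real (Suc k) ^ m * q ^ k" .
        have "q ^ k \<le> G * card W * P k"
          using compare_few_values(2)[OF s0 s(2) E'(1) up' lo' W(1), where n="m ^ k" and b="tens_pow m a k", OF _ _ Wv W(2)] by (simp add: P_def G_def qk)
        also have "\<dots> \<le> G * real (Suc k) ^ m * P k"
          using W(3) G0 P0 by (intro mult_right_mono mult_left_mono) auto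
        finally show "q ^ k \<le> G * real (Suc k) ^ m * P k" .
      qed
      have E0: "0 < E" using E by simp
      have "T a / (E * q) \<le> 1"
      proof (rule le_one_if_powers_poly_bounded)
        show "0 < T a / (E * q)" using Tpos E0 q0 by simp
        show "(T a / (E * q)) ^ k \<le> (G / l 1) * real (Suc k) ^ m" for k
        proof -
          have "T a ^ k * l 1 \<le> E ^ k * (G * real (Suc k) ^ m * q ^ k)"
            by (rule order_trans[OF P_lo mult_left_mono[OF cmp(1)]]) (use E0 in simp)
          then have "T a ^ k \<le> (G / l 1) * real (Suc k) ^ m * (E * q) ^ k"
            using l1 by (simp add: field_simps power_mult_distrib)
          then show ?thesis using E0 q0 by (simp add: power_divide pos_divide_le_eq)
        qed
      qed
      moreover have "q / (E * T a) \<le> 1"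
      proof (rule le_one_if_powers_poly_bounded)
        show "0 < q / (E * T a)" using Tpos E0 q0 by simp
        show "(q / (E * T a)) ^ k \<le> (G * l 1) * real (Suc k) ^ m" for k
        proof -
          have "q ^ k \<le> G * real (Suc k) ^ m * (E ^ k * T a ^ k * l 1)"
            by (rule order_trans[OF cmp(2) mult_left_mono[OF P_up]]) (use G0 in simp)
          then have "q ^ k \<le> (G * l 1) * real (Suc k) ^ m * (E * T a) ^ k"
            by (simp add: power_mult_distrib ac_simps)
          then show ?thesis using E0 Tpos by (simp add: power_divide pos_divide_le_eq)
        qed
      qed
      ultimately show ?thesis using E0 q0 Tpos by (simp add: lp divide_le_eq)
    qed
  qed
  have "sm_equiv T (lp_norm p)"
    unfolding sm_equiv_def
  proof (intro exI[of _ E] conjI allI impI)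
    show E0: "0 < E" using E by simp
    fix a :: "nat \<Rightarrow> real" assume "finite {i. a i \<noteq> 0}"
    from main[OF this] show "inverse E * lp_norm p a \<le> T a" "T a \<le> E * lp_norm p a"
      using E0 by (simp_all add: field_simps)
  qed
  then show ?thesis using p(1) by blast
qed

section \<open>From the given spreading model to the conclusion\<close>

lemma c00_seminorm_seq_norm: "c00_seminorm (seq_norm e)"
proof -
  have eq: "seq_norm e a = norm (\<Sum>i<n. a i *\<^sub>R e i)" if "\<And>i. n \<le> i \<Longrightarrow> a i = 0" for a n
  proof -
    have "(\<Sum>i\<in>{i. a i \<noteq> 0}. a i *\<^sub>R e i) = (\<Sum>i<n. a i *\<^sub>R e i)"
      using that by (intro sum.mono_neutral_left) (auto simp: not_less[symmetric])
    then show ?thesis by (simp add: seq_norm_def)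
  qed
  show ?thesis
    unfolding c00_seminorm_def
  proof (intro conjI allI impI)
    fix a b :: "nat \<Rightarrow> real" assume fin: "finite {i. a i \<noteq> 0}" "finite {i. b i \<noteq> 0}"
    obtain n n' where n: "\<And>i. n \<le> i \<Longrightarrow> a i = 0" "\<And>i. n' \<le> i \<Longrightarrow> b i = 0"
      using finite_supp_bounded[OF fin(1)] finite_supp_bounded[OF fin(2)] by metis
    have "seq_norm e (\<lambda>i. a i + b i) = norm ((\<Sum>i<max n n'. a i *\<^sub>R e i) + (\<Sum>i<max n n'. b i *\<^sub>R e i))"
      using eq[of "max n n'" "\<lambda>i. a i + b i"] n by (simp add: scaleR_add_left sum.distrib)
    also have "\<dots> \<le> seq_norm e a + seq_norm e b"
      using eq[of "max n n'" a] eq[of "max n n'" b] n by (simp add: norm_triangle_ineq)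
    finally show "seq_norm e (\<lambda>i. a i + b i) \<le> seq_norm e a + seq_norm e b" .
  next
    fix a :: "nat \<Rightarrow> real" and c :: real assume fin: "finite {i. a i \<noteq> 0}"
    obtain n where n: "\<And>i. n \<le> i \<Longrightarrow> a i = 0" using finite_supp_bounded[OF fin] by blast
    have "seq_norm e (\<lambda>i. c * a i) = norm (c *\<^sub>R (\<Sum>i<n. a i *\<^sub>R e i))"
      using eq[of n "\<lambda>i. c * a i"] n by (simp add: scaleR_sum_right)
    then show "seq_norm e (\<lambda>i. c * a i) = \<bar>c\<bar> * seq_norm e a" using eq[of n a] n by simp
  qed
qed

text \<open>Scaling removes the restriction to coefficients in [-1, 1], and since
  \<open>\<epsilon>\<close> decreases, \<open>1 + \<epsilon> 0\<close> serves for all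
  lengths.\<close>

lemma generates_sm_estimates:
  assumes gen: "generates_sm UNIV norm x S" and S: "c00_seminorm S"
  obtains C where "1 \<le> C"
    "\<And>a n k. strict_mono_on {..<n} k \<Longrightarrow> (0 < n \<longrightarrow> n \<le> k 0) \<Longrightarrow>
       S (trunc n a) \<le> C * norm (\<Sum>i<n. a i *\<^sub>R x (k i)) \<and> norm (\<Sum>i<n. a i *\<^sub>R x (k i)) \<le> C * S (trunc n a)"
proof -
  obtain \<epsilon> :: "nat \<Rightarrow> real" where \<epsilon>: "decseq \<epsilon>" "\<And>n. 0 < \<epsilon> n" and
    est: "\<And>n a k. (\<forall>i<n. \<bar>a i\<bar> \<le> 1) \<Longrightarrow> strict_mono_on {..<n} k \<Longrightarrow> (0 < n \<longrightarrow> n \<le> k 0) \<Longrightarrow>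
       inverse (1 + \<epsilon> n) * S (trunc n a) \<le> norm (\<Sum>i<n. a i *\<^sub>R x (k i)) \<and>
       norm (\<Sum>i<n. a i *\<^sub>R x (k i)) \<le> (1 + \<epsilon> n) * S (trunc n a)"
  proof -
    from gen obtain \<epsilon> :: "nat \<Rightarrow> real" where \<epsilon>: "decseq \<epsilon>" "\<forall>n. 0 < \<epsilon> n" and
      "\<forall>n (a::nat \<Rightarrow> real) (k::nat \<Rightarrow> nat).
          (\<forall>i<n. \<bar>a i\<bar> \<le> 1) \<and> strict_mono_on {..<n} k \<and> (0 < n \<longrightarrow> n \<le> k 0) \<longrightarrow>
          (let s = S (\<lambda>i. if i < n then a i else 0);
               t = norm (\<Sum>i<n. a i *\<^sub>R x (k i))
           in inverse (1 + \<epsilon> n) * s \<le> t \<and> t \<le> (1 + \<epsilon> n) * s)"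
      unfolding generates_sm_def by (elim conjE exE)
    then show ?thesis by (intro that[of \<epsilon>]) (simp_all add: Let_def trunc_def)
  qed
  have "S (trunc n a) \<le> (1 + \<epsilon> 0) * norm (\<Sum>i<n. a i *\<^sub>R x (k i)) \<and>
      norm (\<Sum>i<n. a i *\<^sub>R x (k i)) \<le> (1 + \<epsilon> 0) * S (trunc n a)"
    if k: "strict_mono_on {..<n} k" "0 < n \<longrightarrow> n \<le> k 0" for a n k
  proof -
    define A where "A = 1 + (\<Sum>i<n. \<bar>a i\<bar>)"
    have A0: "0 < A" by (simp add: A_def sum_nonneg add_pos_nonneg)
    have aA: "\<forall>i<n. \<bar>(1 / A) * a i\<bar> \<le> 1"
    proof (intro allI impI)
      fix i assume "i < n"
      then have "\<bar>a i\<bar> \<le> (\<Sum>i<n. \<bar>a i\<bar>)" by (intro member_le_sum) auto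
      then have "\<bar>a i\<bar> \<le> A" by (simp add: A_def)
      then show "\<bar>(1 / A) * a i\<bar> \<le> 1" using A0 by (simp add: abs_mult)
    qed
    have eq1: "S (trunc n (\<lambda>i. (1 / A) * a i)) = (1 / A) * S (trunc n a)"
      using c00_seminormD(2)[OF S, of n "1 / A" a] A0 by simp
    have eq2: "norm (\<Sum>i<n. ((1 / A) * a i) *\<^sub>R x (k i)) = (1 / A) * norm (\<Sum>i<n. a i *\<^sub>R x (k i))"
    proof -
      have "(\<Sum>i<n. ((1 / A) * a i) *\<^sub>R x (k i)) = (1 / A) *\<^sub>R (\<Sum>i<n. a i *\<^sub>R x (k i))"
        by (simp add: scaleR_sum_right)
      then show ?thesis using A0 by simp
    qed
    have "(1 / A) * (inverse (1 + \<epsilon> n) * S (trunc n a)) \<le> (1 / A) * norm (\<Sum>i<n. a i *\<^sub>R x (k i))"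
      "(1 / A) * norm (\<Sum>i<n. a i *\<^sub>R x (k i)) \<le> (1 / A) * ((1 + \<epsilon> n) * S (trunc n a))"
      using est[OF aA k] unfolding eq1 eq2 by (simp_all only: mult.left_commute)
    then have "inverse (1 + \<epsilon> n) * S (trunc n a) \<le> norm (\<Sum>i<n. a i *\<^sub>R x (k i))"
      "norm (\<Sum>i<n. a i *\<^sub>R x (k i)) \<le> (1 + \<epsilon> n) * S (trunc n a)"
      using A0 by (simp_all only: mult_le_cancel_left_pos zero_less_divide_1_iff)
    moreover have "\<epsilon> n \<le> \<epsilon> 0" using \<epsilon>(1) by (simp add: decseq_def)
    moreover have "0 < 1 + \<epsilon> n" using \<epsilon>(2)[of n] by simp
    moreover have "0 \<le> S (trunc n a)" by (rule c00_seminorm_nonneg[OF S]) simp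
    ultimately have "S (trunc n a) \<le> (1 + \<epsilon> n) * norm (\<Sum>i<n. a i *\<^sub>R x (k i))"
      "(1 + \<epsilon> n) * norm (\<Sum>i<n. a i *\<^sub>R x (k i)) \<le> (1 + \<epsilon> 0) * norm (\<Sum>i<n. a i *\<^sub>R x (k i))"
      "norm (\<Sum>i<n. a i *\<^sub>R x (k i)) \<le> (1 + \<epsilon> n) * S (trunc n a)"
      "(1 + \<epsilon> n) * S (trunc n a) \<le> (1 + \<epsilon> 0) * S (trunc n a)"
      by (simp_all add: field_simps mult_right_mono)
    then show ?thesis by linarith
  qed
  then show ?thesis using that[of "1 + \<epsilon> 0"] \<epsilon>(2)[of 0] by simp
qed

theorem theorem1p9:
  fixes x :: "nat \<Rightarrow> 'a::banach" and e :: "nat \<Rightarrow> 'e::banach"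
  assumes "separable_space (UNIV :: 'a set)"
    and "infinite_dim (UNIV :: 'a set)"
    and "countable (SPw (UNIV :: 'a set) norm)"
    and "\<forall>Y :: 'a set. subspace Y \<and> closed Y \<and> infinite_dim Y \<longrightarrow>
           countable (SPw (dual_space Y) (dual_norm Y))"
    and "weakly_null UNIV norm x"
    and "generates_sm UNIV norm x (seq_norm e)"
  shows "sm_equiv (seq_norm e) c0_norm \<or> (\<exists>p. 1 \<le> p \<and> sm_equiv (seq_norm e) (lp_norm p))"
proof -
  define S where "S = seq_norm e"
  have S: "c00_seminorm S" unfolding S_def by (rule c00_seminorm_seq_norm)
  have subseq: "weakly_null UNIV norm (\<lambda>i. v (m i))" if "weakly_null UNIV norm v" "strict_mono m" for v :: "nat \<Rightarrow> 'a" and m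
    using that LIMSEQ_subseq_LIMSEQ[OF _ that(2)] by (fastforce simp: weakly_null_def o_def)
  have x1: "norm (x i) = 1" for i using assms(6) by (simp add: generates_sm_def normalized_basic_def)
  obtain m1 :: "nat \<Rightarrow> nat" where m1: "strict_mono m1"
    "\<And>a t n. t \<le> n \<Longrightarrow> norm (\<Sum>i<t. a i *\<^sub>R x (m1 i)) \<le> 4 * norm (\<Sum>i<n. a i *\<^sub>R x (m1 i))"
    using basic_subsequence[OF assms(5) x1] by blast
  have wn1: "weakly_null UNIV norm (\<lambda>i. x (m1 i))" by (rule subseq[OF assms(5) m1(1)])
  obtain m2 :: "nat \<Rightarrow> nat" where m2: "strict_mono m2"
    "\<And>a F n. F \<subseteq> {..<n} \<Longrightarrow> (\<And>i. i \<in> F \<Longrightarrow> card F \<le> i) \<Longrightarrow>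
       norm (\<Sum>i\<in>F. a i *\<^sub>R x (m1 (m2 i))) \<le> (2 + 24 * 4) * norm (\<Sum>i<n. a i *\<^sub>R x (m1 (m2 i)))"
    using schreier_unconditional_subsequence[OF wn1 x1 m1(2)] by blast
  define m where "m = (\<lambda>i. m1 (m2 i))"
  have m: "strict_mono m" using m1(1) m2(1) by (simp add: m_def strict_mono_def)
  define z where "z = (\<lambda>i. x (m i))"
  obtain C where C: "1 \<le> C"
    "\<And>a n k. strict_mono_on {..<n} k \<Longrightarrow> (0 < n \<longrightarrow> n \<le> k 0) \<Longrightarrow>
       S (trunc n a) \<le> C * norm (\<Sum>i<n. a i *\<^sub>R x (k i)) \<and> norm (\<Sum>i<n. a i *\<^sub>R x (k i)) \<le> C * S (trunc n a)"
    using generates_sm_estimates[OF assms(6)[folded S_def] S] by blast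
  \<comment> \<open>A subsequence moves indices to the right, so admissible index sets stay
    admissible.\<close>
  have est: "S (trunc n a) \<le> C * norm (\<Sum>i<n. a i *\<^sub>R z (k i)) \<and> norm (\<Sum>i<n. a i *\<^sub>R z (k i)) \<le> C * S (trunc n a)"
    if k: "strict_mono_on {..<n} k" "0 < n \<longrightarrow> n \<le> k 0" for a n k
  proof -
    have "strict_mono_on {..<n} (\<lambda>i. m (k i))" using k(1) m by (simp add: strict_mono_on_def strict_mono_def)
    moreover have "0 < n \<longrightarrow> n \<le> m (k 0)" using k(2) strict_mono_imp_increasing[OF m, of "k 0"] by auto
    ultimately show ?thesis using C(2)[of n "\<lambda>i. m (k i)" a] by (simp add: z_def)
  qed
  interpret X: seminormed UNIV "norm :: 'a \<Rightarrow> real" by (rule seminormed_UNIV)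
  \<comment> \<open>98 is \<open>2 + 24 * 4\<close>, from the basis constant 4, and is used as basis
    constant as well.\<close>
  interpret schreier_basis z 98 C S
  proof
    have "X.basis_const (\<lambda>i. x (m1 i)) 4" unfolding X.basis_const_def using m1(2) by simp
    from X.basis_const_subseq[OF this m2(1)] have b4: "X.basis_const z 4" by (simp add: z_def m_def)
    show "X.basis_const z 98"
      unfolding X.basis_const_def
    proof (intro conjI allI impI)
      fix a :: "nat \<Rightarrow> real" and t n :: nat assume "t \<le> n"
      from X.basis_constD(2)[OF b4 this, of a]
      show "norm (\<Sum>i<t. a i *\<^sub>R z i) \<le> 98 * norm (\<Sum>i<n. a i *\<^sub>R z i)" by (rule order_trans) simp
    qed simp
    show "norm (\<Sum>i\<in>F. a i *\<^sub>R z i) \<le> 98 * norm (\<Sum>i<n. a i *\<^sub>R z i)"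
      if "F \<subseteq> {..<n}" "\<And>i. i \<in> F \<Longrightarrow> card F \<le> i" for a F n
      using m2(2)[OF that, of a] by (simp add: z_def m_def)
    show "norm (z i) = 1" for i by (simp add: z_def x1)
    \<comment> \<open>\<open>Suc\<close> starts at 1: a single vector is admissible only from index
      1 on.\<close>
    have "strict_mono_on {..<1::nat} Suc" by (auto simp: strict_mono_on_def)
    then have "norm (\<Sum>i<1. 1 *\<^sub>R z (Suc i)) \<le> C * S (trunc 1 (\<lambda>_. 1))"
      using est[of 1 Suc "\<lambda>_. 1"] by simp
    then have "0 < C * S (trunc 1 (\<lambda>_. 1))" by (simp add: z_def x1)
    then show "0 < S (trunc 1 (\<lambda>_. 1))" by (rule zero_less_mult_pos) (use C(1) in simp)
  qed (use est C(1) S in auto)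
  show ?thesis
  proof (cases "\<exists>B. \<forall>n. S (trunc n (\<lambda>_. 1)) \<le> B")
    case True
    then show ?thesis using c0_equiv unfolding S_def by blast
  next
    case False
    then have unb: "\<exists>n. B < S (trunc n (\<lambda>_. 1))" for B by (meson not_le)
    have wnz: "weakly_null UNIV norm z" unfolding z_def by (rule subseq[OF assms(5) m])
    obtain E1 where E1: "\<And>m n a b. 0 < n \<Longrightarrow> S (trunc (m * n) (tens n a b)) \<le> E1 * (S (trunc m a) * S (trunc n b))"
      using submultiplicative[OF wnz assms(3)] by blast
    have "countable (SPw (dual_space Y) (dual_norm Y))"
      using assms(4) subspace_Y infinite_dim_Y by (simp add: Y_def)
    from supermultiplicative[OF unb this] obtain E2 where
      E2: "\<And>m n a b. 0 < n \<Longrightarrow> S (trunc m a) * S (trunc n b) \<le> E2 * S (trunc (m * n) (tens n a b))" by blast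
    define E where "E = 1 + \<bar>E1\<bar> + \<bar>E2\<bar>"
    have "\<exists>p. 1 \<le> p \<and> sm_equiv S (lp_norm p)"
    proof (rule lp_equiv[where E=E])
      show "1 \<le> E" by (simp add: E_def)
      show "S (trunc (m * n) (tens n a b)) \<le> E * (S (trunc m a) * S (trunc n b))" if "0 < n" for m n a b
        by (rule order_trans[OF E1[OF that] mult_right_mono]) (auto simp: E_def intro!: mult_nonneg_nonneg T_nonneg)
      show "S (trunc m a) * S (trunc n b) \<le> E * S (trunc (m * n) (tens n a b))" if "0 < n" for m n a b
        by (rule order_trans[OF E2[OF that] mult_right_mono[OF _ T_nonneg]]) (simp add: E_def)
      show "\<exists>n. B < S (trunc n (\<lambda>_. 1))" for B by (rule unb)
    qed
    then show ?thesis unfolding S_def by blast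
  qed
qed

end
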